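(* Let $\Delta\subset\mathfrak t^*$ be a convex quadrilateral. For any linear function $a\in\mathfrak t$ equipoised on $\Delta$ there is a $2$-dimensional cone of inward normals $u$ for which $(\Delta,u)$ admits a generalized Kähler–Ricci soliton $(g,a)$ with a Hamiltonian $2$-form. This cone contains a codimension $1$ subcone of inward normals $u$ for which $(\Delta,u)$ is monotone.
   Context: $\mathfrak t$ is a $2$-dimensional real vector space. A labelling of $\Delta$ with edges $F_1,\dots,F_4$ is a choice $u=\{u_1,\dots,u_4\}\subset\mathfrak t$ with $u_k$ an inward normal to $F_k$ (no rationality assumed); the set of labellings is identified with $\mathbb R_{>0}^4$ by the lengths of the $u_k$ relative to fixed normals; a cone of inward normals is a subset stable under multiplying all $u_k$ by a common positive number. With $L_k$ the affine function with $dL_k=u_k$, $L_k|_{F_k}=0$, $(\Delta,u)$ is monotone if there is $p\in\Delta$ with $L_1(p)=\dots=L_4(p)$. If $\Delta$ has vertices $s_1,\dots,s_4$, $s_1$ not consecutive to $s_3$, an affine function $f$ is equipoised if $\sum_i(-1)^if(s_i)=0$. The set $\mathcal S(\Delta,u)$ of symplectic potentials is the set of smooth strictly convex functions $\phi$ on $\mathring\Delta$ such that $\mathbf H=(\mathrm{Hess}\,\phi)^{-1}$ extends to a smooth $S^2\mathfrak t^*$-valued function on $\Delta$ with $\mathbf H_y(u_i,\cdot)=0$, $d\mathbf H_y(u_i,u_i)=2u_i$ for $y$ in the interior of $F_i$, and such that $\mathbf H$ restricted to the interior of any face $F$ is positive definite as an $S^2(\mathfrak t/\mathfrak t_F)^*$-valued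 function ($\mathfrak t_F$ the span of the normals of facets containing $F$, $(\mathfrak t/\mathfrak t_F)^*\simeq TF$). Such $\phi$ defines the Kähler metric $g_\phi=\sum G_{ij}d\mu_id\mu_j+\sum H_{ij}dt_idt_j$ on $\mathring\Delta\times\mathbb R^2$, with $\omega=\sum d\mu_i\wedge dt_i$, $(G_{ij})=\mathrm{Hess}\,\phi=(H_{ij})^{-1}$. $(\Delta,u)$ admits a generalized Kähler–Ricci soliton $(g,a)$ if $g=g_\phi$, $\phi\in\mathcal S(\Delta,u)$, and $-\sum_{i,j}\frac{\partial^2H_{ij}}{\partial\mu_i\partial\mu_j}+2\sum_{i,j}a_j\frac{\partial H_{ij}}{\partial\mu_i}=\overline{Scal}$, where $\overline{Scal}=2\int_{\partial\Delta}d\ell_u/\int_\Delta dv$ and $u_k\wedge d\ell_u=-dv$ on $F_k$. A Hamiltonian $2$-form of a Kähler structure $(g,J,\omega)$ is a real $J$-invariant $2$-form $\phi$ with $\nabla_Z\phi=\frac12(d\tau\wedge(JZ)^\flat-d^c\tau\wedge Z^\flat)$ for all $Z$, $\tau=\langle\phi,\omega\rangle$, understood to be non-trivial (not a constant multiple of $\omega$). *)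

theory Defs
  imports "HOL-Analysis.Analysis"
begin

section \<open>Smooth functions, partial derivatives and submanifolds\<close>

text \<open>The dual pair of planes \<open>\<tt>\<close> and \<open>\<tt>\<^sup>*\<close> is written in linear coordinates: both are \<^typ>\<open>real^2\<close>,
  and the pairing of a vector with a covector is the standard inner product.\<close>

primrec Ck_on :: "nat \<Rightarrow> 'a::euclidean_space set \<Rightarrow> ('a \<Rightarrow> 'b::real_normed_vector) \<Rightarrow> bool" where
  "Ck_on 0 U f \<longleftrightarrow> continuous_on U f"
| "Ck_on (Suc k) U f \<longleftrightarrow> (\<forall>x\<in>U. f differentiable (at x)) \<and>
     (\<forall>v. Ck_on k U (\<lambda>x. frechet_derivative f (at x) v))"

definition smooth_on :: "'a::euclidean_space set \<Rightarrow> ('a \<Rightarrow> 'b::real_normed_vector) \<Rightarrow> bool" where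
  "smooth_on U f \<longleftrightarrow> open U \<and> (\<forall>k. Ck_on k U f)"

definition pdiff :: "'n::finite \<Rightarrow> (real^'n \<Rightarrow> real) \<Rightarrow> real^'n \<Rightarrow> real" where
  "pdiff i f x = frechet_derivative f (at x) (axis i 1)"

definition hess :: "(real^'n \<Rightarrow> real) \<Rightarrow> real^'n \<Rightarrow> real^'n^'n" where
  "hess f x = (\<chi> i j. pdiff i (pdiff j f) x)"

definition strictly_convex_on :: "'a::real_vector set \<Rightarrow> ('a \<Rightarrow> real) \<Rightarrow> bool" where
  "strictly_convex_on S f \<longleftrightarrow> convex S \<and>
     (\<forall>x\<in>S. \<forall>y\<in>S. \<forall>t. x \<noteq> y \<and> 0 < t \<and> t < 1 \<longrightarrow>
        f ((1 - t) *\<^sub>R x + t *\<^sub>R y) < (1 - t) * f x + t * f y)"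

text \<open>Smooth embedded submanifolds of a Euclidean space, described by slice charts.\<close>

definition submanifold :: "nat \<Rightarrow> 'a::euclidean_space set \<Rightarrow> bool" where
  "submanifold d S \<longleftrightarrow>
     (\<forall>x\<in>S. \<exists>U V (F :: 'a \<Rightarrow> 'a) F' T. x \<in> U \<and> smooth_on U F \<and> smooth_on V F' \<and>
        homeomorphism U V F F' \<and> subspace T \<and> dim T = d \<and> F ` (S \<inter> U) = T \<inter> V)"

section \<open>Labelled quadrilaterals\<close>

text \<open>Vertices are listed in cyclic order, with indices in the type \<^typ>\<open>4\<close> of integers modulo 4
  (so \<open>4 = 0\<close>).  The edge \<open>F\<^sub>k\<close> joins \<open>s\<^sub>k\<close> to \<open>s\<^sub>k\<^sub>+\<^sub>1\<close>.\<close>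

definition edge :: "(4 \<Rightarrow> real^2) \<Rightarrow> 4 \<Rightarrow> (real^2) set" where
  "edge s k = closed_segment (s k) (s (k + 1))"

definition convex_quadrilateral :: "(real^2) set \<Rightarrow> (4 \<Rightarrow> real^2) \<Rightarrow> bool" where
  "convex_quadrilateral \<Delta> s \<longleftrightarrow> polytope \<Delta> \<and> inj s \<and>
     {x. x extreme_point_of \<Delta>} = range s \<and> (\<forall>k. edge s k edge_of \<Delta>)"

definition equipoised :: "(4 \<Rightarrow> real^2) \<Rightarrow> (real^2 \<Rightarrow> real) \<Rightarrow> bool" where
  "equipoised s f \<longleftrightarrow> - f (s 1) + f (s 2) - f (s 3) + f (s 4) = 0"

definition inward_normal :: "(real^2) set \<Rightarrow> (real^2) set \<Rightarrow> real^2 \<Rightarrow> bool" where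
  "inward_normal \<Delta> F v \<longleftrightarrow> v \<noteq> 0 \<and> (\<forall>x\<in>F. \<forall>y\<in>\<Delta>. v \<bullet> x \<le> v \<bullet> y)"

definition labelling :: "(real^2) set \<Rightarrow> (4 \<Rightarrow> real^2) \<Rightarrow> (4 \<Rightarrow> real^2) \<Rightarrow> bool" where
  "labelling \<Delta> s u \<longleftrightarrow> (\<forall>k. inward_normal \<Delta> (edge s k) (u k))"

definition edge_function :: "(4 \<Rightarrow> real^2) \<Rightarrow> (4 \<Rightarrow> real^2) \<Rightarrow> 4 \<Rightarrow> real^2 \<Rightarrow> real" where
  "edge_function s u k x = u k \<bullet> (x - s k)"

definition monotone_labelling :: "(real^2) set \<Rightarrow> (4 \<Rightarrow> real^2) \<Rightarrow> (4 \<Rightarrow> real^2) \<Rightarrow> bool" where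
  "monotone_labelling \<Delta> s u \<longleftrightarrow>
     (\<exists>p\<in>\<Delta>. \<forall>k l. edge_function s u k p = edge_function s u l p)"

text \<open>A labelling is identified with the point of the open positive orthant of \<^typ>\<open>real^4\<close> given by
  the lengths of its normals relative to the unit ones; another choice of fixed normals
  rescales these four coordinates and does not affect submanifolds or their dimension.\<close>

definition label_lengths :: "(4 \<Rightarrow> real^2) \<Rightarrow> real^4" where
  "label_lengths u = (\<chi> k. norm (u k))"

definition cone_of_normals :: "(real^2) set \<Rightarrow> (4 \<Rightarrow> real^2) \<Rightarrow> nat \<Rightarrow> (4 \<Rightarrow> real^2) set \<Rightarrow> bool" where
  "cone_of_normals \<Delta> s d C \<longleftrightarrow> C \<noteq> {} \<and> (\<forall>u\<in>C. labelling \<Delta> s u) \<and>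
     (\<forall>u\<in>C. \<forall>c>0. (\<lambda>k. c *\<^sub>R u k) \<in> C) \<and> submanifold d (label_lengths ` C)"

section \<open>Symplectic potentials and generalized solitons\<close>

definition inv_hess :: "(real^2 \<Rightarrow> real) \<Rightarrow> real^2 \<Rightarrow> real^2^2" where
  "inv_hess \<phi> x = matrix_inv (hess \<phi> x)"

text \<open>\<open>bilin A v w\<close> is the value of the bilinear form with matrix \<open>A\<close>.\<close>

definition bilin :: "real^'n^'n \<Rightarrow> real^'n \<Rightarrow> real^'n \<Rightarrow> real" where
  "bilin A v w = v \<bullet> (A *v w)"

definition normal_span :: "(4 \<Rightarrow> real^2) \<Rightarrow> (4 \<Rightarrow> real^2) \<Rightarrow> (real^2) set \<Rightarrow> (real^2) set" where
  "normal_span s u F = span {u k |k. F \<subseteq> edge s k}"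

text \<open>A function is smooth on the closed set \<open>\<Delta>\<close> if it is smooth on some open neighbourhood of \<open>\<Delta>\<close>.
  In the last clause, a form that is positive definite on the quotient by \<open>normal_span s u F\<close> is
  one that is positive on every vector outside that subspace (the forms in question
  vanish on the subspace); the case \<open>F = \<Delta>\<close> is included.\<close>

definition symplectic_potentials ::
  "(real^2) set \<Rightarrow> (4 \<Rightarrow> real^2) \<Rightarrow> (4 \<Rightarrow> real^2) \<Rightarrow> (real^2 \<Rightarrow> real) set" where
  "symplectic_potentials \<Delta> s u = {\<phi>.
     smooth_on (interior \<Delta>) \<phi> \<and> strictly_convex_on (interior \<Delta>) \<phi> \<and>
     (\<forall>x\<in>interior \<Delta>. invertible (hess \<phi> x)) \<and>
     (\<exists>U (H :: real^2 \<Rightarrow> real^2^2). \<Delta> \<subseteq> U \<and> smooth_on U H \<and>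
        (\<forall>x\<in>interior \<Delta>. H x = inv_hess \<phi> x) \<and>
        (\<forall>k. \<forall>y\<in>rel_interior (edge s k).
           (\<forall>v. bilin (H y) (u k) v = 0) \<and>
           ((\<lambda>x. bilin (H x) (u k) (u k)) has_derivative (\<lambda>v. 2 * (u k \<bullet> v))) (at y)) \<and>
        (\<forall>F. F face_of \<Delta> \<longrightarrow>
           (\<forall>y\<in>rel_interior F. \<forall>v. v \<notin> normal_span s u F \<longrightarrow> 0 < bilin (H y) v v)))}"

text \<open>A covector \<open>\<theta>\<close> with \<open>u \<and> \<theta> = - d\<mu>\<^sub>1 \<and> d\<mu>\<^sub>2\<close>; it is unique up to multiples of \<open>u\<close>, which
  vanish along an edge with normal \<open>u\<close>.\<close>

definition edge_covector :: "real^2 \<Rightarrow> real^2" where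
  "edge_covector u = (SOME \<theta>. u$1 * \<theta>$2 - u$2 * \<theta>$1 = -1)"

text \<open>The total mass of the boundary for \<open>d\<ell>\<^sub>u\<close>: the integral of a constant 1-form along an edge is
  its value on the edge vector, and the absolute value makes the result
  independent of the sense in which the vertices are listed.\<close>

definition boundary_mass :: "(4 \<Rightarrow> real^2) \<Rightarrow> (4 \<Rightarrow> real^2) \<Rightarrow> real" where
  "boundary_mass s u = (\<Sum>k\<in>UNIV. \<bar>edge_covector (u k) \<bullet> (s (k + 1) - s k)\<bar>)"

definition average_scal :: "(real^2) set \<Rightarrow> (4 \<Rightarrow> real^2) \<Rightarrow> (4 \<Rightarrow> real^2) \<Rightarrow> real" where
  "average_scal \<Delta> s u = 2 * boundary_mass s u / measure lebesgue \<Delta>"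

text \<open>Points of \<open>interior \<Delta> \<times> \<real>\<^sup>2\<close> are vectors indexed by \<^typ>\<open>2 + 2\<close>:
  \<open>Inl i\<close> is the coordinate \<open>\<mu>\<^sub>i\<close> and \<open>Inr i\<close> is \<open>t\<^sub>i\<close>.\<close>

definition mu :: "real^(2+2) \<Rightarrow> real^2" where
  "mu z = (\<chi> i. z $ Inl i)"

definition toric_domain :: "(real^2) set \<Rightarrow> (real^(2+2)) set" where
  "toric_domain \<Delta> = {z. mu z \<in> interior \<Delta>}"

definition toric_metric :: "(real^2 \<Rightarrow> real) \<Rightarrow> real^(2+2) \<Rightarrow> real^(2+2)^(2+2)" where
  "toric_metric \<phi> z = (\<chi> p q. case (p, q) of
       (Inl i, Inl j) \<Rightarrow> hess \<phi> (mu z) $ i $ j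
     | (Inr i, Inr j) \<Rightarrow> inv_hess \<phi> (mu z) $ i $ j
     | _ \<Rightarrow> 0)"

definition toric_form :: "real^(2+2) \<Rightarrow> real^(2+2)^(2+2)" where
  "toric_form z = (\<chi> p q. case (p, q) of
       (Inl i, Inr j) \<Rightarrow> if i = j then 1 else 0
     | (Inr i, Inl j) \<Rightarrow> if i = j then -1 else 0
     | _ \<Rightarrow> 0)"

definition generalized_KRS ::
  "(real^2) set \<Rightarrow> (4 \<Rightarrow> real^2) \<Rightarrow> (4 \<Rightarrow> real^2) \<Rightarrow>
   (real^(2+2) \<Rightarrow> real^(2+2)^(2+2)) \<Rightarrow> real^2 \<Rightarrow> bool" where
  "generalized_KRS \<Delta> s u g a \<longleftrightarrow>
     (\<exists>\<phi>\<in>symplectic_potentials \<Delta> s u. g = toric_metric \<phi> \<and>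
       (\<forall>x\<in>interior \<Delta>.
          - (\<Sum>i\<in>UNIV. \<Sum>j\<in>UNIV. pdiff i (pdiff j (\<lambda>y. inv_hess \<phi> y $ i $ j)) x)
          + 2 * (\<Sum>i\<in>UNIV. \<Sum>j\<in>UNIV. a $ j * pdiff i (\<lambda>y. inv_hess \<phi> y $ i $ j) x)
          = average_scal \<Delta> s u))"

section \<open>Hamiltonian 2-forms\<close>

text \<open>Metrics and 2-forms on an open subset of \<open>\<real>\<^sup>n\<close> are matrix-valued functions \<open>(g\<^sub>i\<^sub>j)\<close>, \<open>(\<psi>\<^sub>i\<^sub>j)\<close> with
  \<open>\<psi>\<^sub>i\<^sub>j = \<psi>(\<partial>\<^sub>i, \<partial>\<^sub>j)\<close>; 1-forms and vectors are column vectors.\<close>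

definition christoffel :: "(real^'n \<Rightarrow> real^'n^'n) \<Rightarrow> real^'n \<Rightarrow> 'n \<Rightarrow> 'n \<Rightarrow> 'n \<Rightarrow> real" where
  "christoffel g x k i j = (1/2) * (\<Sum>l\<in>UNIV. matrix_inv (g x) $ k $ l *
     (pdiff i (\<lambda>y. g y $ j $ l) x + pdiff j (\<lambda>y. g y $ i $ l) x - pdiff l (\<lambda>y. g y $ i $ j) x))"

definition cov_deriv ::
  "(real^'n \<Rightarrow> real^'n^'n) \<Rightarrow> (real^'n \<Rightarrow> real^'n^'n) \<Rightarrow> real^'n \<Rightarrow> real^'n \<Rightarrow> real^'n^'n" where
  "cov_deriv g \<psi> x Z = (\<chi> i j. \<Sum>m\<in>UNIV. Z $ m *
     (pdiff m (\<lambda>y. \<psi> y $ i $ j) x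
      - (\<Sum>l\<in>UNIV. christoffel g x l m i * \<psi> x $ l $ j)
      - (\<Sum>l\<in>UNIV. christoffel g x l m j * \<psi> x $ i $ l)))"

definition wedge :: "real^'n \<Rightarrow> real^'n \<Rightarrow> real^'n^'n" where
  "wedge \<alpha> \<beta> = (\<chi> i j. \<alpha> $ i * \<beta> $ j - \<alpha> $ j * \<beta> $ i)"

definition flat :: "(real^'n \<Rightarrow> real^'n^'n) \<Rightarrow> real^'n \<Rightarrow> real^'n \<Rightarrow> real^'n" where
  "flat g x Z = g x *v Z"

definition ext_d :: "(real^'n \<Rightarrow> real) \<Rightarrow> real^'n \<Rightarrow> real^'n" where
  "ext_d f x = (\<chi> i. pdiff i f x)"

text \<open>Convention: \<open>d\<^sup>c f = - df \<circ> J\<close>.  This is the sign for which the right-hand side of the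
  equation of Hamiltonian 2-forms is \<open>J\<close>-invariant.\<close>

definition ext_dc :: "(real^'n \<Rightarrow> real^'n^'n) \<Rightarrow> (real^'n \<Rightarrow> real) \<Rightarrow> real^'n \<Rightarrow> real^'n" where
  "ext_dc J f x = - (transpose (J x) *v ext_d f x)"

text \<open>Inner product of 2-forms, normalized so that \<open>e\<^sub>1 \<and> e\<^sub>2\<close> has norm 1 for \<open>e\<^sub>1\<close>, \<open>e\<^sub>2\<close> orthonormal.\<close>

definition form_inner :: "real^'n^'n \<Rightarrow> real^'n^'n \<Rightarrow> real^'n^'n \<Rightarrow> real" where
  "form_inner G \<psi> \<omega> = (1/2) * (\<Sum>i\<in>UNIV. \<Sum>j\<in>UNIV. \<Sum>k\<in>UNIV. \<Sum>l\<in>UNIV.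
     matrix_inv G $ i $ k * matrix_inv G $ j $ l * \<psi> $ i $ j * \<omega> $ k $ l)"

text \<open>The endomorphism \<open>J\<close> with \<open>\<omega>(X, Y) = g(J X, Y)\<close>, the convention compatible with
  \<open>\<nabla>\<^sub>Z \<tau> = \<langle>\<nabla>\<^sub>Z \<psi>, \<omega>\<rangle>\<close> in the equation below.\<close>

definition complex_structure ::
  "(real^'n \<Rightarrow> real^'n^'n) \<Rightarrow> (real^'n \<Rightarrow> real^'n^'n) \<Rightarrow> real^'n \<Rightarrow> real^'n^'n" where
  "complex_structure g \<omega> x = matrix_inv (g x) ** transpose (\<omega> x)"

definition hamiltonian_2form ::
  "(real^'n) set \<Rightarrow> (real^'n \<Rightarrow> real^'n^'n) \<Rightarrow> (real^'n \<Rightarrow> real^'n^'n) \<Rightarrow>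
   (real^'n \<Rightarrow> real^'n^'n) \<Rightarrow> (real^'n \<Rightarrow> real^'n^'n) \<Rightarrow> bool" where
  "hamiltonian_2form M g J \<omega> \<psi> \<longleftrightarrow> smooth_on M \<psi> \<and>
     (\<forall>x\<in>M. transpose (\<psi> x) = - \<psi> x \<and> transpose (J x) ** \<psi> x ** J x = \<psi> x) \<and>
     (let \<tau> = (\<lambda>x. form_inner (g x) (\<psi> x) (\<omega> x)) in
      \<forall>x\<in>M. \<forall>Z. cov_deriv g \<psi> x Z =
        (1/2) *\<^sub>R (wedge (ext_d \<tau> x) (flat g x (J x *v Z)) - wedge (ext_dc J \<tau> x) (flat g x Z))) \<and>
     \<not> (\<exists>c. \<forall>x\<in>M. \<psi> x = c *\<^sub>R \<omega> x)"

end

theory Submission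
  imports Defs
begin

text \<open>Let \<open>P\<close>, \<open>P + Q\<close>, \<open>P + Q + R + S\<close>, \<open>P + R\<close> be the vertices in cyclic order, with \<open>S = c Q + d R\<close>.
  The bilinear parametrization \<open>\<mu> = P + x Q + y R + x y S\<close> of the quadrilateral by the unit square
  provides the orthotoric coordinates (generic case), those of the Calabi construction (trapezoids) and
  product coordinates (parallelograms) all at once.  With \<open>p = \<partial>\<mu>/\<partial>x\<close>, \<open>q = \<partial>\<mu>/\<partial>y\<close> and
  \<open>D = 1 + c y + d x\<close>, every pair of functions \<open>A\<close>, \<open>B\<close>, positive on \<open>(0, 1)\<close> and vanishing at the ends,
  gives \<open>H = (A(x) p \<otimes> p + B(y) q \<otimes> q) / D\<close>, whose inverse is the Hessian of an explicit potential.
  The endomorphism with eigenvalues \<open>1 + d x\<close> and \<open>- c y\<close> in the frame \<open>(p, q)\<close> is an affine function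
  of \<open>\<mu>\<close>; its symmetry with respect to the metric already implies the equation of Hamiltonian 2-forms.

  If \<open>a\<close> is equipoised, i.e. \<open>a \<bullet> S = 0\<close>, then \<open>a \<bullet> p\<close> and \<open>a \<bullet> q\<close> are constant and the soliton equation
  separates into linear equations for \<open>A\<close> and \<open>B\<close>, whose solutions vanishing at the ends form a
  2-dimensional space.  The labels are the reciprocals of the boundary derivatives of \<open>A\<close> and \<open>B\<close>,
  which accounts for the 2-dimensional cone.  A ray of monotone labels is obtained by
  taking for the point \<open>p\<close> of the definition the barycenter of the quadrilateral with respect to \<open>exp (- 2 a \<bullet> \<mu>)\<close>.\<close>

section \<open>Functions of class C^k\<close>

text \<open>Put \<alpha> = a \<bullet> Q and \<beta> = a \<bullet> R. Separation leaves two
  parameters: the average scalar curvature and a separation constant that can be moved from the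
  equation for \<open>A\<close> to the one for \<open>B\<close>. The boundary slopes depend linearly
  on them, so inverting the label coordinates one by one straightens the cone into an open piece of
  a plane in \<open>real^4\<close>. The obstacle is positivity of \<open>A\<close> and
  \<open>B\<close> on (0, 1), which second-order equations do not give for every choice of the
  parameters. It is secured on one ray, where the equations integrate to A' = 2 \<alpha> A - (x - X)
  (1 + c Y + d x) and B' = 2 \<beta> B - (y - Y) (1 + d X + c y): each inhomogeneous term changes
  sign exactly once. The conditions A(1) = 0 and B(1) = 0 couple \<open>X\<close> to
  \<open>Y\<close>; a fixed point in one variable solves them. The end slopes are then the values at
  (X, Y) of fixed edge functions, whence the monotonicity. Near this ray positivity persists,
  because the perturbing profiles are bounded by multiples of the positive ones up to the ends of
  the interval.\<close>

lemma frechet_derivative_worksI: "f differentiable F \<Longrightarrow> (f has_derivative frechet_derivative f F) F"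
  using frechet_derivative_works by blast

text \<open>\<open>Ck_on\<close> is stated with the chosen \<open>frechet_derivative\<close>. On an
  open set the derivative is unique, so any family of derivatives will do; the closure rules below
  work with this form.\<close>

lemma Ck_on_Suc_iff:
  assumes "open U"
  shows "Ck_on (Suc k) U f \<longleftrightarrow>
    (\<exists>f'. (\<forall>x\<in>U. (f has_derivative f' x) (at x)) \<and> (\<forall>v. Ck_on k U (\<lambda>x. f' x v)))"
    (is "?l \<longleftrightarrow> ?r")
proof
  assume l: ?l
  have "(f has_derivative frechet_derivative f (at x)) (at x)" if "x \<in> U" for x
    using l that by (simp add: frechet_derivative_worksI)
  moreover have "Ck_on k U (\<lambda>x. frechet_derivative f (at x) v)" for v
    using l by simp
  ultimately show ?r
    by (intro exI[of _ "\<lambda>x. frechet_derivative f (at x)"] conjI ballI allI)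
next
  \<comment> \<open>A derivative that agrees with \<open>frechet_derivative\<close> only on
    \<open>U\<close> must be exchangeable under \<open>Ck_on\<close>, which is applied to functions
    defined everywhere.\<close>
  have cong: "Ck_on k U g" if "Ck_on k U h" "\<And>x. x \<in> U \<Longrightarrow> h x = g x" for k and g h :: "'a \<Rightarrow> 'b"
    using that
  proof (induction k arbitrary: g h)
    case 0
    then show ?case
      using continuous_on_eq[of U h g] by simp
  next
    case (Suc k)
    have D: "(g has_derivative frechet_derivative h (at x)) (at x)" if "x \<in> U" for x
    proof (rule has_derivative_transform_within_open[OF frechet_derivative_worksI assms that])
      show "h differentiable at x"
        using Suc.prems(1) that by simp
    qed (use Suc.prems(2) in auto)
    have "Ck_on k U (\<lambda>x. frechet_derivative g (at x) v)" for v
    proof (rule Suc.IH)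
      show "Ck_on k U (\<lambda>x. frechet_derivative h (at x) v)"
        using Suc.prems by simp
      show "frechet_derivative h (at x) v = frechet_derivative g (at x) v" if "x \<in> U" for x
        by (rule fun_cong[OF frechet_derivative_at[OF D[OF that]]])
    qed
    moreover have "\<forall>x\<in>U. g differentiable (at x)"
      using D differentiable_def by blast
    ultimately show ?case by simp
  qed
  assume ?r
  then obtain f' where f': "\<And>x. x \<in> U \<Longrightarrow> (f has_derivative f' x) (at x)"
    "\<And>v. Ck_on k U (\<lambda>x. f' x v)"
    by blast
  have "Ck_on k U (\<lambda>x. frechet_derivative f (at x) v)" for v
    by (rule cong[OF f'(2)[of v]]) (rule fun_cong[OF frechet_derivative_at[OF f'(1)]])
  moreover have "\<forall>x\<in>U. f differentiable (at x)"
    using f'(1) differentiable_def by blast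
  ultimately show ?l by simp
qed

lemma Ck_on_SucI:
  assumes "open U" "\<And>x. x \<in> U \<Longrightarrow> (f has_derivative f' x) (at x)" "\<And>v. Ck_on k U (\<lambda>x. f' x v)"
  shows "Ck_on (Suc k) U f"
  unfolding Ck_on_Suc_iff[OF assms(1)] using assms by blast

lemma Ck_on_SucE:
  assumes "Ck_on (Suc k) U f" "open U"
  obtains f' where "\<And>x. x \<in> U \<Longrightarrow> (f has_derivative f' x) (at x)" "\<And>v. Ck_on k U (\<lambda>x. f' x v)"
  using assms unfolding Ck_on_Suc_iff[OF assms(2)] by blast

lemma Ck_on_cong:
  assumes "Ck_on k U f" "open U" "\<And>x. x \<in> U \<Longrightarrow> f x = g x"
  shows "Ck_on k U g"
proof (cases k)
  case 0
  then show ?thesis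
    using assms continuous_on_eq[of U f g] by simp
next
  case (Suc m)
  obtain f' where f': "\<And>x. x \<in> U \<Longrightarrow> (f has_derivative f' x) (at x)"
    "\<And>v. Ck_on m U (\<lambda>x. f' x v)"
    by (rule Ck_on_SucE[OF assms(1)[unfolded Suc] assms(2)]) (rule that)
  have "(g has_derivative f' x) (at x)" if "x \<in> U" for x
    using f'(1)[OF that] assms that
    by (auto intro!: has_derivative_transform_within_open[of f _ x UNIV U])
  then show ?thesis
    unfolding Suc by (rule Ck_on_SucI[OF assms(2) _ f'(2)])
qed

lemma Ck_on_imp_continuous_on:
  assumes "Ck_on k U f" shows "continuous_on U f"
  using assms
  by (cases k) (auto intro!: continuous_at_imp_continuous_on dest: differentiable_imp_continuous_within)

lemma Ck_on_lower:
  assumes "Ck_on (Suc k) U f" shows "Ck_on k U f"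
  using assms
proof (induction k arbitrary: f)
  case 0
  then show ?case
    using Ck_on_imp_continuous_on[OF "0.prems"] by simp
next
  case (Suc k)
  have "\<forall>x\<in>U. f differentiable (at x)" "\<forall>v. Ck_on (Suc k) U (\<lambda>x. frechet_derivative f (at x) v)"
    using Suc.prems unfolding Ck_on.simps(2)[of "Suc k"] by blast+
  then show ?case
    by (subst Ck_on.simps(2)) (blast intro: Suc.IH)
qed

lemma Ck_on_subset:
  assumes "Ck_on k U f" "V \<subseteq> U" shows "Ck_on k V f"
  using assms by (induction k arbitrary: f) (auto intro: continuous_on_subset)

lemma Ck_on_const: "Ck_on k U (\<lambda>x. c)"
  by (induction k arbitrary: c) (auto simp: frechet_derivative_const)

lemma Ck_on_linear:
  assumes "bounded_linear f" shows "Ck_on k U f"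
proof (cases k)
  case 0
  then show ?thesis
    using assms by (simp add: linear_continuous_on)
next
  case (Suc m)
  have "frechet_derivative f (at x) = f" for x
    using bounded_linear_imp_has_derivative[OF assms] by (metis frechet_derivative_at)
  with Suc show ?thesis
    using assms by (simp add: Ck_on_const bounded_linear_imp_differentiable)
qed

lemma Ck_on_add:
  assumes "open U" "Ck_on k U f" "Ck_on k U g"
  shows "Ck_on k U (\<lambda>x. f x + g x)"
  using assms(2,3)
proof (induction k arbitrary: f g)
  case 0
  then show ?case by (simp add: continuous_on_add)
next
  case (Suc k)
  obtain f' where f': "\<And>x. x \<in> U \<Longrightarrow> (f has_derivative f' x) (at x)" "\<And>v. Ck_on k U (\<lambda>x. f' x v)"
    by (rule Ck_on_SucE[OF Suc.prems(1) assms(1)]) (rule that)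
  obtain g' where g': "\<And>x. x \<in> U \<Longrightarrow> (g has_derivative g' x) (at x)" "\<And>v. Ck_on k U (\<lambda>x. g' x v)"
    by (rule Ck_on_SucE[OF Suc.prems(2) assms(1)]) (rule that)
  show ?case
    by (rule Ck_on_SucI[OF assms(1) has_derivative_add[OF f'(1) g'(1)]]) (auto intro: Suc.IH f' g')
qed

lemma Ck_on_scaleR:
  fixes f :: "'a::euclidean_space \<Rightarrow> real"
  assumes "open U" "Ck_on k U f" "Ck_on k U g"
  shows "Ck_on k U (\<lambda>x. f x *\<^sub>R g x)"
  using assms(2,3)
proof (induction k arbitrary: f g)
  case 0
  then show ?case by (simp add: continuous_on_scaleR)
next
  case (Suc k)
  obtain f' where f': "\<And>x. x \<in> U \<Longrightarrow> (f has_derivative f' x) (at x)" "\<And>v. Ck_on k U (\<lambda>x. f' x v)"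
    by (rule Ck_on_SucE[OF Suc.prems(1) assms(1)]) (rule that)
  obtain g' where g': "\<And>x. x \<in> U \<Longrightarrow> (g has_derivative g' x) (at x)" "\<And>v. Ck_on k U (\<lambda>x. g' x v)"
    by (rule Ck_on_SucE[OF Suc.prems(2) assms(1)]) (rule that)
  show ?case
    by (rule Ck_on_SucI[OF assms(1) has_derivative_scaleR[OF f'(1) g'(1)]])
      (auto intro!: Suc.IH f' g' Ck_on_add assms(1) Suc.prems[THEN Ck_on_lower])
qed

lemma Ck_on_mult:
  fixes f :: "'a::euclidean_space \<Rightarrow> real"
  assumes "open U" "Ck_on k U f" "Ck_on k U g"
  shows "Ck_on k U (\<lambda>x. f x * g x)"
  using Ck_on_scaleR[OF assms] by simp

lemma Ck_on_minus:
  assumes "open U" "Ck_on k U f"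
  shows "Ck_on k U (\<lambda>x. - f x)"
  using Ck_on_scaleR[OF assms(1) Ck_on_const[of k U "-1"] assms(2)] by simp

lemma Ck_on_diff:
  assumes "open U" "Ck_on k U f" "Ck_on k U g"
  shows "Ck_on k U (\<lambda>x. f x - g x)"
  using Ck_on_add[OF assms(1,2) Ck_on_minus[OF assms(1,3)]] by simp

lemma Ck_on_sum:
  assumes "open U" "\<And>i. i \<in> I \<Longrightarrow> Ck_on k U (f i)"
  shows "Ck_on k U (\<lambda>x. \<Sum>i\<in>I. f i x)"
  using assms(2) by (induction I rule: infinite_finite_induct) (auto intro: Ck_on_const Ck_on_add assms(1))

lemma Ck_on_power:
  fixes f :: "'a::euclidean_space \<Rightarrow> real"
  assumes "open U" "Ck_on k U f"
  shows "Ck_on k U (\<lambda>x. f x ^ n)"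
  by (induction n) (auto intro: Ck_on_const Ck_on_mult assms)

text \<open>\<open>f\<close> is the sum of its components, each followed by the bounded linear
  embedding \<open>L\<close> of a coordinate axis. The components may themselves be vectors, so two
  applications handle matrices.\<close>

lemma Ck_on_vec_nth:
  fixes f :: "'a::euclidean_space \<Rightarrow> 'b::real_normed_vector^'n"
  assumes "\<And>i. Ck_on k U (\<lambda>x. f x $ i)" "open U"
  shows "Ck_on k U f"
proof -
  have "f = (\<lambda>x. \<Sum>i\<in>UNIV. \<chi> j. if j = i then f x $ i else 0)"
    by (auto simp: fun_eq_iff vec_eq_iff)
  moreover have "Ck_on k U (\<lambda>x. \<Sum>i\<in>UNIV. \<chi> j. if j = i then f x $ i else 0)"
  proof (rule Ck_on_sum[OF assms(2)])
    fix i
    define L where "L = (\<lambda>y::'b. (\<chi> j::'n. if j = i then y else 0))"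
    have L: "bounded_linear L"
    proof
      show "\<exists>K. \<forall>x. norm (L x) \<le> norm x * K"
      proof (intro exI allI)
        fix x
        have "norm (L x) \<le> (\<Sum>j\<in>UNIV. norm (L x $ j))"
          by (simp add: norm_vec_def L2_set_le_sum)
        also have "\<dots> = (\<Sum>j\<in>UNIV. if j = i then norm x else 0)"
          by (intro sum.cong) (auto simp: L_def)
        finally show "norm (L x) \<le> norm x * 1" by simp
      qed
    qed (auto simp: L_def vec_eq_iff)
    have "Ck_on k U (\<lambda>x. L (g x))" if "Ck_on k U g" for g :: "'a \<Rightarrow> 'b"
      using that
    proof (induction k arbitrary: g)
      case 0
      then show ?case
        using bounded_linear.continuous_on[OF L] by simp
    next
      case (Suc k)
      obtain g' where g': "\<And>x. x \<in> U \<Longrightarrow> (g has_derivative g' x) (at x)" "\<And>v. Ck_on k U (\<lambda>x. g' x v)"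
        by (rule Ck_on_SucE[OF Suc.prems(1) assms(2)]) (rule that)
      show ?case
        by (rule Ck_on_SucI[OF assms(2) bounded_linear.has_derivative[OF L g'(1)]])
          (auto intro: Suc.IH g'(2))
    qed
    from this[OF assms(1)] show "Ck_on k U (\<lambda>x. \<chi> j. if j = i then f x $ i else 0)"
      by (simp add: L_def)
  qed
  ultimately show ?thesis by simp
qed

lemma Ck_on_SucI_real:
  fixes f :: "real \<Rightarrow> real"
  assumes "open U" "\<And>x. x \<in> U \<Longrightarrow> (f has_real_derivative f' x) (at x)" "Ck_on k U f'"
  shows "Ck_on (Suc k) U f"
proof (rule Ck_on_SucI[OF assms(1)])
  show "(f has_derivative (\<lambda>v. f' x * v)) (at x)" if "x \<in> U" for x
    using assms(2)[OF that] by (simp add: has_field_derivative_def)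
qed (intro Ck_on_mult assms Ck_on_const)

text \<open>The outer function has one real variable, so its derivative is multiplication by a
  number and the chain rule reduces the step to \<open>Ck_on_mult\<close>.\<close>

lemma Ck_on_compose:
  fixes g :: "real \<Rightarrow> real"
  assumes "open U" "open S" "f ` U \<subseteq> S" "Ck_on k S g" "Ck_on k U f"
  shows "Ck_on k U (\<lambda>x. g (f x))"
  using assms(4,5)
proof (induction k arbitrary: g)
  case 0
  then show ?case
    using assms(3) by (simp add: continuous_on_compose2)
next
  case (Suc k)
  obtain f' where f': "\<And>x. x \<in> U \<Longrightarrow> (f has_derivative f' x) (at x)" "\<And>v. Ck_on k U (\<lambda>x. f' x v)"
    by (rule Ck_on_SucE[OF Suc.prems(2) assms(1)]) (rule that)
  obtain g' where g': "\<And>x. x \<in> S \<Longrightarrow> (g has_derivative g' x) (at x)" "\<And>v. Ck_on k S (\<lambda>x. g' x v)"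
    by (rule Ck_on_SucE[OF Suc.prems(1) assms(2)]) (rule that)
  have *: "g' (f x) v = g' (f x) 1 * v" if "x \<in> U" for x v
  proof -
    have "f x \<in> S" using assms(3) that by auto
    then show ?thesis
      using linear_scale[OF has_derivative_linear[OF g'(1)], of "f x" v 1] by simp
  qed
  show ?case
  proof (rule Ck_on_SucI[OF assms(1)])
    show "((\<lambda>x. g (f x)) has_derivative (\<lambda>v. g' (f x) (f' x v))) (at x)" if "x \<in> U" for x
    proof (rule has_derivative_compose[OF f'(1)[OF that] g'(1)])
      show "f x \<in> S" using assms(3) that by auto
    qed
    have "Ck_on k U (\<lambda>x. g' (f x) 1 * f' x v)" for v
      by (rule Ck_on_mult[OF assms(1) Suc.IH[OF g'(2) Ck_on_lower[OF Suc.prems(2)]] f'(2)])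
    then show "Ck_on k U (\<lambda>x. g' (f x) (f' x v))" for v
      by (rule Ck_on_cong[OF _ assms(1)]) (rule *[symmetric])
  qed
qed

lemma Ck_on_inverse_real: "Ck_on k (- {0}) (inverse :: real \<Rightarrow> real)"
proof (induction k)
  case 0
  show ?case by (simp add: continuous_on_inverse)
next
  case (Suc k)
  show ?case
    by (rule Ck_on_SucI_real[where f'="\<lambda>x. - (inverse x * inverse x)"])
      (auto intro!: Ck_on_minus Ck_on_mult Suc derivative_eq_intros simp: power2_eq_square divide_inverse)
qed

lemma Ck_on_inverse:
  fixes f :: "'a::euclidean_space \<Rightarrow> real"
  assumes "open U" "Ck_on k U f" "\<And>x. x \<in> U \<Longrightarrow> f x \<noteq> 0"
  shows "Ck_on k U (\<lambda>x. inverse (f x))"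
  by (rule Ck_on_compose[OF assms(1) _ _ Ck_on_inverse_real assms(2)]) (use assms(3) in auto)

lemma Ck_on_divide:
  fixes f :: "'a::euclidean_space \<Rightarrow> real"
  assumes "open U" "Ck_on k U f" "Ck_on k U g" "\<And>x. x \<in> U \<Longrightarrow> g x \<noteq> 0"
  shows "Ck_on k U (\<lambda>x. f x / g x)"
  unfolding divide_inverse using assms by (intro Ck_on_mult Ck_on_inverse)

lemma Ck_on_sqrt:
  fixes f :: "'a::euclidean_space \<Rightarrow> real"
  assumes "open U" "Ck_on k U f" "\<And>x. x \<in> U \<Longrightarrow> f x > 0"
  shows "Ck_on k U (\<lambda>x. sqrt (f x))"
proof -
  have "Ck_on k {0<..} sqrt"
  proof (induction k)
    case 0
    show ?case by (simp add: continuous_on_real_sqrt)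
  next
    case (Suc k)
    show ?case
    proof (rule Ck_on_SucI_real)
      show "(sqrt has_real_derivative inverse (sqrt x) / 2) (at x)" if "x \<in> {0<..}" for x
        using that DERIV_real_sqrt by simp
      have "Ck_on k {0<..} (\<lambda>x. inverse (sqrt x))"
        by (rule Ck_on_inverse[OF _ Suc]) auto
      from Ck_on_mult[OF open_greaterThan this Ck_on_const[of k _ "1/2"]]
      show "Ck_on k {0<..} (\<lambda>x. inverse (sqrt x) / 2)" by simp
    qed simp
  qed
  then show ?thesis
    using Ck_on_compose[of U "{0<..}" f k sqrt] assms by auto
qed

lemmas Ck_on_intros = Ck_on_const Ck_on_add Ck_on_scaleR Ck_on_mult Ck_on_minus Ck_on_diff
  Ck_on_sum Ck_on_power

lemma Ck_on_linear_compose: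
  fixes h :: "'a::euclidean_space \<Rightarrow> 'c::euclidean_space"
  assumes "bounded_linear h" "open U" "Ck_on k U f"
  shows "Ck_on k (h -` U) (\<lambda>x. f (h x))"
  using assms(3)
proof (induction k arbitrary: f)
  case 0
  then show ?case
    using linear_continuous_on[OF assms(1)] by (auto intro!: continuous_on_compose2[of U f])
next
  case (Suc k)
  obtain f' where f': "\<And>x. x \<in> U \<Longrightarrow> (f has_derivative f' x) (at x)" "\<And>v. Ck_on k U (\<lambda>x. f' x v)"
    by (rule Ck_on_SucE[OF Suc.prems(1) assms(2)]) (rule that)
  show ?case
  proof (rule Ck_on_SucI)
    show "open (h -` U)"
      using assms by (simp add: continuous_open_vimage linear_continuous_at)
    show "((\<lambda>x. f (h x)) has_derivative (\<lambda>v. f' (h x) (h v))) (at x)" if "x \<in> h -` U" for x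
    proof (rule has_derivative_compose[OF bounded_linear_imp_has_derivative[OF assms(1)] f'(1)])
      show "h x \<in> U" using that by auto
    qed
  qed (rule Suc.IH[OF f'(2)])
qed

section \<open>Partial derivatives\<close>

lemma pdiff_eqI: "(f has_derivative f') (at x) \<Longrightarrow> pdiff i f x = f' (axis i 1)"
  unfolding pdiff_def by (metis frechet_derivative_at)

text \<open>Needed because \<open>inv_hess \<phi>\<close> is known explicitly only on an open set;
  first and second partial derivatives are transported by this rule.\<close>

lemma pdiff_cong:
  assumes "open U" "x \<in> U" "\<And>y. y \<in> U \<Longrightarrow> f y = g y" "f differentiable at x"
  shows "pdiff i g x = pdiff i f x"
proof -
  have "(f has_derivative frechet_derivative f (at x)) (at x)"
    using assms(4) frechet_derivative_works by blast
  moreover from this have "(g has_derivative frechet_derivative f (at x)) (at x)"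
    by (rule has_derivative_transform_within_open) (use assms in auto)
  ultimately show ?thesis
    by (simp add: pdiff_eqI)
qed

section \<open>Profile functions\<close>

lemma continuous_on_if_DERIV:
  fixes f :: "real \<Rightarrow> real"
  assumes "\<And>x. x \<in> S \<Longrightarrow> (f has_real_derivative f' x) (at x)"
  shows "continuous_on S f"
  by (rule DERIV_continuous_on[of S f f']) (rule has_field_derivative_at_within[OF assms])

lemma antiderivative_exists:
  fixes g :: "real \<Rightarrow> real"
  assumes "\<And>x. isCont g x"
  obtains F where "\<And>x. (F has_real_derivative g x) (at x)" "F 0 = 0"
proof -
  obtain F where F: "\<And>x. (F has_vector_derivative g x) (at x)"
    using einterval_antiderivative[of "-\<infinity>" \<infinity> g] assms by auto
  show ?thesis
    by (rule that[of "\<lambda>x. F x - F 0"])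
      (use F in \<open>auto intro!: derivative_eq_intros simp: has_real_derivative_iff_has_vector_derivative\<close>)
qed

text \<open>Meant for integrands such as \<open>1 / A x\<close>, which blow up at the ends of the
  interval; hence no claim and no normalization there.\<close>

lemma antiderivative_unit_interval:
  fixes g :: "real \<Rightarrow> real"
  assumes "continuous_on {0<..<1} g"
  obtains F where "\<And>x. 0 < x \<Longrightarrow> x < 1 \<Longrightarrow> (F has_real_derivative g x) (at x)"
proof -
  have "isCont g x" if "0 < ereal x" "ereal x < 1" for x
    using assms that by (simp add: continuous_on_eq_continuous_at zero_ereal_def one_ereal_def)
  then obtain F where "\<And>x. 0 < ereal x \<Longrightarrow> ereal x < 1 \<Longrightarrow> (F has_vector_derivative g x) (at x)"
    using einterval_antiderivative[of 0 1 g] by auto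
  then show ?thesis
    by (intro that[of F]) (auto simp: has_real_derivative_iff_has_vector_derivative)
qed

lemma affine_pos:
  fixes \<alpha> \<beta> x :: real
  assumes "\<alpha> > 0" "\<alpha> + \<beta> > 0" "0 \<le> x" "x \<le> 1"
  shows "\<alpha> + \<beta> * x > 0"
proof -
  have "\<alpha> + \<beta> * x = (1 - x) * \<alpha> + x * (\<alpha> + \<beta>)"
    by (simp add: algebra_simps)
  moreover have "(1 - x) * \<alpha> + x * (\<alpha> + \<beta>) > 0" if "x > 0"
    using assms that by (intro add_nonneg_pos) auto
  ultimately show ?thesis
    using assms by (cases "x = 0") auto
qed

text \<open>\<open>m0\<close>, \<open>m1\<close>, \<open>m2\<close> are the moments of exp (- 2 a x)
  on [0, 1]. Keeping the antiderivatives replaces integrals by monotonicity arguments, and the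
  profiles are built from them.\<close>

locale weight_moments =
  fixes a m0 m1 m2 :: real and I0 I1 I2 :: "real \<Rightarrow> real"
  assumes I0: "\<And>x. (I0 has_real_derivative exp (- 2 * a * x)) (at x)" "I0 0 = 0" "I0 1 = m0"
    and I1: "\<And>x. (I1 has_real_derivative exp (- 2 * a * x) * x) (at x)" "I1 0 = 0" "I1 1 = m1"
    and I2: "\<And>x. (I2 has_real_derivative exp (- 2 * a * x) * x^2) (at x)" "I2 0 = 0" "I2 1 = m2"
begin

lemma moment_pos:
  assumes "\<And>x. 0 < x \<Longrightarrow> x < 1 \<Longrightarrow> \<alpha> + \<beta> * x + \<gamma> * x^2 > 0"
  shows "0 < \<alpha> * m0 + \<beta> * m1 + \<gamma> * m2"
proof -
  define F where "F = (\<lambda>x. \<alpha> * I0 x + \<beta> * I1 x + \<gamma> * I2 x)"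
  have F: "(F has_real_derivative exp (- 2 * a * x) * (\<alpha> + \<beta> * x + \<gamma> * x^2)) (at x)" for x
    unfolding F_def by (rule derivative_eq_intros I0 I1 I2 refl)+ (simp add: algebra_simps)
  have "F 0 < F 1"
  proof (rule DERIV_pos_imp_increasing_open[of 0 1 F])
    show "\<exists>y. (F has_real_derivative y) (at x) \<and> 0 < y" if "0 < x" "x < 1" for x
      using assms[OF that] by (intro exI[of _ "exp (- 2 * a * x) * (\<alpha> + \<beta> * x + \<gamma> * x^2)"] conjI F) auto
    show "continuous_on {0..1} F"
      by (rule continuous_on_if_DERIV) (rule F)
  qed simp
  then show ?thesis
    using I0 I1 I2 by (simp add: F_def)
qed

text \<open>The density \<alpha> + \<beta> x stays positive on (0, 1) when multiplied by x or by 1 -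
  x. So the mean of x for the weight exp (- 2 a x) (\<alpha> + \<beta> x) lies strictly between 0
  and 1.\<close>

lemma barycenter_bounds:
  assumes "\<alpha> > 0" "\<alpha> + \<beta> > 0"
  shows "0 < \<alpha> * m0 + \<beta> * m1" "0 < \<alpha> * m1 + \<beta> * m2" "\<alpha> * m1 + \<beta> * m2 < \<alpha> * m0 + \<beta> * m1"
proof -
  show "0 < \<alpha> * m0 + \<beta> * m1"
    using moment_pos[of \<alpha> \<beta> 0] affine_pos[OF assms] by auto
  have "0 < x * (\<alpha> + \<beta> * x)" "0 < (1 - x) * (\<alpha> + \<beta> * x)" if "0 < x" "x < 1" for x
    using affine_pos[OF assms, of x] that by auto
  then show "0 < \<alpha> * m1 + \<beta> * m2" "\<alpha> * m1 + \<beta> * m2 < \<alpha> * m0 + \<beta> * m1"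
    using moment_pos[of 0 \<alpha> \<beta>] moment_pos[of \<alpha> "\<beta> - \<alpha>" "- \<beta>"]
    by (auto simp: algebra_simps power2_eq_square)
qed

text \<open>The integrating factor exp (- 2 a x) turns the equation into one for \<open>M\<close>,
  whose vanishing at 1 says that \<open>X\<close> is the mean of x for the weight. Since M' has the
  sign of x - X, \<open>M\<close> falls and then rises between its zeros 0 and 1, hence is negative
  inside.\<close>

lemma profile_exists:
  assumes "\<alpha> > 0" "\<alpha> + \<beta> > 0" "0 < X" "X < 1" "\<alpha> * m1 + \<beta> * m2 = X * (\<alpha> * m0 + \<beta> * m1)"
  obtains A where "A 0 = 0" "A 1 = 0" "\<And>x. 0 < x \<Longrightarrow> x < 1 \<Longrightarrow> A x > 0"
    "\<And>x. (A has_real_derivative 2 * a * A x - (x - X) * (\<alpha> + \<beta> * x)) (at x)"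
proof -
  define M where "M = (\<lambda>x. \<alpha> * I1 x + \<beta> * I2 x - X * (\<alpha> * I0 x + \<beta> * I1 x))"
  have M: "(M has_real_derivative exp (- 2 * a * x) * ((x - X) * (\<alpha> + \<beta> * x))) (at x)" for x
    unfolding M_def
    by (rule derivative_eq_intros I0 I1 I2 refl)+ (simp add: algebra_simps power2_eq_square)
  have M0: "M 0 = 0" and M1: "M 1 = 0"
    using I0 I1 I2 assms(5) by (auto simp: M_def)
  have cont: "continuous_on S M" for S
    by (rule continuous_on_if_DERIV) (rule M)
  have neg: "M x < 0" if "0 < x" "x < 1" for x
  proof (cases "x \<le> X")
    case True
    have "M 0 > M x"
    proof (rule DERIV_neg_imp_decreasing_open[OF that(1) _ cont])
      show "\<exists>y. (M has_real_derivative y) (at t) \<and> y < 0" if "0 < t" "t < x" for t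
        using affine_pos[OF assms(1,2), of t] that True \<open>x < 1\<close>
        by (intro exI[of _ "exp (- 2 * a * t) * ((t - X) * (\<alpha> + \<beta> * t))"] conjI M)
          (auto simp: mult_less_0_iff)
    qed
    then show ?thesis by (simp add: M0)
  next
    case False
    have "M x < M 1"
    proof (rule DERIV_pos_imp_increasing_open[OF that(2) _ cont])
      show "\<exists>y. (M has_real_derivative y) (at t) \<and> y > 0" if "x < t" "t < 1" for t
        using affine_pos[OF assms(1,2), of t] that False \<open>0 < x\<close>
        by (intro exI[of _ "exp (- 2 * a * t) * ((t - X) * (\<alpha> + \<beta> * t))"] conjI M) auto
    qed
    then show ?thesis by (simp add: M1)
  qed
  show ?thesis
  proof (rule that[of "\<lambda>x. - exp (2 * a * x) * M x"])
    show "((\<lambda>x. - exp (2 * a * x) * M x) has_real_derivative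
      2 * a * (- exp (2 * a * x) * M x) - (x - X) * (\<alpha> + \<beta> * x)) (at x)" for x
    proof -
      have *: "exp (2 * a * x) * exp (- 2 * a * x) = 1"
        by (simp flip: exp_add)
      have "((\<lambda>x. - exp (2 * a * x) * M x) has_real_derivative
        - (exp (2 * a * x) * (2 * a)) * M x
        - exp (2 * a * x) * (exp (- 2 * a * x) * ((x - X) * (\<alpha> + \<beta> * x)))) (at x)"
        by (rule derivative_eq_intros M refl)+ simp
      then show ?thesis
        unfolding mult.assoc[symmetric] * by (simp add: algebra_simps)
    qed
  qed (use M0 M1 neg in \<open>auto simp: mult_less_0_iff\<close>)
qed

end

lemma weight_moments_exist:
  obtains m0 m1 m2 I0 I1 I2 where "weight_moments a m0 m1 m2 I0 I1 I2"
proof -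
  obtain I0 where "\<And>x. (I0 has_real_derivative exp (- 2 * a * x)) (at x)" "I0 0 = 0"
    by (rule antiderivative_exists[of "\<lambda>x. exp (- 2 * a * x)"]) auto
  moreover obtain I1 where "\<And>x. (I1 has_real_derivative exp (- 2 * a * x) * x) (at x)" "I1 0 = 0"
    by (rule antiderivative_exists[of "\<lambda>x. exp (- 2 * a * x) * x"]) auto
  moreover obtain I2 where "\<And>x. (I2 has_real_derivative exp (- 2 * a * x) * x^2) (at x)" "I2 0 = 0"
    by (rule antiderivative_exists[of "\<lambda>x. exp (- 2 * a * x) * x^2"]) auto
  ultimately show ?thesis
    by (intro that[of "I0 1" "I1 1" "I2 1" I0 I1 I2]) (unfold_locales, auto)
qed

text \<open>The point \<open>(X, Y)\<close> is the barycenter of the unit square for the weight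
  \<open>exp (- 2 a x - 2 b y) (1 + c y + d x)\<close>, in the bilinear coordinates of the quadrilateral.\<close>

lemma monotone_profiles_exist:
  fixes a b c d :: real
  assumes cd: "1 + c > 0" "1 + d > 0" "1 + c + d > 0"
  obtains X Y A B where "0 < X" "X < 1" "0 < Y" "Y < 1"
    "A 0 = 0" "A 1 = 0" "\<And>x. 0 < x \<Longrightarrow> x < 1 \<Longrightarrow> A x > 0"
    "\<And>x. (A has_real_derivative 2 * a * A x - (x - X) * (1 + c * Y + d * x)) (at x)"
    "B 0 = 0" "B 1 = 0" "\<And>x. 0 < x \<Longrightarrow> x < 1 \<Longrightarrow> B x > 0"
    "\<And>x. (B has_real_derivative 2 * b * B x - (x - Y) * (1 + d * X + c * x)) (at x)"
proof -
  obtain m0 m1 m2 I0 I1 I2 where "weight_moments a m0 m1 m2 I0 I1 I2"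
    by (rule weight_moments_exist)
  then interpret x: weight_moments a m0 m1 m2 I0 I1 I2 .
  obtain n0 n1 n2 J0 J1 J2 where "weight_moments b n0 n1 n2 J0 J1 J2"
    by (rule weight_moments_exist)
  then interpret y: weight_moments b n0 n1 n2 J0 J1 J2 .
  have pos: "1 + c * t > 0" "1 + c * t + d > 0" "1 + d * t > 0" "1 + d * t + c > 0"
    if "0 \<le> t" "t \<le> 1" for t
    using affine_pos[of 1 c t] affine_pos[of "1 + d" c t] affine_pos[of 1 d t]
      affine_pos[of "1 + c" d t] that cd by (auto simp: algebra_simps)
  \<comment> \<open>\<open>F t\<close> is the weighted mean of x when the second barycenter
    coordinate is \<open>t\<close>; \<open>G t\<close> is the weighted mean of y when the first one
    is \<open>t\<close>.\<close>
  define F where "F = (\<lambda>t. ((1 + c * t) * m1 + d * m2) / ((1 + c * t) * m0 + d * m1))"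
  define G where "G = (\<lambda>t. ((1 + d * t) * n1 + c * n2) / ((1 + d * t) * n0 + c * n1))"
  have Fpos: "(1 + c * t) * m0 + d * m1 > 0" and F: "0 < F t" "F t < 1" if "0 \<le> t" "t \<le> 1" for t
    using x.barycenter_bounds[OF pos(1,2)[OF that]] by (auto simp: F_def)
  have Gpos: "(1 + d * t) * n0 + c * n1 > 0" and G: "0 < G t" "G t < 1" if "0 \<le> t" "t \<le> 1" for t
    using y.barycenter_bounds[OF pos(3,4)[OF that]] by (auto simp: G_def)
  have "continuous_on {0..1} F" "continuous_on {0..1} G"
    unfolding F_def G_def using Fpos Gpos by (auto intro!: continuous_intros simp: less_imp_neq[symmetric])
  then have "continuous_on {0..1} (\<lambda>t. t - F (G t))"
    by (auto intro!: continuous_intros continuous_on_compose2[of "{0..1}" F] simp: G less_imp_le)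
  \<comment> \<open>The pair has to satisfy X = F Y and Y = G X. Eliminating Y leaves a fixed point
    of a continuous self-map of [0, 1].\<close>
  then obtain X where X: "0 \<le> X" "X \<le> 1" "X - F (G X) = 0"
    using IVT'[of "\<lambda>t. t - F (G t)" 0 0 1] F G by (force simp: less_imp_le)
  define Y where "Y = G X"
  have Y: "0 < Y" "Y < 1"
    using G X by (auto simp: Y_def)
  have X': "X = F Y" "0 < X" "X < 1"
    using F[of Y] X Y by (auto simp: Y_def)
  have "(1 + c * Y) * m1 + d * m2 = X * ((1 + c * Y) * m0 + d * m1)"
    using Fpos[of Y] Y by (simp add: X'(1) F_def)
  then obtain A where "A 0 = 0" "A 1 = 0" "\<And>x. 0 < x \<Longrightarrow> x < 1 \<Longrightarrow> A x > 0"
    "\<And>x. (A has_real_derivative 2 * a * A x - (x - X) * (1 + c * Y + d * x)) (at x)"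
    using x.profile_exists[of "1 + c * Y" d X] pos[of Y] X' Y by auto
  moreover have "(1 + d * X) * n1 + c * n2 = Y * ((1 + d * X) * n0 + c * n1)"
    using Gpos[of X] X by (simp add: Y_def G_def)
  then obtain B where "B 0 = 0" "B 1 = 0" "\<And>x. 0 < x \<Longrightarrow> x < 1 \<Longrightarrow> B x > 0"
    "\<And>x. (B has_real_derivative 2 * b * B x - (x - Y) * (1 + d * X + c * x)) (at x)"
    using y.profile_exists[of "1 + d * X" c Y] pos[of X] X' Y by auto
  ultimately show ?thesis
    using that X' Y by blast
qed

text \<open>The case of the weight exp (- 2 a x) alone. Differentiated, the equation reads A'' - 2 a
  A' = -1, so this solution carries exactly the separation constant.\<close>

lemma torsion_profile_exists:
  fixes a :: real
  obtains X A where "0 < X" "X < 1" "A 0 = 0" "A 1 = 0"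
    "\<And>x. (A has_real_derivative 2 * a * A x - (x - X)) (at x)"
proof -
  assume goal: "\<And>X A. 0 < X \<Longrightarrow> X < 1 \<Longrightarrow> A 0 = 0 \<Longrightarrow> A 1 = 0 \<Longrightarrow>
    (\<And>x. (A has_real_derivative 2 * a * A x - (x - X)) (at x)) \<Longrightarrow> thesis"
  obtain m0 m1 m2 I0 I1 I2 where "weight_moments a m0 m1 m2 I0 I1 I2"
    by (rule weight_moments_exist)
  then interpret weight_moments a m0 m1 m2 I0 I1 I2 .
  have "0 < m0" "0 < m1" "m1 < m0"
    using barycenter_bounds[of 1 0] by auto
  show ?thesis
  proof (rule profile_exists[of 1 0 "m1 / m0"])
    show thesis if "A 0 = 0" "A 1 = 0"
      "\<And>x. (A has_real_derivative 2 * a * A x - (x - m1 / m0) * (1 + 0 * x)) (at x)" for A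
      using goal[of "m1 / m0" A] that \<open>0 < m0\<close> \<open>0 < m1\<close> \<open>m1 < m0\<close> by simp
  qed (use \<open>0 < m0\<close> \<open>0 < m1\<close> \<open>m1 < m0\<close> in auto)
qed

text \<open>Bootstrapping: the equation expresses the derivative through \<open>A\<close>
  itself.\<close>

lemma Ck_on_profile:
  fixes A :: "real \<Rightarrow> real"
  assumes A: "\<And>x. (A has_real_derivative \<kappa> * A x + q x) (at x)" and q: "\<And>k. Ck_on k UNIV q"
  shows "Ck_on k UNIV A"
proof (induction k)
  case 0
  show ?case
    using continuous_on_if_DERIV[OF A] by simp
next
  case (Suc k)
  show ?case
    by (rule Ck_on_SucI_real[OF _ A]) (auto intro!: Ck_on_intros Suc q)
qed

text \<open>The quotient B / A extends continuously to [0, 1]; its limits at the ends are the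
  quotients of the slopes, where the slopes of \<open>A\<close> do not vanish. Hence |B| \<le> K A
  on the interval, and every |t| < 1 / K is admissible.\<close>

lemma profile_perturbation:
  fixes A B :: "real \<Rightarrow> real"
  assumes A: "A 0 = 0" "A 1 = 0" "\<And>x. 0 < x \<Longrightarrow> x < 1 \<Longrightarrow> A x > 0"
    "(A has_real_derivative p) (at 0)" "(A has_real_derivative - q) (at 1)" "p > 0" "q > 0"
    and B: "B 0 = 0" "B 1 = 0" "(B has_real_derivative p') (at 0)" "(B has_real_derivative q') (at 1)"
    and cont: "continuous_on {0..1} A" "continuous_on {0..1} B"
  obtains \<epsilon> where "\<epsilon> > 0" "\<And>t x. \<bar>t\<bar> < \<epsilon> \<Longrightarrow> 0 < x \<Longrightarrow> x < 1 \<Longrightarrow> A x + t * B x > 0"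
proof -
  define h where "h = (\<lambda>x. if x = 0 then p' / p else if x = 1 then q' / (- q) else B x / A x)"
  have "((\<lambda>x. (B x / x) / (A x / x)) \<longlongrightarrow> p' / p) (at 0)"
    using A B by (intro tendsto_divide) (auto simp: has_field_derivative_iff)
  then have 0: "((\<lambda>x. B x / A x) \<longlongrightarrow> p' / p) (at 0)"
    by (rule Lim_transform_eventually) (auto simp: eventually_at intro!: exI[of _ 1])
  have "((\<lambda>x. (B x / (x - 1)) / (A x / (x - 1))) \<longlongrightarrow> q' / (- q)) (at 1)"
    using A B by (intro tendsto_divide) (auto simp: has_field_derivative_iff)
  then have one: "((\<lambda>x. B x / A x) \<longlongrightarrow> q' / (- q)) (at 1)"
    by (rule Lim_transform_eventually) (auto simp: eventually_at intro!: exI[of _ 1])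
  have "continuous_on {0..1} h"
    unfolding continuous_on_def
  proof
    fix x :: real assume x: "x \<in> {0..1}"
    consider "x = 0" | "x = 1" | "0 < x" "x < 1" using x by force
    then show "(h \<longlongrightarrow> h x) (at x within {0..1})"
    proof cases
      case 1
      have "(h \<longlongrightarrow> p' / p) (at 0)"
        by (rule Lim_transform_eventually[OF 0])
          (auto simp: eventually_at h_def dist_real_def intro!: exI[of _ 1])
      moreover have "h x = p' / p"
        using 1 by (simp add: h_def)
      ultimately show ?thesis
        using 1 Lim_at_imp_Lim_at_within by metis
    next
      case 2
      have "(h \<longlongrightarrow> q' / (- q)) (at 1)"
        by (rule Lim_transform_eventually[OF one])
          (auto simp: eventually_at h_def dist_real_def intro!: exI[of _ 1])
      moreover have "h x = q' / (- q)"
        using 2 by (simp add: h_def)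
      ultimately show ?thesis
        using 2 Lim_at_imp_Lim_at_within by metis
    next
      case 3
      have "continuous_on {0<..<1} A" "continuous_on {0<..<1} B"
        using cont by (auto elim: continuous_on_subset)
      then have "continuous_on {0<..<1} (\<lambda>x. B x / A x)"
        using A(3) by (intro continuous_on_divide) (auto simp: less_imp_neq[symmetric])
      then have "continuous_on {0<..<1} h"
        by (rule continuous_on_eq) (auto simp: h_def)
      with 3 have "(h \<longlongrightarrow> h x) (at x)"
        by (simp add: continuous_on_eq_continuous_at isCont_def)
      then show ?thesis by (rule Lim_at_imp_Lim_at_within)
    qed
  qed
  then have "bounded (h ` {0..1})"
    by (intro compact_imp_bounded compact_continuous_image) auto
  then obtain K where K: "K > 0" "\<And>x. x \<in> {0..1} \<Longrightarrow> \<bar>h x\<bar> \<le> K"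
    by (auto simp: bounded_pos)
  show ?thesis
  proof (rule that[of "1 / K"])
    fix t x :: real assume t: "\<bar>t\<bar> < 1 / K" and x: "0 < x" "x < 1"
    have "\<bar>B x\<bar> \<le> K * A x"
      using K(2)[of x] A(3)[OF x] x by (auto simp: h_def divide_simps abs_mult)
    then have "\<bar>t * B x\<bar> \<le> \<bar>t\<bar> * (K * A x)"
      by (simp add: abs_mult mult_left_mono)
    also have "\<dots> < 1 / K * (K * A x)"
      using t K(1) A(3)[OF x] by (intro mult_strict_right_mono) auto
    finally show "A x + t * B x > 0"
      using K(1) by auto
  qed (use K in auto)
qed

section \<open>Bilinear coordinates\<close>

lemma dual_basis_expand:
  fixes Q R e f v :: "real^2"
  assumes "\<And>i j. e $ i * Q $ j + f $ i * R $ j = (if i = j then 1 else 0)"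
  shows "v = (e \<bullet> v) *\<^sub>R Q + (f \<bullet> v) *\<^sub>R R"
proof (rule vec_eq_iff[THEN iffD2], rule allI)
  fix j
  have "((e \<bullet> v) *\<^sub>R Q + (f \<bullet> v) *\<^sub>R R) $ j = (\<Sum>i\<in>UNIV. v $ i * (e $ i * Q $ j + f $ i * R $ j))"
    by (simp add: inner_vec_def sum_2 algebra_simps)
  also have "\<dots> = v $ j"
    by (simp add: assms if_distrib[of "(*) _"] cong: if_cong)
  finally show "v $ j = ((e \<bullet> v) *\<^sub>R Q + (f \<bullet> v) *\<^sub>R R) $ j" ..
qed

text \<open>\<open>(e, f)\<close> is the basis dual to \<open>(Q, R)\<close>.  The map \<open>pt\<close> parametrizes the quadrilateral with
  vertices \<open>P\<close>, \<open>P + Q\<close>, \<open>P + Q + R + S\<close>, \<open>P + R\<close> by the unit square, and \<open>xc\<close>, \<open>yc\<close> invert it by the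
  quadratic formula: \<open>rt\<close> is the Jacobian \<open>1 + c y + d x\<close>, and \<open>\<delta> = d x - c y\<close> is affine.\<close>

locale bilinear_coordinates =
  fixes P Q R e f :: "real^2" and c d :: real
  assumes basis: "\<And>i j. e $ i * Q $ j + f $ i * R $ j = (if i = j then 1 else 0)"
    and dual: "e \<bullet> Q = 1" "e \<bullet> R = 0" "f \<bullet> Q = 0" "f \<bullet> R = 1"
    and cd: "1 + c > 0" "1 + d > 0" "1 + c + d > 0"
begin

definition S :: "real^2" where "S = c *\<^sub>R Q + d *\<^sub>R R"
definition \<sigma> :: "real^2" where "\<sigma> = d *\<^sub>R e - c *\<^sub>R f"
definition pt :: "real \<Rightarrow> real \<Rightarrow> real^2" where "pt x y = P + x *\<^sub>R Q + y *\<^sub>R R + (x * y) *\<^sub>R S"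
definition pv :: "real \<Rightarrow> real^2" where "pv y = Q + y *\<^sub>R S"
definition qv :: "real \<Rightarrow> real^2" where "qv x = R + x *\<^sub>R S"
text \<open>The lines x = const are straight, so their conormal \<open>Xv x\<close> depends on x
  alone, and dx = Xv / rt. Likewise dy = Yv / rt.\<close>

definition Xv :: "real \<Rightarrow> real^2" where "Xv x = e + x *\<^sub>R \<sigma>"
definition Yv :: "real \<Rightarrow> real^2" where "Yv y = f - y *\<^sub>R \<sigma>"
definition \<delta> :: "real^2 \<Rightarrow> real" where "\<delta> \<mu> = \<sigma> \<bullet> (\<mu> - P)"
definition disc :: "real^2 \<Rightarrow> real" where
  "disc \<mu> = 1 + (\<delta> \<mu>)\<^sup>2 + 2 * (d * (e \<bullet> (\<mu> - P)) + c * (f \<bullet> (\<mu> - P)))"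
definition rt :: "real^2 \<Rightarrow> real" where "rt \<mu> = sqrt (disc \<mu>)"
text \<open>The rationalized root of the quadratic equation: its denominator equals 2 (1 + c y), so
  c = 0 and d = 0 need no separate treatment.\<close>

definition xc :: "real^2 \<Rightarrow> real" where "xc \<mu> = 2 * (e \<bullet> (\<mu> - P)) / (1 + rt \<mu> - \<delta> \<mu>)"
definition yc :: "real^2 \<Rightarrow> real" where "yc \<mu> = 2 * (f \<bullet> (\<mu> - P)) / (1 + rt \<mu> + \<delta> \<mu>)"
text \<open>An open neighbourhood of the closed quadrilateral (see \<open>quad_coords\<close>), so
  that functions smooth on it are smooth up to and beyond the edges.\<close>

definition dom :: "(real^2) set" where
  "dom = {\<mu>. disc \<mu> > 0 \<and> 1 + rt \<mu> - \<delta> \<mu> > 0 \<and> 1 + rt \<mu> + \<delta> \<mu> > 0}"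

lemma dot_simps:
  "e \<bullet> S = c" "f \<bullet> S = d" "\<sigma> \<bullet> Q = d" "\<sigma> \<bullet> R = - c" "\<sigma> \<bullet> S = 0"
  by (auto simp: S_def \<sigma>_def dual inner_add_right inner_diff_left)

lemma XY_pq:
  "Xv x \<bullet> pv y = 1 + c * y + d * x" "Xv x \<bullet> qv t = c * (t - x)"
  "Yv y \<bullet> pv t = d * (t - y)" "Yv y \<bullet> qv x = 1 + c * y + d * x"
  by (auto simp: Xv_def Yv_def pv_def qv_def inner_simps dual dot_simps algebra_simps)

lemma pt_dot:
  "e \<bullet> (pt x y - P) = x + c * x * y" "f \<bullet> (pt x y - P) = y + d * x * y"
  "\<sigma> \<bullet> (pt x y - P) = d * x - c * y"
  by (auto simp: pt_def inner_simps dual dot_simps algebra_simps)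

lemma frame_resolution:
  "Xv x $ i * pv y $ j + Yv y $ i * qv x $ j = (if i = j then 1 + c * y + d * x else 0)"
proof -
  have "Xv x $ i * pv y $ j + Yv y $ i * qv x $ j =
      (1 + c * y + d * x) * (e $ i * Q $ j + f $ i * R $ j)"
    by (simp add: Xv_def Yv_def pv_def qv_def S_def \<sigma>_def algebra_simps)
  then show ?thesis by (simp add: basis)
qed

lemma \<delta>_eq: "\<delta> \<mu> = d * (e \<bullet> (\<mu> - P)) - c * (f \<bullet> (\<mu> - P))"
  by (simp add: \<delta>_def \<sigma>_def inner_simps algebra_simps)

lemma dom_coords:
  assumes "\<mu> \<in> dom"
  shows "rt \<mu> > 0" "rt \<mu> = 1 + c * yc \<mu> + d * xc \<mu>" "\<delta> \<mu> = d * xc \<mu> - c * yc \<mu>"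
    "1 + c * yc \<mu> > 0" "1 + d * xc \<mu> > 0"
    "e \<bullet> (\<mu> - P) = xc \<mu> * (1 + c * yc \<mu>)" "f \<bullet> (\<mu> - P) = yc \<mu> * (1 + d * xc \<mu>)"
proof -
  define m n r s where "m = e \<bullet> (\<mu> - P)" and "n = f \<bullet> (\<mu> - P)" and "r = rt \<mu>" and "s = \<delta> \<mu>"
  have s: "s = d * m - c * n"
    by (simp add: s_def m_def n_def \<delta>_eq)
  have pos: "1 + r - s > 0" "1 + r + s > 0" "disc \<mu> > 0"
    using assms by (auto simp: dom_def r_def s_def)
  then show "rt \<mu> > 0" by (simp add: rt_def)
  have r2: "r^2 = 1 + s^2 + 2 * (d * m + c * n)"
    using pos(3) by (simp add: r_def rt_def disc_def m_def n_def s_def)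
  have x: "xc \<mu> = 2 * m / (1 + r - s)" and y: "yc \<mu> = 2 * n / (1 + r + s)"
    by (auto simp: xc_def yc_def m_def n_def r_def s_def)
  \<comment> \<open>With s = d m - c n, the formula for r^2 determines both d m and c n. The
    factorization exhibits the denominators of \<open>xc\<close> and \<open>yc\<close>, which then
    cancel.\<close>
  have "4 * (d * m) = (r - 1 + s) * (1 + r - s)" "4 * (c * n) = (r - 1 - s) * (1 + r + s)"
  proof -
    have *: "(r - 1 + s) * (1 + r - s) = r^2 - 1 + 2 * s - s^2" "(r - 1 - s) * (1 + r + s) = r^2 - 1 - 2 * s - s^2"
      by (simp_all add: power2_eq_square algebra_simps)
    show "4 * (d * m) = (r - 1 + s) * (1 + r - s)"
      unfolding * r2 by (simp add: s algebra_simps)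
    show "4 * (c * n) = (r - 1 - s) * (1 + r + s)"
      unfolding * r2 by (simp add: s algebra_simps)
  qed
  then have dx: "d * xc \<mu> = (r - 1 + s) / 2" and cy: "c * yc \<mu> = (r - 1 - s) / 2"
    unfolding x y using pos by (auto simp: field_simps)
  show "rt \<mu> = 1 + c * yc \<mu> + d * xc \<mu>" "\<delta> \<mu> = d * xc \<mu> - c * yc \<mu>"
    "1 + c * yc \<mu> > 0" "1 + d * xc \<mu> > 0"
    using dx cy pos by (auto simp: r_def[symmetric] s_def[symmetric])
  have "xc \<mu> * (1 + c * yc \<mu>) = xc \<mu> * (1 + r - s) / 2"
    unfolding cy by (simp add: field_simps)
  then show "e \<bullet> (\<mu> - P) = xc \<mu> * (1 + c * yc \<mu>)"
    using pos by (simp add: x m_def)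
  have "yc \<mu> * (1 + d * xc \<mu>) = yc \<mu> * (1 + r + s) / 2"
    unfolding dx by (simp add: field_simps)
  then show "f \<bullet> (\<mu> - P) = yc \<mu> * (1 + d * xc \<mu>)"
    using pos by (simp add: y n_def)
qed

lemma coords_pt:
  assumes "1 + c * y > 0" "1 + d * x > 0" "1 + c * y + d * x > 0"
  shows "pt x y \<in> dom" "xc (pt x y) = x" "yc (pt x y) = y" "rt (pt x y) = 1 + c * y + d * x"
proof -
  have "disc (pt x y) = (1 + c * y + d * x)\<^sup>2"
    unfolding disc_def \<delta>_def pt_dot by (simp add: power2_eq_square algebra_simps)
  with assms have rt: "rt (pt x y) = 1 + c * y + d * x" "disc (pt x y) > 0"
    by (auto simp: rt_def)
  then show "rt (pt x y) = 1 + c * y + d * x" "pt x y \<in> dom"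
    using assms by (auto simp: dom_def \<delta>_def pt_dot)
  have *: "1 + (1 + c * y + d * x) - (d * x - c * y) = 2 * (1 + c * y)"
    "1 + (1 + c * y + d * x) + (d * x - c * y) = 2 * (1 + d * x)"
    "2 * (x + c * x * y) = x * (2 * (1 + c * y))" "2 * (y + d * x * y) = y * (2 * (1 + d * x))"
    by (simp_all add: algebra_simps)
  show "xc (pt x y) = x" "yc (pt x y) = y"
    unfolding xc_def yc_def \<delta>_def pt_dot rt(1) *
    by (rule nonzero_mult_div_cancel_right, use assms in simp)+
qed

text \<open>The Jacobian 1 + c y + d x is affine in each variable, and \<open>cd\<close> is its
  positivity at the corners (0, 1), (1, 0) and (1, 1).\<close>

lemma jacobian_pos:
  assumes "0 \<le> x" "x \<le> 1" "0 \<le> y" "y \<le> 1"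
  shows "1 + c * y > 0" "1 + d * x > 0" "1 + c * y + d * x > 0" "1 + c + d * x > 0" "1 + d + c * y > 0"
proof -
  show 1: "1 + c * y > 0" "1 + d * x > 0" "1 + c + d * x > 0" and 2: "1 + d + c * y > 0"
    using affine_pos[of 1 c y] affine_pos[of 1 d x] affine_pos[of "1 + c" d x] affine_pos[of "1 + d" c y] cd assms
    by (auto simp: add.assoc add.commute)
  show "1 + c * y + d * x > 0"
    using affine_pos[of "1 + c * y" d x] 1 2 assms by (auto simp: algebra_simps)
qed

lemma coords_pt_unit:
  assumes "0 \<le> x" "x \<le> 1" "0 \<le> y" "y \<le> 1"
  shows "pt x y \<in> dom" "xc (pt x y) = x" "yc (pt x y) = y" "rt (pt x y) = 1 + c * y + d * x"
  using coords_pt jacobian_pos[OF assms] by auto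

lemma open_dom: "open dom"
  unfolding dom_def disc_def rt_def \<delta>_def
  by (intro open_Collect_conj open_Collect_less continuous_intros)

lemma Ck_on_affine: "Ck_on k U (\<lambda>\<mu>. w \<bullet> (\<mu> - P))" if "open U" for U :: "(real^2) set"
  using Ck_on_diff[OF that Ck_on_linear[OF bounded_linear_inner_right[of w]] Ck_on_const[of k U "w \<bullet> P"]]
  by (simp add: inner_diff_right)

lemma Ck_on_coords: "Ck_on k dom rt" "Ck_on k dom xc" "Ck_on k dom yc"
proof -
  note aff = Ck_on_affine[OF open_dom]
  have "Ck_on k dom \<delta>"
    unfolding \<delta>_def by (rule aff)
  moreover have "Ck_on k dom disc"
    unfolding disc_def by (intro Ck_on_intros open_dom aff \<open>Ck_on k dom \<delta>\<close>)
  then show rt: "Ck_on k dom rt"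
    unfolding rt_def by (rule Ck_on_sqrt[OF open_dom]) (simp add: dom_def)
  ultimately show "Ck_on k dom xc" "Ck_on k dom yc"
    unfolding xc_def yc_def
    by (intro Ck_on_divide Ck_on_intros open_dom aff; force simp: dom_def)+
qed

lemma affine_has_derivative: "((\<lambda>\<mu>. w \<bullet> (\<mu> - P)) has_derivative (\<lambda>v. w \<bullet> v)) F"
  by (rule derivative_eq_intros refl)+ simp

text \<open>Implicit differentiation of e \<bullet> (\<mu> - P) = x (1 + c y) and f \<bullet> (\<mu>
  - P) = y (1 + d x). The linear system for the differentials of x and y has determinant
  \<open>rt\<close>; their existence comes from \<open>Ck_on_coords\<close>.\<close>

lemma coords_has_derivative:
  assumes "\<mu> \<in> dom"
  shows "(xc has_derivative (\<lambda>v. Xv (xc \<mu>) \<bullet> v / rt \<mu>)) (at \<mu>)"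
    "(yc has_derivative (\<lambda>v. Yv (yc \<mu>) \<bullet> v / rt \<mu>)) (at \<mu>)"
    "(rt has_derivative (\<lambda>v. (d * (Xv (xc \<mu>) \<bullet> v) + c * (Yv (yc \<mu>) \<bullet> v)) / rt \<mu>)) (at \<mu>)"
proof -
  obtain x' where x': "(xc has_derivative x') (at \<mu>)"
    using Ck_on_coords(2)[of "Suc 0"] assms by (auto simp: differentiable_def)
  obtain y' where y': "(yc has_derivative y') (at \<mu>)"
    using Ck_on_coords(3)[of "Suc 0"] assms by (auto simp: differentiable_def)
  let ?x = "xc \<mu>" and ?y = "yc \<mu>" and ?D = "rt \<mu>"
  have 1: "e \<bullet> v = x' v * (1 + c * ?y) + ?x * (c * y' v)" for v
  proof -
    have "((\<lambda>\<mu>. xc \<mu> * (1 + c * yc \<mu>)) has_derivative (\<lambda>v. x' v * (1 + c * ?y) + ?x * (c * y' v))) (at \<mu>)"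
      (is "(_ has_derivative ?h) _")
      by (rule derivative_eq_intros x' y' refl)+ (simp add: algebra_simps)
    then have "((\<lambda>\<mu>. e \<bullet> (\<mu> - P)) has_derivative ?h) (at \<mu>)"
      by (rule has_derivative_transform_within_open[OF _ open_dom assms]) (simp add: dom_coords(6))
    from fun_cong[OF has_derivative_unique[OF affine_has_derivative this], of v]
    show ?thesis .
  qed
  have 2: "f \<bullet> v = y' v * (1 + d * ?x) + ?y * (d * x' v)" for v
  proof -
    have "((\<lambda>\<mu>. yc \<mu> * (1 + d * xc \<mu>)) has_derivative (\<lambda>v. y' v * (1 + d * ?x) + ?y * (d * x' v))) (at \<mu>)"
      (is "(_ has_derivative ?h) _")
      by (rule derivative_eq_intros x' y' refl)+ (simp add: algebra_simps)
    then have "((\<lambda>\<mu>. f \<bullet> (\<mu> - P)) has_derivative ?h) (at \<mu>)"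
      by (rule has_derivative_transform_within_open[OF _ open_dom assms]) (simp add: dom_coords(7))
    from fun_cong[OF has_derivative_unique[OF affine_has_derivative this], of v]
    show ?thesis .
  qed
  have D: "?D > 0" "?D = 1 + c * ?y + d * ?x"
    using dom_coords[OF assms] by auto
  have "Xv ?x \<bullet> v = ?D * x' v" "Yv ?y \<bullet> v = ?D * y' v" for v
    unfolding Xv_def Yv_def \<sigma>_def inner_simps 1 2 D(2) by (simp_all add: algebra_simps)
  then have "x' = (\<lambda>v. Xv ?x \<bullet> v / ?D)" "y' = (\<lambda>v. Yv ?y \<bullet> v / ?D)"
    using D(1) by (auto simp: fun_eq_iff)
  with x' y' show x: "(xc has_derivative (\<lambda>v. Xv ?x \<bullet> v / ?D)) (at \<mu>)"
    and y: "(yc has_derivative (\<lambda>v. Yv ?y \<bullet> v / ?D)) (at \<mu>)" by auto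
  have "((\<lambda>\<mu>. 1 + c * yc \<mu> + d * xc \<mu>) has_derivative
      (\<lambda>v. (d * (Xv ?x \<bullet> v) + c * (Yv ?y \<bullet> v)) / ?D)) (at \<mu>)"
    by (rule derivative_eq_intros x y refl)+ (simp add: add_divide_distrib add.commute)
  then show "(rt has_derivative (\<lambda>v. (d * (Xv ?x \<bullet> v) + c * (Yv ?y \<bullet> v)) / ?D)) (at \<mu>)"
    by (rule has_derivative_transform_within_open[OF _ open_dom assms]) (simp add: dom_coords(2))
qed

section \<open>The quadrilateral as the image of the unit square\<close>

definition quad :: "(real^2) set" where
  "quad = convex hull {P, P + Q, P + Q + R + S, P + R}"

lemma vertices_pt: "P = pt 0 0" "P + Q = pt 1 0" "P + Q + R + S = pt 1 1" "P + R = pt 0 1"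
  by (simp_all add: pt_def)

lemma pt_eqI:
  assumes "e \<bullet> (\<mu> - P) = x + c * x * y" "f \<bullet> (\<mu> - P) = y + d * x * y"
  shows "\<mu> = pt x y"
proof -
  from dual_basis_expand[OF basis, of "\<mu> - P"] have "\<mu> - P = (x + c * x * y) *\<^sub>R Q + (y + d * x * y) *\<^sub>R R"
    by (simp add: assms)
  then show ?thesis
    by (simp add: pt_def S_def algebra_simps)
qed

text \<open>An affine inequality need only be checked at the vertices. The four functionals are the
  edge conormals \<open>Xv 0\<close>, \<open>Yv 0\<close>, \<open>Xv 1\<close>,
  \<open>Yv 1\<close>.\<close>

lemma quad_halfspaces:
  assumes "\<mu> \<in> quad"
  shows "e \<bullet> (\<mu> - P) \<ge> 0" "f \<bullet> (\<mu> - P) \<ge> 0" "(e + \<sigma>) \<bullet> (\<mu> - P) \<le> 1 + d" "(f - \<sigma>) \<bullet> (\<mu> - P) \<le> 1 + c"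
proof -
  have ge: "w \<bullet> \<mu> \<ge> b" if "\<And>x y. x \<in> {0, 1} \<Longrightarrow> y \<in> {0, 1} \<Longrightarrow> w \<bullet> pt x y \<ge> b" for w b
  proof -
    have "quad \<subseteq> {\<mu>. w \<bullet> \<mu> \<ge> b}"
      unfolding quad_def
      by (rule hull_minimal)
        (use that[of 0 0] that[of 1 0] that[of 1 1] that[of 0 1] in
          \<open>simp_all add: vertices_pt[symmetric] convex_halfspace_ge\<close>)
    then show ?thesis using assms by auto
  qed
  have le: "w \<bullet> (\<mu> - P) \<ge> b" if "\<And>x y. x \<in> {0, 1} \<Longrightarrow> y \<in> {0, 1} \<Longrightarrow> w \<bullet> (pt x y - P) \<ge> b" for w b
    using ge[of "b + w \<bullet> P" w] that by (auto simp: inner_diff_right algebra_simps)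
  show "e \<bullet> (\<mu> - P) \<ge> 0" "f \<bullet> (\<mu> - P) \<ge> 0"
    by (rule le; use cd in \<open>auto simp: pt_dot\<close>)+
  have "- (e + \<sigma>) \<bullet> (\<mu> - P) \<ge> - (1 + d)"
    by (rule le) (use cd in \<open>auto simp: pt_dot inner_diff_left\<close>)
  then show "(e + \<sigma>) \<bullet> (\<mu> - P) \<le> 1 + d"
    unfolding inner_minus_left by simp
  have "- (f - \<sigma>) \<bullet> (\<mu> - P) \<ge> - (1 + c)"
    by (rule le) (use cd in \<open>auto simp: pt_dot inner_diff_left\<close>)
  then show "(f - \<sigma>) \<bullet> (\<mu> - P) \<le> 1 + c"
    unfolding inner_minus_left by simp
qed

lemma quad_pt:
  assumes "\<mu> \<in> quad"
  obtains x y where "\<mu> = pt x y" "0 \<le> x" "x \<le> 1" "0 \<le> y" "y \<le> 1"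
proof -
  define m n where "m = e \<bullet> (\<mu> - P)" and "n = f \<bullet> (\<mu> - P)"
  have h: "m \<ge> 0" "n \<ge> 0" "(1 + d) * m - c * n \<le> 1 + d" "(1 + c) * n - d * m \<le> 1 + c"
    using quad_halfspaces[OF assms] by (auto simp: m_def n_def \<sigma>_def inner_simps algebra_simps)
  \<comment> \<open>Eliminating y from m = x (1 + c y) and n = y (1 + d x) leaves this function of
    x; the halfspace inequalities give its signs at 0 and 1.\<close>
  have "continuous_on {0..1} (\<lambda>t. m * (1 + d * t) - c * t * n - t * (1 + d * t))"
    by (intro continuous_intros)
  then obtain x where x: "0 \<le> x" "x \<le> 1" "m * (1 + d * x) - c * x * n - x * (1 + d * x) = 0"
    using IVT2'[of "\<lambda>t. m * (1 + d * t) - c * t * n - t * (1 + d * t)" 1 0 0] h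
    by (auto simp: algebra_simps)
  define y where "y = n / (1 + d * x)"
  have pos: "1 + d * x > 0" "1 + c + d * x > 0"
    using jacobian_pos[of x 0] x by auto
  have n: "n = y * (1 + d * x)" and "y \<ge> 0"
    using pos h by (auto simp: y_def)
  have "m * (1 + d * x) = (x + c * x * y) * (1 + d * x)"
    using x(3) unfolding n by (simp add: algebra_simps)
  then have m: "m = x + c * x * y" using pos by simp
  have "(1 + c + d * x) * y \<le> (1 + c + d * x) * 1"
    using h(4) unfolding m n by (simp add: algebra_simps)
  then have "y \<le> 1" using pos by simp
  moreover have "\<mu> = pt x y"
    using m n by (intro pt_eqI) (auto simp: m_def n_def algebra_simps)
  ultimately show ?thesis
    using that x \<open>y \<ge> 0\<close> by blast
qed

lemma pt_in_quad:
  assumes "0 \<le> x" "x \<le> 1" "0 \<le> y" "y \<le> 1"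
  shows "pt x y \<in> quad"
proof -
  have conv: "(1 - t) *\<^sub>R u + t *\<^sub>R v \<in> quad" if "u \<in> quad" "v \<in> quad" "0 \<le> t" "t \<le> 1" for u v t
    using that convex_convex_hull unfolding quad_def by (intro convexD_alt) auto
  have v: "P \<in> quad" "P + Q \<in> quad" "P + Q + R + S \<in> quad" "P + R \<in> quad"
    unfolding quad_def by (auto intro: hull_inc)
  have "pt x y = (1 - y) *\<^sub>R ((1 - x) *\<^sub>R P + x *\<^sub>R (P + Q)) + y *\<^sub>R ((1 - x) *\<^sub>R (P + R) + x *\<^sub>R (P + Q + R + S))"
    by (simp add: pt_def algebra_simps)
  then show ?thesis
    using assms v by (auto intro!: conv)
qed

lemma quad_coords:
  assumes "\<mu> \<in> quad"
  shows "\<mu> \<in> dom" "\<mu> = pt (xc \<mu>) (yc \<mu>)" "0 \<le> xc \<mu>" "xc \<mu> \<le> 1" "0 \<le> yc \<mu>" "yc \<mu> \<le> 1"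
  by (rule quad_pt[OF assms]; simp add: coords_pt_unit)+

lemma interior_quad_coords:
  assumes "\<mu> \<in> interior quad"
  shows "0 < xc \<mu>" "xc \<mu> < 1" "0 < yc \<mu>" "yc \<mu> < 1"
proof -
  have q: "\<mu> \<in> quad"
    using assms interior_subset by blast
  obtain x y where xy: "\<mu> = pt x y" "0 \<le> x" "x \<le> 1" "0 \<le> y" "y \<le> 1"
    by (rule quad_pt[OF q])
  have gt: "w \<bullet> (\<mu> - P) > b" if "\<And>\<mu>. \<mu> \<in> quad \<Longrightarrow> w \<bullet> (\<mu> - P) \<ge> b" "w \<noteq> 0" for w b
  proof -
    have "quad \<subseteq> {\<mu>. w \<bullet> \<mu> \<ge> b + w \<bullet> P}"
      using that(1) by (auto simp: inner_diff_right algebra_simps)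
    then have "\<mu> \<in> interior {\<mu>. w \<bullet> \<mu> \<ge> b + w \<bullet> P}"
      using assms interior_mono by blast
    then show ?thesis
      using interior_halfspace_ge[OF that(2), of "b + w \<bullet> P"] by (auto simp: inner_diff_right algebra_simps)
  qed
  have nz: "e \<noteq> 0" "f \<noteq> 0" "- (e + \<sigma>) \<noteq> 0" "- (f - \<sigma>) \<noteq> 0"
  proof -
    have "(e + \<sigma>) \<bullet> Q = 1 + d" "(f - \<sigma>) \<bullet> R = 1 + c"
      by (auto simp: inner_simps dual dot_simps)
    with cd show "- (e + \<sigma>) \<noteq> 0" "- (f - \<sigma>) \<noteq> 0"
      by (metis inner_zero_left less_irrefl neg_equal_0_iff_equal)+
    show "e \<noteq> 0" "f \<noteq> 0"
      using dual by (metis inner_zero_left zero_neq_one)+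
  qed
  have "e \<bullet> (\<mu> - P) > 0" "f \<bullet> (\<mu> - P) > 0"
    using gt[OF quad_halfspaces(1) nz(1)] gt[OF quad_halfspaces(2) nz(2)] by auto
  moreover have "- (e + \<sigma>) \<bullet> (\<mu> - P) > - (1 + d)"
    by (rule gt[OF _ nz(3)]) (simp only: inner_minus_left neg_le_iff_le quad_halfspaces(3))
  moreover have "- (f - \<sigma>) \<bullet> (\<mu> - P) > - (1 + c)"
    by (rule gt[OF _ nz(4)]) (simp only: inner_minus_left neg_le_iff_le quad_halfspaces(4))
  ultimately have "x \<noteq> 0" "y \<noteq> 0" "x \<noteq> 1" "y \<noteq> 1"
    unfolding xy(1) inner_minus_left inner_add_left inner_diff_left pt_dot by (auto simp: algebra_simps)
  with xy coords_pt_unit[of x y] show "0 < xc \<mu>" "xc \<mu> < 1" "0 < yc \<mu>" "yc \<mu> < 1"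
    by auto
qed

end

section \<open>Symplectic potentials from two profile functions\<close>

lemma matrix_inv_eqI:
  fixes M N :: "real^'n^'n"
  assumes "M ** N = mat 1" "N ** M = mat 1"
  shows "matrix_inv M = N"
proof -
  have "M ** matrix_inv M = mat 1 \<and> matrix_inv M ** M = mat 1"
    unfolding matrix_inv_def by (rule someI[of _ N]) (use assms in auto)
  then have "matrix_inv M = (N ** M) ** matrix_inv M" "N = N ** (M ** matrix_inv M)"
    by (simp_all add: assms)
  then show ?thesis by (simp add: matrix_mul_assoc)
qed

lemma pdiff_sum:
  assumes "\<And>j. j \<in> I \<Longrightarrow> f j differentiable at x"
  shows "pdiff i (\<lambda>x. \<Sum>j\<in>I. f j x) x = (\<Sum>j\<in>I. pdiff i (f j) x)"
proof -
  have "((\<lambda>x. \<Sum>j\<in>I. f j x) has_derivative (\<lambda>v. \<Sum>j\<in>I. frechet_derivative (f j) (at x) v)) (at x)"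
    by (intro has_derivative_sum frechet_derivative_worksI assms)
  then show ?thesis
    by (subst pdiff_eqI) (auto simp: pdiff_def)
qed

text \<open>Along a segment the derivative increases strictly, so the mean slope before the dividing
  point is smaller than the mean slope after it.\<close>

lemma strictly_convex_onI:
  fixes \<phi> :: "real^'n \<Rightarrow> real"
  assumes "convex S"
    and \<phi>: "\<And>x. x \<in> S \<Longrightarrow> (\<phi> has_derivative (\<lambda>v. g x \<bullet> v)) (at x)"
    and g: "\<And>x. x \<in> S \<Longrightarrow> (g has_derivative g' x) (at x)"
    and pos: "\<And>x v. x \<in> S \<Longrightarrow> v \<noteq> 0 \<Longrightarrow> g' x v \<bullet> v > 0"
  shows "strictly_convex_on S \<phi>"
  unfolding strictly_convex_on_def
proof (intro conjI ballI allI impI)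
  fix x y t assume xy: "x \<in> S" "y \<in> S" and t: "x \<noteq> y \<and> 0 < t \<and> t < (1::real)"
  define l where "l = (\<lambda>t. x + t *\<^sub>R (y - x))"
  have lS: "l t \<in> S" if "0 \<le> t" "t \<le> 1" for t
    using convexD_alt[OF assms(1) xy that] by (simp add: l_def algebra_simps)
  have l: "(l has_derivative (\<lambda>h. h *\<^sub>R (y - x))) (at t)" for t
    unfolding l_def by (rule derivative_eq_intros refl)+ simp
  have 1: "((\<lambda>t. \<phi> (l t)) has_real_derivative g (l t) \<bullet> (y - x)) (at t)" if "0 \<le> t" "t \<le> 1" for t
    using has_derivative_compose[OF l \<phi>[OF lS[OF that]]]
    by (simp add: has_field_derivative_def mult.commute[of _ "_ \<bullet> _"])
  have 2: "((\<lambda>t. g (l t) \<bullet> (y - x)) has_real_derivative g' (l t) (y - x) \<bullet> (y - x)) (at t)"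
    if "0 \<le> t" "t \<le> 1" for t
  proof -
    have "((\<lambda>t. g (l t) \<bullet> (y - x)) has_derivative (\<lambda>h. g' (l t) (h *\<^sub>R (y - x)) \<bullet> (y - x))) (at t)"
      by (rule has_derivative_inner_left[OF has_derivative_compose[OF l g[OF lS[OF that]]]])
    moreover have "g' (l t) (h *\<^sub>R (y - x)) = h *\<^sub>R g' (l t) (y - x)" for h
      by (rule linear_scale[OF has_derivative_linear[OF g[OF lS[OF that]]]])
    ultimately show ?thesis
      by (simp add: has_field_derivative_def mult.commute[of _ "_ \<bullet> _"])
  qed
  obtain t1 where t1: "0 < t1" "t1 < t" "\<phi> (l t) - \<phi> (l 0) = (t - 0) * (g (l t1) \<bullet> (y - x))"
    using MVT2[of 0 t "\<lambda>t. \<phi> (l t)" "\<lambda>t. g (l t) \<bullet> (y - x)"] t 1 by auto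
  obtain t2 where t2: "t < t2" "t2 < 1" "\<phi> (l 1) - \<phi> (l t) = (1 - t) * (g (l t2) \<bullet> (y - x))"
    using MVT2[of t 1 "\<lambda>t. \<phi> (l t)" "\<lambda>t. g (l t) \<bullet> (y - x)"] t 1 by auto
  have "g (l t1) \<bullet> (y - x) < g (l t2) \<bullet> (y - x)"
  proof (rule DERIV_pos_imp_increasing[of t1 t2])
    fix r assume "t1 \<le> r" "r \<le> t2"
    then have r: "0 \<le> r" "r \<le> 1" using t1 t2 by auto
    show "\<exists>z. ((\<lambda>t. g (l t) \<bullet> (y - x)) has_real_derivative z) (at r) \<and> 0 < z"
      using 2[OF r] pos[OF lS[OF r], of "y - x"] t by (intro exI conjI) auto
  qed (use t1 t2 in auto)
  then have "(1 - t) * t * (g (l t1) \<bullet> (y - x)) < (1 - t) * t * (g (l t2) \<bullet> (y - x))"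
    using t by simp
  then have "(1 - t) * (\<phi> (l t) - \<phi> (l 0)) < t * (\<phi> (l 1) - \<phi> (l t))"
    unfolding t1(3) t2(3) by (simp add: mult_ac)
  moreover have "l 0 = x" "l 1 = y" "l t = (1 - t) *\<^sub>R x + t *\<^sub>R y"
    by (simp_all add: l_def algebra_simps)
  ultimately show "\<phi> ((1 - t) *\<^sub>R x + t *\<^sub>R y) < (1 - t) * \<phi> x + t * \<phi> y"
    by (simp add: algebra_simps)
qed (rule assms(1))

lemma Ck_on_antiderivative:
  fixes F :: "real \<Rightarrow> real"
  assumes "open S" "\<And>x. x \<in> S \<Longrightarrow> (F has_real_derivative g x) (at x)" "\<And>k. Ck_on k S g"
  shows "Ck_on k S F"
proof (cases k)
  case 0
  then show ?thesis using continuous_on_if_DERIV[OF assms(2)] by simp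
next
  case (Suc m)
  show ?thesis unfolding Suc by (rule Ck_on_SucI_real[OF assms(1,2,3)])
qed

lemma Ck_on_antiderivative_exists:
  fixes h :: "real \<Rightarrow> real"
  assumes "\<And>k. Ck_on k {0<..<1} h"
  obtains U where "\<And>x. x \<in> {0<..<1} \<Longrightarrow> (U has_real_derivative h x) (at x)" "\<And>k. Ck_on k {0<..<1} U"
proof -
  obtain U where U: "\<And>x. 0 < x \<Longrightarrow> x < 1 \<Longrightarrow> (U has_real_derivative h x) (at x)"
    by (rule antiderivative_unit_interval[OF Ck_on_imp_continuous_on[OF assms[of 0]]]) (rule that)
  then have U': "(U has_real_derivative h x) (at x)" if "x \<in> {0<..<1}" for x
    using that by simp
  show ?thesis
    by (rule that[OF U' Ck_on_antiderivative[OF open_greaterThanLessThan U' assms]])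
qed

text \<open>The profiles are smooth on the whole line, not only on [0, 1]: this extends
  \<open>H\<close> past the edges. Positivity is required only inside.\<close>

locale toric_profiles = bilinear_coordinates +
  fixes A A1 A2 B B1 B2 :: "real \<Rightarrow> real"
  assumes A: "\<And>x. (A has_real_derivative A1 x) (at x)" "\<And>x. (A1 has_real_derivative A2 x) (at x)"
      "\<And>k. Ck_on k UNIV A" "A 0 = 0" "A 1 = 0" "\<And>x. 0 < x \<Longrightarrow> x < 1 \<Longrightarrow> A x > 0"
    and B: "\<And>x. (B has_real_derivative B1 x) (at x)" "\<And>x. (B1 has_real_derivative B2 x) (at x)"
      "\<And>k. Ck_on k UNIV B" "B 0 = 0" "B 1 = 0" "\<And>x. 0 < x \<Longrightarrow> x < 1 \<Longrightarrow> B x > 0"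
begin

definition reg :: "(real^2) set" where
  "reg = {\<mu> \<in> dom. 0 < xc \<mu> \<and> xc \<mu> < 1 \<and> 0 < yc \<mu> \<and> yc \<mu> < 1}"

definition H :: "real^2 \<Rightarrow> real^2^2" where
  "H \<mu> = (\<chi> i j. (A (xc \<mu>) * pv (yc \<mu>) $ i * pv (yc \<mu>) $ j + B (yc \<mu>) * qv (xc \<mu>) $ i * qv (xc \<mu>) $ j) / rt \<mu>)"

text \<open>In the coordinates x, y this is the quadratic form rt (dx^2 / A + dy^2 / B).\<close>

definition G :: "real^2 \<Rightarrow> real^2^2" where
  "G \<mu> = (\<chi> i j. Xv (xc \<mu>) $ i * Xv (xc \<mu>) $ j / (A (xc \<mu>) * rt \<mu>) +
    Yv (yc \<mu>) $ i * Yv (yc \<mu>) $ j / (B (yc \<mu>) * rt \<mu>))"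

lemma open_reg: "open reg"
proof -
  have "continuous_on dom xc" "continuous_on dom yc"
    using Ck_on_coords[THEN Ck_on_imp_continuous_on] by auto
  then have "open (dom \<inter> xc -` {0<..<1})" "open (dom \<inter> yc -` {0<..<1})"
    using open_dom by (auto intro: continuous_open_preimage)
  moreover have "reg = (dom \<inter> xc -` {0<..<1}) \<inter> (dom \<inter> yc -` {0<..<1})"
    by (auto simp: reg_def)
  ultimately show ?thesis by (metis open_Int)
qed

lemma reg_dom: "\<mu> \<in> reg \<Longrightarrow> \<mu> \<in> dom"
  by (simp add: reg_def)

lemma interior_quad_reg: "interior quad \<subseteq> reg"
  using interior_quad_coords quad_coords(1) interior_subset[of quad] by (auto simp: reg_def)

lemma profile_pos:
  assumes "\<mu> \<in> reg"
  shows "A (xc \<mu>) > 0" "B (yc \<mu>) > 0" "rt \<mu> > 0"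
  using assms A(6) B(6) dom_coords(1) by (auto simp: reg_def)

lemma H_apply:
  "H \<mu> *v w = (1 / rt \<mu>) *\<^sub>R ((A (xc \<mu>) * (pv (yc \<mu>) \<bullet> w)) *\<^sub>R pv (yc \<mu>) +
    (B (yc \<mu>) * (qv (xc \<mu>) \<bullet> w)) *\<^sub>R qv (xc \<mu>))"
  by (simp add: H_def vec_eq_iff matrix_vector_mult_def inner_vec_def sum_2 add_divide_distrib algebra_simps)

lemma G_apply:
  "G \<mu> *v w = (Xv (xc \<mu>) \<bullet> w / (A (xc \<mu>) * rt \<mu>)) *\<^sub>R Xv (xc \<mu>) +
    (Yv (yc \<mu>) \<bullet> w / (B (yc \<mu>) * rt \<mu>)) *\<^sub>R Yv (yc \<mu>)"
  by (simp add: G_def vec_eq_iff matrix_vector_mult_def inner_vec_def sum_2 add_divide_distrib algebra_simps)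

lemma bilin_H:
  "bilin (H \<mu>) v w = (A (xc \<mu>) * (pv (yc \<mu>) \<bullet> v) * (pv (yc \<mu>) \<bullet> w) +
    B (yc \<mu>) * (qv (xc \<mu>) \<bullet> v) * (qv (xc \<mu>) \<bullet> w)) / rt \<mu>"
  by (simp add: bilin_def H_apply inner_simps inner_commute algebra_simps add_divide_distrib)

lemma frame_dot:
  assumes "\<mu> \<in> dom"
  shows "Xv (xc \<mu>) \<bullet> pv (yc \<mu>) = rt \<mu>" "Xv (xc \<mu>) \<bullet> qv (xc \<mu>) = 0"
    "Yv (yc \<mu>) \<bullet> pv (yc \<mu>) = 0" "Yv (yc \<mu>) \<bullet> qv (xc \<mu>) = rt \<mu>"
    "Xv (xc \<mu>) \<bullet> S = c" "Yv (yc \<mu>) \<bullet> S = d"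
  using dom_coords(2)[OF assms] XY_pq
  by (auto simp: Xv_def Yv_def inner_simps dot_simps)

lemma frame_expand:
  assumes "\<mu> \<in> dom"
  shows "(pv (yc \<mu>) \<bullet> w) *\<^sub>R Xv (xc \<mu>) + (qv (xc \<mu>) \<bullet> w) *\<^sub>R Yv (yc \<mu>) = rt \<mu> *\<^sub>R w" (is "?l1 = _")
    and "(Xv (xc \<mu>) \<bullet> w) *\<^sub>R pv (yc \<mu>) + (Yv (yc \<mu>) \<bullet> w) *\<^sub>R qv (xc \<mu>) = rt \<mu> *\<^sub>R w" (is "?l2 = _")
proof -
  have *: "Xv (xc \<mu>) $ i * pv (yc \<mu>) $ j + Yv (yc \<mu>) $ i * qv (xc \<mu>) $ j = (if i = j then rt \<mu> else 0)" for i j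
    unfolding frame_resolution dom_coords(2)[OF assms] ..
  have "?l1 $ i =
      (\<Sum>j\<in>UNIV. (Xv (xc \<mu>) $ i * pv (yc \<mu>) $ j + Yv (yc \<mu>) $ i * qv (xc \<mu>) $ j) * w $ j)" for i
    by (simp add: inner_vec_def sum_2 algebra_simps)
  then show "?l1 = rt \<mu> *\<^sub>R w"
    unfolding * by (simp add: vec_eq_iff if_distrib[of "\<lambda>t. t * _"] cong: if_cong)
  have "?l2 $ j =
      (\<Sum>i\<in>UNIV. (Xv (xc \<mu>) $ i * pv (yc \<mu>) $ j + Yv (yc \<mu>) $ i * qv (xc \<mu>) $ j) * w $ i)" for j
    by (simp add: inner_vec_def sum_2 algebra_simps)
  then show "?l2 = rt \<mu> *\<^sub>R w"
    unfolding * by (simp add: vec_eq_iff if_distrib[of "\<lambda>t. t * _"] cong: if_cong)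
qed

lemma G_H_inverse:
  assumes "\<mu> \<in> reg"
  shows "G \<mu> ** H \<mu> = mat 1" "H \<mu> ** G \<mu> = mat 1"
proof -
  note pos = profile_pos[OF assms] and dom = reg_dom[OF assms]
  let ?X = "Xv (xc \<mu>)" and ?Y = "Yv (yc \<mu>)" and ?p = "pv (yc \<mu>)" and ?q = "qv (xc \<mu>)" and ?D = "rt \<mu>"
  have "G \<mu> *v (H \<mu> *v w) = w" for w
  proof -
    have "G \<mu> *v (H \<mu> *v w) = (1 / ?D) *\<^sub>R ((?p \<bullet> w) *\<^sub>R ?X + (?q \<bullet> w) *\<^sub>R ?Y)"
      unfolding G_apply unfolding H_apply using pos
      by (simp add: inner_simps frame_dot[OF dom] scaleR_add_right)
    then show ?thesis using pos by (simp add: frame_expand[OF dom])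
  qed
  then show "G \<mu> ** H \<mu> = mat 1"
    by (simp add: matrix_eq matrix_vector_mul_assoc[symmetric])
  have sw: "?p \<bullet> ?X = ?D" "?q \<bullet> ?X = 0" "?p \<bullet> ?Y = 0" "?q \<bullet> ?Y = ?D"
    using frame_dot[OF dom] by (simp_all add: inner_commute)
  have "H \<mu> *v (G \<mu> *v w) = w" for w
  proof -
    have "H \<mu> *v (G \<mu> *v w) = (1 / ?D) *\<^sub>R ((?X \<bullet> w) *\<^sub>R ?p + (?Y \<bullet> w) *\<^sub>R ?q)"
      unfolding H_apply unfolding G_apply using pos
      by (simp add: inner_simps sw scaleR_add_right)
    then show ?thesis using pos by (simp add: frame_expand[OF dom])
  qed
  then show "H \<mu> ** G \<mu> = mat 1"
    by (simp add: matrix_eq matrix_vector_mul_assoc[symmetric])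
qed

lemma G_pos:
  assumes "\<mu> \<in> reg" "v \<noteq> 0"
  shows "(G \<mu> *v v) \<bullet> v > 0"
proof -
  note pos = profile_pos[OF assms(1)] and dom = reg_dom[OF assms(1)]
  have "Xv (xc \<mu>) \<bullet> v \<noteq> 0 \<or> Yv (yc \<mu>) \<bullet> v \<noteq> 0"
    using frame_expand(2)[OF dom, of v] pos assms(2) by auto
  moreover have "(G \<mu> *v v) \<bullet> v =
      (Xv (xc \<mu>) \<bullet> v)\<^sup>2 / (A (xc \<mu>) * rt \<mu>) + (Yv (yc \<mu>) \<bullet> v)\<^sup>2 / (B (yc \<mu>) * rt \<mu>)"
    by (simp add: G_apply inner_simps power2_eq_square)
  ultimately show ?thesis
    using pos by (auto intro: add_pos_nonneg add_nonneg_pos)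
qed

lemma Ck_on_H_component: "Ck_on k dom (\<lambda>\<mu>. H \<mu> $ i $ j)"
proof -
  have "Ck_on k dom (\<lambda>\<mu>. A (xc \<mu>))" "Ck_on k dom (\<lambda>\<mu>. B (yc \<mu>))"
    using Ck_on_compose[OF open_dom open_UNIV _ A(3) Ck_on_coords(2)]
      Ck_on_compose[OF open_dom open_UNIV _ B(3) Ck_on_coords(3)] by auto
  then show ?thesis
    unfolding H_def pv_def qv_def vec_lambda_beta vector_add_component vector_scaleR_component
    by (intro Ck_on_divide Ck_on_intros open_dom Ck_on_coords) (auto dest: dom_coords(1))
qed

lemma Ck_on_H: "Ck_on k dom H"
  by (intro Ck_on_vec_nth open_dom Ck_on_H_component)

text \<open>As a differential of a covector, \<open>G\<close> is (dx / A) Xv + (dy / B) Yv with Xv =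
  e + x \<sigma> and Yv = f - y \<sigma>. Each summand involves one variable only, so the gradient
  \<open>g\<close> is found by integrating 1 / A, x / A, 1 / B and y / B.\<close>

lemma potential_exists:
  obtains \<phi> g where "\<And>k. Ck_on k reg \<phi>"
    "\<And>\<mu>. \<mu> \<in> reg \<Longrightarrow> (\<phi> has_derivative (\<lambda>v. g \<mu> \<bullet> v)) (at \<mu>)"
    "\<And>\<mu>. \<mu> \<in> reg \<Longrightarrow> (g has_derivative (\<lambda>v. G \<mu> *v v)) (at \<mu>)"
proof -
  have nz: "(x::real) \<in> {0<..<1} \<Longrightarrow> A x \<noteq> 0" "x \<in> {0<..<1} \<Longrightarrow> B x \<noteq> 0" for x
    using A(6) B(6) by (auto simp: less_imp_neq[symmetric])
  have AB: "Ck_on k {0<..<1} A" "Ck_on k {0<..<1} B" for k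
    using A(3) B(3) by (auto intro: Ck_on_subset)
  have id: "Ck_on k T (\<lambda>x::real. x)" for k T
    by (rule Ck_on_linear) simp
  obtain U0 where U0: "\<And>x. x \<in> {0<..<1} \<Longrightarrow> (U0 has_real_derivative 1 / A x) (at x)" "\<And>k. Ck_on k {0<..<1} U0"
    by (rule Ck_on_antiderivative_exists[OF Ck_on_divide[OF open_greaterThanLessThan Ck_on_const[of _ _ 1] AB(1) nz(1)]]) (assumption | rule that)+
  obtain U1 where U1: "\<And>x. x \<in> {0<..<1} \<Longrightarrow> (U1 has_real_derivative x / A x) (at x)" "\<And>k. Ck_on k {0<..<1} U1"
    by (rule Ck_on_antiderivative_exists[OF Ck_on_divide[OF open_greaterThanLessThan id AB(1) nz(1)]]) (assumption | rule that)+
  obtain V0 where V0: "\<And>x. x \<in> {0<..<1} \<Longrightarrow> (V0 has_real_derivative 1 / B x) (at x)" "\<And>k. Ck_on k {0<..<1} V0"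
    by (rule Ck_on_antiderivative_exists[OF Ck_on_divide[OF open_greaterThanLessThan Ck_on_const[of _ _ 1] AB(2) nz(2)]]) (assumption | rule that)+
  obtain V1 where V1: "\<And>x. x \<in> {0<..<1} \<Longrightarrow> (V1 has_real_derivative x / B x) (at x)" "\<And>k. Ck_on k {0<..<1} V1"
    by (rule Ck_on_antiderivative_exists[OF Ck_on_divide[OF open_greaterThanLessThan id AB(2) nz(2)]]) (assumption | rule that)+
  define W0 where "W0 = (\<lambda>x. x * U0 x - U1 x)"
  define Z0 where "Z0 = (\<lambda>x. x * V0 x - V1 x)"
  have W0: "(W0 has_real_derivative U0 x) (at x)" and Z0: "(Z0 has_real_derivative V0 x) (at x)"
    if "x \<in> {0<..<1}" for x
    unfolding W0_def Z0_def by (rule derivative_eq_intros U0(1) U1(1) V0(1) V1(1) refl that | simp)+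
  have W0_Ck: "Ck_on k {0<..<1} W0" and Z0_Ck: "Ck_on k {0<..<1} Z0" for k
    unfolding W0_def Z0_def by (intro Ck_on_diff Ck_on_mult id U0 U1 V0 V1; simp)+
  obtain W1 where W1: "\<And>x. x \<in> {0<..<1} \<Longrightarrow> (W1 has_real_derivative U1 x) (at x)" "\<And>k. Ck_on k {0<..<1} W1"
    by (rule Ck_on_antiderivative_exists[OF U1(2)]) (rule that)
  obtain Z1 where Z1: "\<And>x. x \<in> {0<..<1} \<Longrightarrow> (Z1 has_real_derivative V1 x) (at x)" "\<And>k. Ck_on k {0<..<1} Z1"
    by (rule Ck_on_antiderivative_exists[OF V1(2)]) (rule that)
  \<comment> \<open>The x-derivative of \<phi> has to be g \<bullet> pv = (1 + c y) U0 + d U1 + d (y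
    V0 - V1), and the y-derivative is similar. The brackets y V0 - V1 = Z0 and x U0 - U1 = W0 are
    themselves antiderivatives of V0 and U0, which makes the two conditions compatible.\<close>
  define \<phi> where "\<phi> = (\<lambda>\<mu>. (1 + c * yc \<mu>) * W0 (xc \<mu>) + d * W1 (xc \<mu>) +
      (1 + d * xc \<mu>) * Z0 (yc \<mu>) + c * Z1 (yc \<mu>))"
  define g where "g = (\<lambda>\<mu>. U0 (xc \<mu>) *\<^sub>R e + U1 (xc \<mu>) *\<^sub>R \<sigma> + V0 (yc \<mu>) *\<^sub>R f - V1 (yc \<mu>) *\<^sub>R \<sigma>)"
  have sub: "reg \<subseteq> dom" and im: "xc ` reg \<subseteq> {0<..<1}" "yc ` reg \<subseteq> {0<..<1}"
    by (auto simp: reg_def)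
  note co = Ck_on_subset[OF Ck_on_coords(2) sub] Ck_on_subset[OF Ck_on_coords(3) sub]
  note xcomp = Ck_on_compose[OF open_reg open_greaterThanLessThan im(1) _ co(1)]
    and ycomp = Ck_on_compose[OF open_reg open_greaterThanLessThan im(2) _ co(2)]
  show ?thesis
  proof
    show "Ck_on k reg \<phi>" for k
      unfolding \<phi>_def
      by (intro Ck_on_intros open_reg co xcomp[OF W0_Ck] xcomp[OF W1(2)] ycomp[OF Z0_Ck] ycomp[OF Z1(2)])
    fix \<mu> assume \<mu>: "\<mu> \<in> reg"
    let ?x = "xc \<mu>" and ?y = "yc \<mu>" and ?D = "rt \<mu>"
    have x: "?x \<in> {0<..<1}" and y: "?y \<in> {0<..<1}" and dom: "\<mu> \<in> dom"
      using \<mu> by (auto simp: reg_def)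
    have D: "?D > 0" "?D = 1 + c * ?y + d * ?x"
      using dom_coords[OF dom] by auto
    note x' = coords_has_derivative(1)[OF dom] and y' = coords_has_derivative(2)[OF dom]
    note W0' = DERIV_compose_FDERIV[OF W0[OF x] x'] and W1' = DERIV_compose_FDERIV[OF W1(1)[OF x] x']
      and Z0' = DERIV_compose_FDERIV[OF Z0[OF y] y'] and Z1' = DERIV_compose_FDERIV[OF Z1(1)[OF y] y']
      and U0' = DERIV_compose_FDERIV[OF U0(1)[OF x] x'] and U1' = DERIV_compose_FDERIV[OF U1(1)[OF x] x']
      and V0' = DERIV_compose_FDERIV[OF V0(1)[OF y] y'] and V1' = DERIV_compose_FDERIV[OF V1(1)[OF y] y']
    have "(\<phi> has_derivative (\<lambda>v.
        ((1 + c * ?y) * (Xv ?x \<bullet> v / ?D * U0 ?x) + (c * (Yv ?y \<bullet> v / ?D)) * W0 ?x) +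
        d * (Xv ?x \<bullet> v / ?D * U1 ?x) +
        ((1 + d * ?x) * (Yv ?y \<bullet> v / ?D * V0 ?y) + (d * (Xv ?x \<bullet> v / ?D)) * Z0 ?y) +
        c * (Yv ?y \<bullet> v / ?D * V1 ?y))) (at \<mu>)"
      unfolding \<phi>_def
      by (rule derivative_eq_intros W0' W1' Z0' Z1' x' y' refl)+ simp
    moreover have "((1 + c * ?y) * (Xv ?x \<bullet> v / ?D * U0 ?x) + (c * (Yv ?y \<bullet> v / ?D)) * W0 ?x) +
        d * (Xv ?x \<bullet> v / ?D * U1 ?x) +
        ((1 + d * ?x) * (Yv ?y \<bullet> v / ?D * V0 ?y) + (d * (Xv ?x \<bullet> v / ?D)) * Z0 ?y) +
        c * (Yv ?y \<bullet> v / ?D * V1 ?y) = g \<mu> \<bullet> v" (is "?l = _") for v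
    proof -
      have id: "(1 + c * ?y) * (Xv ?x \<bullet> v) + c * ?x * (Yv ?y \<bullet> v) = ?D * (e \<bullet> v)"
        "d * ?y * (Xv ?x \<bullet> v) + (1 + d * ?x) * (Yv ?y \<bullet> v) = ?D * (f \<bullet> v)"
        "d * (Xv ?x \<bullet> v) - c * (Yv ?y \<bullet> v) = ?D * (\<sigma> \<bullet> v)"
        unfolding D(2) by (simp_all add: Xv_def Yv_def \<sigma>_def inner_simps algebra_simps)
      have "?D * (g \<mu> \<bullet> v) / ?D = (U0 ?x * (?D * (e \<bullet> v)) + (U1 ?x - V1 ?y) * (?D * (\<sigma> \<bullet> v)) + V0 ?y * (?D * (f \<bullet> v))) / ?D"
        by (simp add: g_def inner_simps algebra_simps)
      also have "\<dots> = ?l"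
        unfolding id[symmetric]
        by (simp add: W0_def Z0_def add_divide_distrib diff_divide_distrib algebra_simps)
      finally show ?thesis using D(1) by simp
    qed
    ultimately show "(\<phi> has_derivative (\<lambda>v. g \<mu> \<bullet> v)) (at \<mu>)" by simp
    have "(g has_derivative (\<lambda>v. (Xv ?x \<bullet> v / ?D * (1 / A ?x)) *\<^sub>R e + (Xv ?x \<bullet> v / ?D * (?x / A ?x)) *\<^sub>R \<sigma> +
       (Yv ?y \<bullet> v / ?D * (1 / B ?y)) *\<^sub>R f - (Yv ?y \<bullet> v / ?D * (?y / B ?y)) *\<^sub>R \<sigma>)) (at \<mu>)"
      unfolding g_def
      by (rule derivative_eq_intros U0' U1' V0' V1' refl)+ simp
    moreover have "(\<lambda>v. (Xv ?x \<bullet> v / ?D * (1 / A ?x)) *\<^sub>R e + (Xv ?x \<bullet> v / ?D * (?x / A ?x)) *\<^sub>R \<sigma> +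
       (Yv ?y \<bullet> v / ?D * (1 / B ?y)) *\<^sub>R f - (Yv ?y \<bullet> v / ?D * (?y / B ?y)) *\<^sub>R \<sigma>) = (\<lambda>v. G \<mu> *v v)"
      unfolding G_apply
      by (simp add: fun_eq_iff Xv_def Yv_def vec_eq_iff field_simps)
    ultimately show "(g has_derivative (\<lambda>v. G \<mu> *v v)) (at \<mu>)" by simp
  qed
qed

end

lemma dot_axis: "(x::real^'n) \<bullet> axis i 1 = x $ i"
  by (simp add: inner_axis)

context bilinear_coordinates
begin

lemma edge_coords:
  assumes s: "s 1 = P" "s 2 = P + Q" "s 3 = P + Q + R + S" "s (4::4) = P + R"
  shows "edge s 1 = {\<mu> \<in> quad. yc \<mu> = 0}" (is ?B) and "edge s 2 = {\<mu> \<in> quad. xc \<mu> = 1}" (is ?R)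
    and "edge s 3 = {\<mu> \<in> quad. yc \<mu> = 1}" (is ?T) and "edge s 4 = {\<mu> \<in> quad. xc \<mu> = 0}" (is ?L)
proof -
  have seg: "closed_segment a b = w ` {0..1}" if "\<And>t. (1 - t) *\<^sub>R a + t *\<^sub>R b = w t" for a b :: "real^2" and w
    using that by (force simp: closed_segment_def image_def)
  have four: "(4::4) + 1 = 1" "(3::4) + 1 = 4" "(2::4) + 1 = 3" "(1::4) + 1 = 2"
    by simp_all
  have flip: "(\<lambda>t. h (1 - t)) ` {0..1} = h ` {0..1}" for h :: "real \<Rightarrow> real^2"
  proof -
    have "(\<lambda>t::real. 1 - t) ` {0..1} = {0..1}"
      by (auto simp: image_iff intro!: bexI[of _ "1 - _"])
    then show ?thesis
      by (metis (no_types, lifting) image_cong image_image)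
  qed
  have e: "edge s 1 = (\<lambda>t. pt t 0) ` {0..1}" "edge s 2 = (\<lambda>t. pt 1 t) ` {0..1}"
    "edge s 3 = (\<lambda>t. pt t 1) ` {0..1}" "edge s 4 = (\<lambda>t. pt 0 t) ` {0..1}"
    unfolding edge_def four s
    by (rule seg seg[THEN trans, OF _ flip]; simp add: pt_def algebra_simps)+
  have on: "\<mu> = pt (xc \<mu>) (yc \<mu>)" "xc \<mu> \<in> {0..1}" "yc \<mu> \<in> {0..1}" if "\<mu> \<in> quad" for \<mu>
    using quad_coords[OF that] by auto
  show ?B ?R ?T ?L
    unfolding e by (auto simp: coords_pt_unit pt_in_quad) (metis on image_eqI)+
qed

end

context toric_profiles
begin

lemma potential_hess:
  assumes \<phi>: "\<And>\<mu>. \<mu> \<in> reg \<Longrightarrow> (\<phi> has_derivative (\<lambda>v. g \<mu> \<bullet> v)) (at \<mu>)"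
    and g: "\<And>\<mu>. \<mu> \<in> reg \<Longrightarrow> (g has_derivative (\<lambda>v. G \<mu> *v v)) (at \<mu>)"
    and \<mu>: "\<mu> \<in> reg"
  shows "hess \<phi> \<mu> = G \<mu>" "inv_hess \<phi> \<mu> = H \<mu>"
proof -
  have "pdiff i (pdiff j \<phi>) \<mu> = G \<mu> $ i $ j" for i j
  proof -
    have "((\<lambda>z. g z $ j) has_derivative (\<lambda>v. (G \<mu> *v v) $ j)) (at \<mu>)"
      by (rule bounded_linear.has_derivative[OF bounded_linear_vec_nth g[OF \<mu>]])
    then have "(pdiff j \<phi> has_derivative (\<lambda>v. (G \<mu> *v v) $ j)) (at \<mu>)"
      by (rule has_derivative_transform_within_open[OF _ open_reg \<mu>])
        (simp add: pdiff_eqI[OF \<phi>] dot_axis)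
    then have "pdiff i (pdiff j \<phi>) \<mu> = (G \<mu> *v axis i 1) $ j"
      by (rule pdiff_eqI)
    also have "\<dots> = G \<mu> $ j $ i"
      by (simp add: matrix_vector_mult_basis column_def)
    finally show ?thesis by (simp add: G_def mult.commute)
  qed
  then show h: "hess \<phi> \<mu> = G \<mu>"
    by (simp add: hess_def vec_eq_iff)
  show "inv_hess \<phi> \<mu> = H \<mu>"
    unfolding inv_hess_def h by (rule matrix_inv_eqI[OF G_H_inverse[OF \<mu>]])
qed

section \<open>The divergence of \<open>H\<close> and the soliton equation\<close>

lemma frame_component_derivatives:
  assumes "\<mu> \<in> dom"
  shows "((\<lambda>\<mu>. pv (yc \<mu>) $ i) has_derivative (\<lambda>v. Yv (yc \<mu>) \<bullet> v / rt \<mu> * S $ i)) (at \<mu>)"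
    "((\<lambda>\<mu>. qv (xc \<mu>) $ i) has_derivative (\<lambda>v. Xv (xc \<mu>) \<bullet> v / rt \<mu> * S $ i)) (at \<mu>)"
    "((\<lambda>\<mu>. inverse (rt \<mu>)) has_derivative (\<lambda>v. - (inverse (rt \<mu>) *
      ((d * (Xv (xc \<mu>) \<bullet> v) + c * (Yv (yc \<mu>) \<bullet> v)) / rt \<mu>) * inverse (rt \<mu>)))) (at \<mu>)"
  unfolding pv_def qv_def vector_add_component vector_scaleR_component
  by ((rule derivative_eq_intros coords_has_derivative[OF assms] refl | simp)+)[2]
    (rule Deriv.has_derivative_inverse[OF dom_coords(1)[OF assms, THEN less_imp_neq, symmetric]
        coords_has_derivative(3)[OF assms]])

lemma pdiff_H:
  assumes "\<mu> \<in> dom"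
  defines "E \<equiv> inverse (rt \<mu>)" and "p \<equiv> pv (yc \<mu>)" and "q \<equiv> qv (xc \<mu>)"
    and "X \<equiv> Xv (xc \<mu>)" and "Y \<equiv> Yv (yc \<mu>)"
  shows "pdiff k (\<lambda>\<mu>. H \<mu> $ i $ j) \<mu> =
    E * E * (A1 (xc \<mu>) * X $ k * p $ i * p $ j + A (xc \<mu>) * Y $ k * (S $ i * p $ j + p $ i * S $ j)
      + B1 (yc \<mu>) * Y $ k * q $ i * q $ j + B (yc \<mu>) * X $ k * (S $ i * q $ j + q $ i * S $ j))
    - E * E * E * (d * X $ k + c * Y $ k) * (A (xc \<mu>) * p $ i * p $ j + B (yc \<mu>) * q $ i * q $ j)"
proof -
  note D = coords_has_derivative[OF assms(1)] and F = frame_component_derivatives[OF assms(1)]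
  note A' = DERIV_compose_FDERIV[OF A(1) D(1)] and B' = DERIV_compose_FDERIV[OF B(1) D(2)]
  have "((\<lambda>\<mu>. H \<mu> $ i $ j) has_derivative (\<lambda>v.
      (A (xc \<mu>) * p $ i * p $ j + B (yc \<mu>) * q $ i * q $ j) *
        - (E * ((d * (X \<bullet> v) + c * (Y \<bullet> v)) / rt \<mu>) * E) +
      ((A (xc \<mu>) * p $ i * (Y \<bullet> v / rt \<mu> * S $ j) +
        (A (xc \<mu>) * (Y \<bullet> v / rt \<mu> * S $ i) + X \<bullet> v / rt \<mu> * A1 (xc \<mu>) * p $ i) * p $ j) +
       (B (yc \<mu>) * q $ i * (X \<bullet> v / rt \<mu> * S $ j) +
        (B (yc \<mu>) * (X \<bullet> v / rt \<mu> * S $ i) + Y \<bullet> v / rt \<mu> * B1 (yc \<mu>) * q $ i) * q $ j)) * E)) (at \<mu>)"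
    unfolding H_def vec_lambda_beta divide_inverse[of _ "rt _"] E_def p_def q_def X_def Y_def
    by (rule has_derivative_mult has_derivative_add F[unfolded divide_inverse[of _ "rt _"]]
        A'[unfolded divide_inverse[of _ "rt _"]] B'[unfolded divide_inverse[of _ "rt _"]])+
  from pdiff_eqI[OF this, of k] show ?thesis
    unfolding dot_axis divide_inverse[of _ "rt _"] E_def[symmetric] by (simp add: algebra_simps)
qed

lemma frame_dot_sum:
  assumes "\<mu> \<in> dom"
  defines "p \<equiv> pv (yc \<mu>)" and "q \<equiv> qv (xc \<mu>)" and "X \<equiv> Xv (xc \<mu>)" and "Y \<equiv> Yv (yc \<mu>)"
  shows "X $ 1 * p $ 1 + X $ 2 * p $ 2 = rt \<mu>" "X $ 1 * q $ 1 + X $ 2 * q $ 2 = 0"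
    "Y $ 1 * p $ 1 + Y $ 2 * p $ 2 = 0" "Y $ 1 * q $ 1 + Y $ 2 * q $ 2 = rt \<mu>"
    "X $ 1 * S $ 1 + X $ 2 * S $ 2 = c" "Y $ 1 * S $ 1 + Y $ 2 * S $ 2 = d"
  using frame_dot[OF assms(1)] by (simp_all add: inner_vec_def sum_2 p_def q_def X_def Y_def)

definition divH :: "2 \<Rightarrow> real^2 \<Rightarrow> real" where
  "divH i \<mu> = inverse (rt \<mu>) * (A1 (xc \<mu>) * pv (yc \<mu>) $ i + B1 (yc \<mu>) * qv (xc \<mu>) $ i)"

text \<open>The undifferentiated profiles drop out: in the term with \<open>A\<close> the variation
  of \<open>pv\<close> contributes Yv \<bullet> S = d, and that of 1 / rt contributes - d. In the
  term with \<open>B\<close> the same happens with c.\<close>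

lemma divergence_H:
  assumes "\<mu> \<in> dom"
  shows "(\<Sum>j\<in>UNIV. pdiff j (\<lambda>\<mu>. H \<mu> $ i $ j) \<mu>) =
    divH i \<mu>"
proof -
  define E p q X Y where "E = inverse (rt \<mu>)" and "p = pv (yc \<mu>)" and "q = qv (xc \<mu>)"
    and "X = Xv (xc \<mu>)" and "Y = Yv (yc \<mu>)"
  note fd = frame_dot_sum[OF assms, folded p_def q_def X_def Y_def]
  have D: "rt \<mu> * E = 1"
    using dom_coords(1)[OF assms] by (simp add: E_def)
  let ?a = "A (xc \<mu>)" and ?b = "B (yc \<mu>)" and ?a1 = "A1 (xc \<mu>)" and ?b1 = "B1 (yc \<mu>)"
  have "(\<Sum>j\<in>UNIV. pdiff j (\<lambda>\<mu>. H \<mu> $ i $ j) \<mu>) =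
    E * E * (?a1 * p $ i * (X $ 1 * p $ 1 + X $ 2 * p $ 2) + ?a * (S $ i * (Y $ 1 * p $ 1 + Y $ 2 * p $ 2) + p $ i * (Y $ 1 * S $ 1 + Y $ 2 * S $ 2))
      + ?b1 * q $ i * (Y $ 1 * q $ 1 + Y $ 2 * q $ 2) + ?b * (S $ i * (X $ 1 * q $ 1 + X $ 2 * q $ 2) + q $ i * (X $ 1 * S $ 1 + X $ 2 * S $ 2)))
    - E * E * E * (?a * p $ i * (d * (X $ 1 * p $ 1 + X $ 2 * p $ 2) + c * (Y $ 1 * p $ 1 + Y $ 2 * p $ 2)) +
      ?b * q $ i * (d * (X $ 1 * q $ 1 + X $ 2 * q $ 2) + c * (Y $ 1 * q $ 1 + Y $ 2 * q $ 2)))"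
    unfolding pdiff_H[OF assms] E_def[symmetric] p_def[symmetric] q_def[symmetric] X_def[symmetric] Y_def[symmetric]
    by (simp add: sum_2 algebra_simps)
  also have "\<dots> = E * (rt \<mu> * E) * (?a1 * p $ i + ?b1 * q $ i) + (E * E - E * E * (rt \<mu> * E)) * (?a * p $ i * d + ?b * q $ i * c)"
    unfolding fd by (simp add: algebra_simps)
  finally show ?thesis
    unfolding D divH_def by (simp add: E_def p_def q_def)
qed

text \<open>The cancellation of \<open>divergence_H\<close> repeats with \<open>A1\<close>,
  \<open>B1\<close> in place of \<open>A\<close>, \<open>B\<close>.\<close>

lemma divergence2_H:
  assumes "\<mu> \<in> dom"
  shows "(\<Sum>i\<in>UNIV. pdiff i (divH i) \<mu>) =
    inverse (rt \<mu>) * (A2 (xc \<mu>) + B2 (yc \<mu>))"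
proof -
  define E p q X Y where "E = inverse (rt \<mu>)" and "p = pv (yc \<mu>)" and "q = qv (xc \<mu>)"
    and "X = Xv (xc \<mu>)" and "Y = Yv (yc \<mu>)"
  note defs = E_def p_def q_def X_def Y_def
  note fd = frame_dot_sum[OF assms, folded p_def q_def X_def Y_def]
  have D: "rt \<mu> * E = 1"
    using dom_coords(1)[OF assms] by (simp add: E_def)
  note C = coords_has_derivative[OF assms] and F = frame_component_derivatives[OF assms]
  note A' = DERIV_compose_FDERIV[OF A(2) C(1)] and B' = DERIV_compose_FDERIV[OF B(2) C(2)]
  let ?a1 = "A1 (xc \<mu>)" and ?b1 = "B1 (yc \<mu>)" and ?a2 = "A2 (xc \<mu>)" and ?b2 = "B2 (yc \<mu>)"
  have "((divH i) has_derivative (\<lambda>v.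
      E * ((?a1 * (Y \<bullet> v / rt \<mu> * S $ i) + X \<bullet> v / rt \<mu> * ?a2 * p $ i) +
        (?b1 * (X \<bullet> v / rt \<mu> * S $ i) + Y \<bullet> v / rt \<mu> * ?b2 * q $ i)) +
      - (E * ((d * (X \<bullet> v) + c * (Y \<bullet> v)) / rt \<mu>) * E) * (?a1 * p $ i + ?b1 * q $ i))) (at \<mu>)" for i
    unfolding defs divH_def by (rule has_derivative_mult has_derivative_add F A' B')+
  from pdiff_eqI[OF this]
  have "pdiff i (divH i) \<mu> =
      E * E * ((?a1 * (Y $ i * S $ i) + X $ i * ?a2 * p $ i) + (?b1 * (X $ i * S $ i) + Y $ i * ?b2 * q $ i)) -
      E * E * E * (d * X $ i + c * Y $ i) * (?a1 * p $ i + ?b1 * q $ i)" for i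
    unfolding dot_axis divide_inverse[of _ "rt _"] E_def[symmetric] by (simp add: algebra_simps)
  then have "(\<Sum>i\<in>UNIV. pdiff i (divH i) \<mu>) =
      E * E * ((?a1 * (Y $ 1 * S $ 1 + Y $ 2 * S $ 2) + (X $ 1 * p $ 1 + X $ 2 * p $ 2) * ?a2) +
        (?b1 * (X $ 1 * S $ 1 + X $ 2 * S $ 2) + ?b2 * (Y $ 1 * q $ 1 + Y $ 2 * q $ 2))) -
      E * E * E * (d * (?a1 * (X $ 1 * p $ 1 + X $ 2 * p $ 2) + ?b1 * (X $ 1 * q $ 1 + X $ 2 * q $ 2)) +
        c * (?a1 * (Y $ 1 * p $ 1 + Y $ 2 * p $ 2) + ?b1 * (Y $ 1 * q $ 1 + Y $ 2 * q $ 2)))"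
    by (simp add: sum_2 algebra_simps)
  also have "\<dots> = E * (rt \<mu> * E) * (?a2 + ?b2) + (E * E - E * E * (rt \<mu> * E)) * (?a1 * d + ?b1 * c)"
    unfolding fd by (simp add: algebra_simps)
  finally show ?thesis
    unfolding D by (simp add: E_def)
qed

lemma H_component_differentiable:
  assumes "\<mu> \<in> dom"
  shows "(\<lambda>\<mu>. H \<mu> $ i $ j) differentiable at \<mu>" "(\<lambda>\<mu>. pdiff k (\<lambda>\<mu>. H \<mu> $ i $ j) \<mu>) differentiable at \<mu>"
proof -
  show "(\<lambda>\<mu>. H \<mu> $ i $ j) differentiable at \<mu>" "(\<lambda>\<mu>. pdiff k (\<lambda>\<mu>. H \<mu> $ i $ j) \<mu>) differentiable at \<mu>"
    using Ck_on_H_component[of "Suc (Suc 0)" i j] assms unfolding pdiff_def by simp_all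
qed

text \<open>All terms share the factor 1 / rt, because a \<bullet> pv = a \<bullet> Q and a
  \<bullet> qv = a \<bullet> R; clearing it produces the Jacobian on the right-hand side of
  \<open>ode\<close>.\<close>

lemma soliton_equation:
  assumes \<phi>: "\<And>\<mu>. \<mu> \<in> reg \<Longrightarrow> inv_hess \<phi> \<mu> = H \<mu>"
    and \<mu>: "\<mu> \<in> reg" and a: "a \<bullet> S = 0"
    and ode: "\<And>x y. - (A2 x + B2 y) + 2 * ((a \<bullet> Q) * A1 x + (a \<bullet> R) * B1 y) = \<kappa> * (1 + c * y + d * x)"
  shows "- (\<Sum>i\<in>UNIV. \<Sum>j\<in>UNIV. pdiff i (pdiff j (\<lambda>y. inv_hess \<phi> y $ i $ j)) \<mu>)
    + 2 * (\<Sum>i\<in>UNIV. \<Sum>j\<in>UNIV. a $ j * pdiff i (\<lambda>y. inv_hess \<phi> y $ i $ j) \<mu>) = \<kappa>"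
proof -
  have p1: "pdiff k (\<lambda>y. inv_hess \<phi> y $ i $ j) z = pdiff k (\<lambda>y. H y $ i $ j) z" if "z \<in> reg" for i j k z
    by (rule pdiff_cong[OF open_reg that]) (use \<phi> that reg_dom H_component_differentiable(1) in auto)
  have p2: "pdiff l (pdiff k (\<lambda>y. inv_hess \<phi> y $ i $ j)) \<mu> = pdiff l (pdiff k (\<lambda>y. H y $ i $ j)) \<mu>" for i j k l
    by (rule pdiff_cong[OF open_reg \<mu>]) (use p1 \<mu> reg_dom H_component_differentiable(2) in auto)
  have dom: "\<mu> \<in> dom" using \<mu> by (rule reg_dom)
  have "(\<Sum>i\<in>UNIV. \<Sum>j\<in>UNIV. pdiff i (pdiff j (\<lambda>y. H y $ i $ j)) \<mu>) =
      (\<Sum>i\<in>UNIV. pdiff i (\<lambda>z. \<Sum>j\<in>UNIV. pdiff j (\<lambda>y. H y $ i $ j) z) \<mu>)"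
    by (intro sum.cong refl pdiff_sum[symmetric] H_component_differentiable(2)[OF dom])
  also have "\<dots> = (\<Sum>i\<in>UNIV. pdiff i (divH i) \<mu>)"
  proof (rule sum.cong[OF refl], rule pdiff_cong[symmetric, OF open_dom dom])
    fix i
    show "(\<lambda>z. \<Sum>j\<in>UNIV. pdiff j (\<lambda>y. H y $ i $ j) z) differentiable at \<mu>"
      by (intro differentiable_sum ballI H_component_differentiable(2)[OF dom]) simp
  qed (rule divergence_H)
  finally have 2: "(\<Sum>i\<in>UNIV. \<Sum>j\<in>UNIV. pdiff i (pdiff j (\<lambda>y. H y $ i $ j)) \<mu>) =
      inverse (rt \<mu>) * (A2 (xc \<mu>) + B2 (yc \<mu>))"
    unfolding divergence2_H[OF dom] .
  have sym: "(\<lambda>y. H y $ i $ j) = (\<lambda>y. H y $ j $ i)" for i j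
    by (simp add: H_def mult_ac)
  have "(\<Sum>i\<in>UNIV. \<Sum>j\<in>UNIV. a $ j * pdiff i (\<lambda>y. H y $ i $ j) \<mu>) =
      (\<Sum>j\<in>UNIV. a $ j * (\<Sum>i\<in>UNIV. pdiff i (\<lambda>y. H y $ j $ i) \<mu>))"
    unfolding sum_distrib_left by (subst sum.swap) (simp add: sym[of _ "_"])
  also have "\<dots> = inverse (rt \<mu>) * (A1 (xc \<mu>) * (a \<bullet> pv (yc \<mu>)) + B1 (yc \<mu>) * (a \<bullet> qv (xc \<mu>)))"
    unfolding divergence_H[OF dom] divH_def by (simp add: inner_vec_def sum_2 algebra_simps)
  also have "\<dots> = inverse (rt \<mu>) * (A1 (xc \<mu>) * (a \<bullet> Q) + B1 (yc \<mu>) * (a \<bullet> R))"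
    by (simp add: pv_def qv_def inner_simps a)
  finally have 1: "(\<Sum>i\<in>UNIV. \<Sum>j\<in>UNIV. a $ j * pdiff i (\<lambda>y. H y $ i $ j) \<mu>) =
      inverse (rt \<mu>) * (A1 (xc \<mu>) * (a \<bullet> Q) + B1 (yc \<mu>) * (a \<bullet> R))" .
  have "- (inverse (rt \<mu>) * (A2 (xc \<mu>) + B2 (yc \<mu>))) +
      2 * (inverse (rt \<mu>) * (A1 (xc \<mu>) * (a \<bullet> Q) + B1 (yc \<mu>) * (a \<bullet> R))) =
      inverse (rt \<mu>) * (- (A2 (xc \<mu>) + B2 (yc \<mu>)) + 2 * ((a \<bullet> Q) * A1 (xc \<mu>) + (a \<bullet> R) * B1 (yc \<mu>)))"
    by (simp add: algebra_simps)
  also have "\<dots> = \<kappa>"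
    unfolding ode using dom_coords(1,2)[OF dom] by simp
  finally show ?thesis
    unfolding p2 p1[OF \<mu>] 2 1 .
qed

end

section \<open>Hamiltonian 2-forms of toric metrics\<close>

lemma sum_UNIV_Plus: "(\<Sum>p\<in>(UNIV::(2 + 2) set). f p) = (\<Sum>i\<in>UNIV. f (Inl i)) + (\<Sum>i\<in>UNIV. f (Inr i))"
proof -
  have "(\<Sum>p\<in>UNIV. f p) = (\<Sum>p\<in>UNIV <+> UNIV. f p)"
    by (simp only: UNIV_Plus_UNIV)
  also have "\<dots> = (\<Sum>i\<in>UNIV. f (Inl i)) + (\<Sum>i\<in>UNIV. f (Inr i))"
    by (simp add: sum.Plus del: UNIV_Plus_UNIV)
  finally show ?thesis .
qed

lemma mu_linear: "bounded_linear mu"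
  by (rule linear_conv_bounded_linear[THEN iffD1]) (simp add: linear_iff mu_def vec_eq_iff)

lemma pdiff_mu:
  assumes "h differentiable at (mu z)"
  shows "pdiff (Inl k) (\<lambda>y. h (mu y)) z = pdiff k h (mu z)" "pdiff (Inr k) (\<lambda>y. h (mu y)) z = 0"
proof -
  have d: "((\<lambda>y. h (mu y)) has_derivative (\<lambda>v. frechet_derivative h (at (mu z)) (mu v))) (at z)"
    by (rule has_derivative_compose[OF bounded_linear_imp_has_derivative[OF mu_linear]
          frechet_derivative_worksI[OF assms]])
  have "mu (axis (Inl k) 1) = axis k 1" "mu (axis (Inr k) 1) = 0"
    by (simp_all add: mu_def vec_eq_iff axis_def)
  with pdiff_eqI[OF d] show "pdiff (Inl k) (\<lambda>y. h (mu y)) z = pdiff k h (mu z)"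
      "pdiff (Inr k) (\<lambda>y. h (mu y)) z = 0"
    using linear_0[OF has_derivative_linear[OF frechet_derivative_worksI[OF assms]]]
    by (simp_all add: pdiff_def[of _ h])
qed

lemma pdiff_const: "pdiff k (\<lambda>y. c) z = 0"
  by (rule pdiff_eqI[OF has_derivative_const])

text \<open>The pointwise content of the equation of Hamiltonian 2-forms, in momentum-angle coordinates.
  Here \<open>g3\<close> and \<open>h3\<close> are the first derivatives of \<open>G\<close> and \<open>H\<close>, and the last assumption is the
  derivative of the symmetry of \<open>\<Psi> G\<close>.\<close>

locale hamiltonian_algebra =
  fixes G H \<Psi> :: "2 \<Rightarrow> 2 \<Rightarrow> real" and g3 h3 :: "2 \<Rightarrow> 2 \<Rightarrow> 2 \<Rightarrow> real" and \<sigma> :: "2 \<Rightarrow> real"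
  assumes GH: "\<And>i j. (\<Sum>k\<in>UNIV. G i k * H k j) = (if i = j then 1 else 0)"
    and sym: "\<And>i j. G i j = G j i" "\<And>i j. H i j = H j i"
      "\<And>k i j. g3 k i j = g3 k j i" "\<And>k i j. g3 k i j = g3 i k j"
    and h3: "\<And>k i j. h3 k i j = - (\<Sum>p\<in>UNIV. \<Sum>q\<in>UNIV. H i p * g3 k p q * H q j)"
    and \<Psi>G: "\<And>i k. (\<Sum>l\<in>UNIV. \<Psi> i l * G l k) = (\<Sum>l\<in>UNIV. \<Psi> k l * G l i)"
    and d\<Psi>G: "\<And>i k m. (\<Sum>l\<in>UNIV. \<Psi> i l * g3 m l k) - (\<Sum>l\<in>UNIV. \<Psi> k l * g3 m l i) = \<sigma> k * G m i - \<sigma> i * G m k"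
begin

text \<open>This array is symmetric in its last two indices, and its skew part in the first two is
  prescribed by \<open>d\<Psi>G\<close>. The identities \<open>mixed\<close>, \<open>base\<close>
  and \<open>fibre\<close> all reduce to that skew part.\<close>

definition T where "T i k m = (\<Sum>l\<in>UNIV. \<Psi> i l * g3 m l k)"

lemma T_skew: "T i k m - T k i m = \<sigma> k * G m i - \<sigma> i * G m k"
  using d\<Psi>G by (simp add: T_def)

lemma T_sym: "T i k m = T i m k"
  unfolding T_def using sym by metis

text \<open>Multiplying the symmetric matrix \<Psi> G by \<open>H\<close> on both sides shows that H
  \<Psi> is symmetric too.\<close>

lemma H\<Psi>: "(\<Sum>l\<in>UNIV. H k l * \<Psi> l b) = (\<Sum>l\<in>UNIV. \<Psi> l k * H l b)"
proof -
  have HG: "(\<Sum>l\<in>UNIV. H i l * G l j) = (if i = j then 1 else 0)" for i j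
    using GH[of j i] sym by (simp add: sum_2 mult.commute)
  have "(\<Sum>l\<in>UNIV. H k l * \<Psi> l b) = (\<Sum>l\<in>UNIV. H k l * (\<Sum>m\<in>UNIV. \<Psi> l m * (\<Sum>n\<in>UNIV. G m n * H n b)))"
    unfolding GH by (simp add: if_distrib[of "(*) _"] cong: if_cong)
  also have "\<dots> = (\<Sum>l\<in>UNIV. \<Sum>n\<in>UNIV. H k l * (\<Sum>m\<in>UNIV. \<Psi> l m * G m n) * H n b)"
    by (simp add: sum_2 algebra_simps)
  also have "\<dots> = (\<Sum>l\<in>UNIV. \<Sum>n\<in>UNIV. H k l * (\<Sum>m\<in>UNIV. \<Psi> n m * G m l) * H n b)"
    by (subst \<Psi>G) simp
  also have "\<dots> = (\<Sum>n\<in>UNIV. (\<Sum>m\<in>UNIV. (\<Sum>l\<in>UNIV. H k l * G l m) * \<Psi> n m) * H n b)"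
    using sym(1) by (simp add: sum_2 algebra_simps)
  also have "\<dots> = (\<Sum>l\<in>UNIV. \<Psi> l k * H l b)"
    unfolding HG by (simp add: if_distrib[of "\<lambda>t. t * _"] cong: if_cong)
  finally show ?thesis .
qed

lemma G_h3: "(\<Sum>c\<in>UNIV. G b c * h3 m c j) = - (\<Sum>q\<in>UNIV. g3 m b q * H q j)"
proof -
  have "(\<Sum>c\<in>UNIV. G b c * h3 m c j) = - (\<Sum>p\<in>UNIV. (\<Sum>c\<in>UNIV. G b c * H c p) * (\<Sum>q\<in>UNIV. g3 m p q * H q j))"
    unfolding h3 by (simp add: sum_2 algebra_simps)
  then show ?thesis
    unfolding GH by (simp add: if_distrib[of "\<lambda>t. t * _"] cong: if_cong)
qed

lemma h3_sym: "h3 k i j = h3 k j i"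
  unfolding h3 using sym(2,3) by (simp add: sum_2 algebra_simps)

lemma \<Psi>_G_h3: "(\<Sum>b\<in>UNIV. (\<Sum>c\<in>UNIV. G b c * h3 m j c) * \<Psi> i b) = - (\<Sum>k\<in>UNIV. T i k m * H k j)"
  unfolding h3_sym[of m j] G_h3 by (simp add: T_def sum_2 algebra_simps)

text \<open>The component of the covariant derivative along a momentum direction, on one momentum
  and one angle. The two Christoffel sums differ by the skew part of \<open>T\<close>, which trades
  half of the term with \<sigma> i for the term with H \<sigma>.\<close>

lemma mixed:
  "\<sigma> i * (if j = m then 1 else 0) - (\<Sum>l\<in>UNIV. 1/2 * (\<Sum>k\<in>UNIV. H l k * g3 m i k) * \<Psi> l j)
    - (\<Sum>b\<in>UNIV. 1/2 * (\<Sum>c\<in>UNIV. G b c * h3 m j c) * \<Psi> i b) =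
   1/2 * (\<sigma> i * (if j = m then 1 else 0) + G m i * (\<Sum>k\<in>UNIV. H j k * \<sigma> k))"
proof -
  have 1: "(\<Sum>l\<in>UNIV. (\<Sum>k\<in>UNIV. H l k * g3 m i k) * \<Psi> l j) = (\<Sum>k\<in>UNIV. T k i m * H k j)"
  proof -
    have "(\<Sum>l\<in>UNIV. (\<Sum>k\<in>UNIV. H l k * g3 m i k) * \<Psi> l j) = (\<Sum>k\<in>UNIV. g3 m i k * (\<Sum>l\<in>UNIV. H k l * \<Psi> l j))"
      using sym(2) by (simp add: sum_2 algebra_simps)
    also have "\<dots> = (\<Sum>k\<in>UNIV. T k i m * H k j)"
      unfolding H\<Psi> T_def using sym(3) by (simp add: sum_2 algebra_simps)
    finally show ?thesis .
  qed
  have "(\<Sum>k\<in>UNIV. T k i m * H k j) - (\<Sum>k\<in>UNIV. T i k m * H k j) = - (\<Sum>k\<in>UNIV. (T i k m - T k i m) * H k j)"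
    by (simp add: sum_2 algebra_simps)
  also have "\<dots> = \<sigma> i * (\<Sum>k\<in>UNIV. G m k * H k j) - G m i * (\<Sum>k\<in>UNIV. H j k * \<sigma> k)"
    unfolding T_skew using sym(2) by (simp add: sum_2 algebra_simps)
  finally have 2: "(\<Sum>k\<in>UNIV. T k i m * H k j) - (\<Sum>k\<in>UNIV. T i k m * H k j) =
      \<sigma> i * (if j = m then 1 else 0) - G m i * (\<Sum>k\<in>UNIV. H j k * \<sigma> k)"
    unfolding GH by (simp add: eq_commute)
  show ?thesis
    unfolding mult.assoc[of "1/2"] sum_distrib_left[symmetric] 1 \<Psi>_G_h3 using 2 by (simp add: algebra_simps)
qed

text \<open>The component along an angle, on two momenta. Symmetry of \<open>T\<close> in its last
  indices brings the difference into the form of \<open>T_skew\<close>.\<close>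

lemma base:
  "(\<Sum>b\<in>UNIV. 1/2 * (\<Sum>c\<in>UNIV. G b c * h3 i m c) * \<Psi> j b) - (\<Sum>b\<in>UNIV. 1/2 * (\<Sum>c\<in>UNIV. G b c * h3 j m c) * \<Psi> i b) =
   1/2 * (\<sigma> j * (if i = m then 1 else 0) - \<sigma> i * (if j = m then 1 else 0))"
proof -
  have "(\<Sum>k\<in>UNIV. T i k j * H k m) - (\<Sum>k\<in>UNIV. T j k i * H k m) = (\<Sum>k\<in>UNIV. (T i j k - T j i k) * H k m)"
    unfolding T_sym[of i _ j] T_sym[of j _ i] by (simp add: sum_2 algebra_simps)
  also have "\<dots> = \<sigma> j * (\<Sum>k\<in>UNIV. G i k * H k m) - \<sigma> i * (\<Sum>k\<in>UNIV. G j k * H k m)"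
    unfolding T_skew using sym(1) by (simp add: sum_2 algebra_simps)
  finally show ?thesis
    unfolding mult.assoc[of "1/2"] sum_distrib_left[symmetric] \<Psi>_G_h3 GH by (simp add: algebra_simps)
qed

text \<open>The component along an angle, on two angles. Written as contractions of \<open>T\<close>
  with three factors \<open>H\<close>, the two sums differ by an exchange of the first two indices
  of \<open>T\<close>.\<close>

lemma fibre:
  "(\<Sum>l\<in>UNIV. 1/2 * (\<Sum>k\<in>UNIV. H l k * h3 k m a) * \<Psi> l b) - (\<Sum>l\<in>UNIV. 1/2 * (\<Sum>k\<in>UNIV. H l k * h3 k m b) * \<Psi> l a) =
   - (1/2) * ((\<Sum>k\<in>UNIV. H a k * \<sigma> k) * H m b - (\<Sum>k\<in>UNIV. H b k * \<sigma> k) * H m a)"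
proof -
  have 1: "(\<Sum>l\<in>UNIV. (\<Sum>k\<in>UNIV. H l k * h3 k m a) * \<Psi> l b) =
      - (\<Sum>l\<in>UNIV. \<Sum>p\<in>UNIV. \<Sum>q\<in>UNIV. H l b * H m p * H q a * T l q p)" for a b
  proof -
    have "(\<Sum>l\<in>UNIV. (\<Sum>k\<in>UNIV. H l k * h3 k m a) * \<Psi> l b) = (\<Sum>k\<in>UNIV. h3 k m a * (\<Sum>l\<in>UNIV. H k l * \<Psi> l b))"
      using sym(2) by (simp add: sum_2 algebra_simps)
    also have "\<dots> = - (\<Sum>l\<in>UNIV. \<Sum>p\<in>UNIV. \<Sum>q\<in>UNIV. H l b * H m p * H q a * (\<Sum>k\<in>UNIV. \<Psi> l k * g3 k p q))"
      unfolding H\<Psi> h3 by (simp add: sum_2 algebra_simps)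
    also have "\<dots> = - (\<Sum>l\<in>UNIV. \<Sum>p\<in>UNIV. \<Sum>q\<in>UNIV. H l b * H m p * H q a * T l q p)"
      unfolding T_def using sym(4) by (simp add: sum_2)
    finally show ?thesis .
  qed
  have "(\<Sum>l\<in>UNIV. \<Sum>p\<in>UNIV. \<Sum>q\<in>UNIV. H l a * H m p * H q b * T l q p)
      - (\<Sum>l\<in>UNIV. \<Sum>p\<in>UNIV. \<Sum>q\<in>UNIV. H l b * H m p * H q a * T l q p) =
    - (\<Sum>l\<in>UNIV. \<Sum>p\<in>UNIV. \<Sum>q\<in>UNIV. H l b * H m p * H q a * (T l q p - T q l p))"
    by (simp add: sum_2 algebra_simps)
  also have "\<dots> = - ((\<Sum>q\<in>UNIV. H a q * \<sigma> q) * (\<Sum>p\<in>UNIV. H m p * (\<Sum>l\<in>UNIV. G p l * H l b)) -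
      (\<Sum>l\<in>UNIV. H b l * \<sigma> l) * (\<Sum>p\<in>UNIV. H m p * (\<Sum>q\<in>UNIV. G p q * H q a)))"
    unfolding T_skew using sym(2) by (simp add: sum_2 algebra_simps)
  finally show ?thesis
    unfolding mult.assoc[of "1/2"] sum_distrib_left[symmetric] 1 GH
    by (simp add: if_distrib[of "(*) _"] algebra_simps cong: if_cong)
qed

end


section \<open>The covariant derivative of the 2-form of an affine endomorphism\<close>

locale toric_hamiltonian =
  fixes \<Delta> :: "(real^2) set" and \<phi> :: "real^2 \<Rightarrow> real" and \<Psi> :: "real^2 \<Rightarrow> real^2^2" and \<sigma> :: "real^2"
  assumes inv: "\<And>\<mu>. \<mu> \<in> interior \<Delta> \<Longrightarrow> hess \<phi> \<mu> ** inv_hess \<phi> \<mu> = mat 1"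
      "\<And>\<mu>. \<mu> \<in> interior \<Delta> \<Longrightarrow> inv_hess \<phi> \<mu> ** hess \<phi> \<mu> = mat 1"
    and hess_sym: "\<And>\<mu> i j. \<mu> \<in> interior \<Delta> \<Longrightarrow> hess \<phi> \<mu> $ i $ j = hess \<phi> \<mu> $ j $ i"
    and diff: "\<And>\<mu> i j. \<mu> \<in> interior \<Delta> \<Longrightarrow> (\<lambda>\<mu>. hess \<phi> \<mu> $ i $ j) differentiable at \<mu>"
      "\<And>\<mu> i j. \<mu> \<in> interior \<Delta> \<Longrightarrow> (\<lambda>\<mu>. inv_hess \<phi> \<mu> $ i $ j) differentiable at \<mu>"
    and third_sym: "\<And>\<mu> i j k. \<mu> \<in> interior \<Delta> \<Longrightarrow>
      pdiff k (\<lambda>\<mu>. hess \<phi> \<mu> $ i $ j) \<mu> = pdiff i (\<lambda>\<mu>. hess \<phi> \<mu> $ k $ j) \<mu>"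
    and d\<Psi>: "\<And>\<mu> i j. ((\<lambda>\<mu>. \<Psi> \<mu> $ i $ j) has_derivative (\<lambda>v. \<sigma> $ i * v $ j)) (at \<mu>)"
    and \<Psi>G: "\<And>\<mu> i k. \<mu> \<in> interior \<Delta> \<Longrightarrow>
      (\<Sum>l\<in>UNIV. \<Psi> \<mu> $ i $ l * hess \<phi> \<mu> $ l $ k) = (\<Sum>l\<in>UNIV. \<Psi> \<mu> $ k $ l * hess \<phi> \<mu> $ l $ i)"
begin

text \<open>The 2-form given by the sum of \<Psi> i j d\<mu> i \<and> dt j; the identity matrix in
  place of \<Psi> would give \<open>toric_form\<close>.\<close>

definition \<psi> :: "real^(2 + 2) \<Rightarrow> real^(2 + 2)^(2 + 2)" where
  "\<psi> z = (\<chi> p q. case (p, q) of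
       (Inl i, Inr j) \<Rightarrow> \<Psi> (mu z) $ i $ j
     | (Inr i, Inl j) \<Rightarrow> - \<Psi> (mu z) $ j $ i
     | _ \<Rightarrow> 0)"

definition toric_metric_inv :: "real^(2 + 2) \<Rightarrow> real^(2 + 2)^(2 + 2)" where
  "toric_metric_inv z = (\<chi> p q. case (p, q) of
       (Inl i, Inl j) \<Rightarrow> inv_hess \<phi> (mu z) $ i $ j
     | (Inr i, Inr j) \<Rightarrow> hess \<phi> (mu z) $ i $ j
     | _ \<Rightarrow> 0)"

lemma block_simps:
  "toric_metric \<phi> z $ Inl i $ Inl j = hess \<phi> (mu z) $ i $ j"
  "toric_metric \<phi> z $ Inr i $ Inr j = inv_hess \<phi> (mu z) $ i $ j"
  "toric_metric \<phi> z $ Inl i $ Inr j = 0" "toric_metric \<phi> z $ Inr i $ Inl j = 0"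
  "toric_metric_inv z $ Inl i $ Inl j = inv_hess \<phi> (mu z) $ i $ j"
  "toric_metric_inv z $ Inr i $ Inr j = hess \<phi> (mu z) $ i $ j"
  "toric_metric_inv z $ Inl i $ Inr j = 0" "toric_metric_inv z $ Inr i $ Inl j = 0"
  "toric_form z $ Inl i $ Inl j = 0" "toric_form z $ Inr i $ Inr j = 0"
  "toric_form z $ Inl i $ Inr j = (if i = j then 1 else 0)"
  "toric_form z $ Inr i $ Inl j = (if i = j then - 1 else 0)"
  "\<psi> z $ Inl i $ Inl j = 0" "\<psi> z $ Inr i $ Inr j = 0"
  "\<psi> z $ Inl i $ Inr j = \<Psi> (mu z) $ i $ j" "\<psi> z $ Inr i $ Inl j = - \<Psi> (mu z) $ j $ i"
  by (simp_all add: toric_metric_def toric_metric_inv_def toric_form_def \<psi>_def)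

lemma open_toric_domain: "open (toric_domain \<Delta>)"
proof -
  have "toric_domain \<Delta> = mu -` interior \<Delta>"
    by (auto simp: toric_domain_def)
  then show ?thesis
    using mu_linear by (simp add: continuous_open_vimage linear_continuous_at)
qed

context
  fixes z assumes z: "z \<in> toric_domain \<Delta>"
begin

lemma mu_z: "mu z \<in> interior \<Delta>"
  using z by (simp add: toric_domain_def)

lemma GH_sum: "(\<Sum>k\<in>UNIV. hess \<phi> (mu z) $ i $ k * inv_hess \<phi> (mu z) $ k $ j) = (if i = j then 1 else 0)"
    "(\<Sum>k\<in>UNIV. inv_hess \<phi> (mu z) $ i $ k * hess \<phi> (mu z) $ k $ j) = (if i = j then 1 else 0)"
  using inv[OF mu_z] by (simp_all add: vec_eq_iff matrix_matrix_mult_def mat_def)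

lemma inv_hess_sym: "inv_hess \<phi> (mu z) $ i $ j = inv_hess \<phi> (mu z) $ j $ i"
proof -
  have t: "transpose (hess \<phi> (mu z)) = hess \<phi> (mu z)"
    using hess_sym[OF mu_z] by (simp add: transpose_def vec_eq_iff)
  have "transpose (inv_hess \<phi> (mu z)) ** hess \<phi> (mu z) = mat 1"
    using arg_cong[OF inv(1)[OF mu_z], of transpose] by (simp add: matrix_transpose_mul t transpose_mat)
  then have "transpose (inv_hess \<phi> (mu z)) ** (hess \<phi> (mu z) ** inv_hess \<phi> (mu z)) = inv_hess \<phi> (mu z)"
    by (simp add: matrix_mul_assoc)
  then have "transpose (inv_hess \<phi> (mu z)) = inv_hess \<phi> (mu z)"
    by (simp add: inv(1)[OF mu_z])
  then show ?thesis by (simp add: transpose_def vec_eq_iff)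
qed

lemma metric_inv: "matrix_inv (toric_metric \<phi> z) = toric_metric_inv z"
  by (rule matrix_inv_eqI)
    (simp_all add: vec_eq_iff matrix_matrix_mult_def mat_def split_sum_all sum_UNIV_Plus block_simps GH_sum)

abbreviation "J \<equiv> complex_structure (toric_metric \<phi>) toric_form"

lemma J_simps:
  "J z $ Inl i $ Inl j = 0" "J z $ Inr i $ Inr j = 0"
  "J z $ Inl i $ Inr j = - inv_hess \<phi> (mu z) $ i $ j" "J z $ Inr i $ Inl j = hess \<phi> (mu z) $ i $ j"
  unfolding complex_structure_def metric_inv
  by (simp_all add: matrix_matrix_mult_def transpose_def sum_UNIV_Plus block_simps if_distrib[of "(*) _"] cong: if_cong)

abbreviation "g3 k i j \<equiv> pdiff k (\<lambda>\<mu>. hess \<phi> \<mu> $ i $ j) (mu z)"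
abbreviation "h3 k i j \<equiv> pdiff k (\<lambda>\<mu>. inv_hess \<phi> \<mu> $ i $ j) (mu z)"

lemma pdiff_metric:
  "pdiff (Inl k) (\<lambda>y. toric_metric \<phi> y $ Inl i $ Inl j) z = g3 k i j"
  "pdiff (Inr k) (\<lambda>y. toric_metric \<phi> y $ Inl i $ Inl j) z = 0"
  "pdiff (Inl k) (\<lambda>y. toric_metric \<phi> y $ Inr i $ Inr j) z = h3 k i j"
  "pdiff (Inr k) (\<lambda>y. toric_metric \<phi> y $ Inr i $ Inr j) z = 0"
  "pdiff p (\<lambda>y. toric_metric \<phi> y $ Inl i $ Inr j) z = 0"
  "pdiff p (\<lambda>y. toric_metric \<phi> y $ Inr i $ Inl j) z = 0"
  unfolding block_simps
  using pdiff_mu[OF diff(1)[OF mu_z]] pdiff_mu[OF diff(2)[OF mu_z]] by (simp_all add: pdiff_const)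

lemma g3_sym: "g3 k i j = g3 k j i" "g3 k i j = g3 i k j"
proof -
  show "g3 k i j = g3 k j i"
    by (rule pdiff_cong[OF open_interior mu_z]) (simp_all add: hess_sym diff mu_z)
  show "g3 k i j = g3 i k j"
    by (rule third_sym[OF mu_z])
qed

text \<open>Differentiation of the constant product of the Hessian with its inverse, followed by
  multiplication with the inverse.\<close>

lemma h3_eq: "h3 k i j = - (\<Sum>p\<in>UNIV. \<Sum>q\<in>UNIV. inv_hess \<phi> (mu z) $ i $ p * g3 k p q * inv_hess \<phi> (mu z) $ q $ j)"
proof -
  let ?G = "\<lambda>i j. hess \<phi> (mu z) $ i $ j" and ?H = "\<lambda>i j. inv_hess \<phi> (mu z) $ i $ j"
  have "(\<Sum>l\<in>UNIV. ?G p l * h3 k l j) = - (\<Sum>q\<in>UNIV. g3 k p q * ?H q j)" for p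
  proof -
    have "((\<lambda>\<mu>. \<Sum>l\<in>UNIV. hess \<phi> \<mu> $ p $ l * inv_hess \<phi> \<mu> $ l $ j) has_derivative
      (\<lambda>v. \<Sum>l\<in>UNIV. ?G p l * frechet_derivative (\<lambda>\<mu>. inv_hess \<phi> \<mu> $ l $ j) (at (mu z)) v +
        frechet_derivative (\<lambda>\<mu>. hess \<phi> \<mu> $ p $ l) (at (mu z)) v * ?H l j)) (at (mu z))"
      by (intro has_derivative_sum has_derivative_mult frechet_derivative_worksI diff mu_z)
    moreover have "((\<lambda>\<mu>. \<Sum>l\<in>UNIV. hess \<phi> \<mu> $ p $ l * inv_hess \<phi> \<mu> $ l $ j) has_derivative (\<lambda>v. 0)) (at (mu z))"
    proof (rule has_derivative_transform_within_open[OF has_derivative_const open_interior mu_z])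
      show "(if p = j then 1 else 0) = (\<Sum>l\<in>UNIV. hess \<phi> \<mu> $ p $ l * inv_hess \<phi> \<mu> $ l $ j)" if "\<mu> \<in> interior \<Delta>" for \<mu>
        using inv(1)[OF that] by (simp add: vec_eq_iff matrix_matrix_mult_def mat_def)
    qed
    ultimately have "(\<Sum>l\<in>UNIV. ?G p l * h3 k l j + g3 k p l * ?H l j) = 0"
      unfolding pdiff_def by (rule fun_cong[OF has_derivative_unique])
    then show ?thesis by (simp add: sum.distrib)
  qed
  then have "(\<Sum>p\<in>UNIV. ?H i p * (\<Sum>l\<in>UNIV. ?G p l * h3 k l j)) =
      - (\<Sum>p\<in>UNIV. \<Sum>q\<in>UNIV. ?H i p * g3 k p q * ?H q j)"
    by (simp add: sum_distrib_left sum_negf mult.assoc)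
  moreover have "(\<Sum>p\<in>UNIV. ?H i p * (\<Sum>l\<in>UNIV. ?G p l * h3 k l j)) =
      (\<Sum>l\<in>UNIV. (\<Sum>p\<in>UNIV. ?H i p * ?G p l) * h3 k l j)"
    by (simp add: sum_2 algebra_simps)
  ultimately show ?thesis
    unfolding GH_sum by (simp add: if_distrib[of "\<lambda>t. t * _"] cong: if_cong)
qed

lemma pdiff_\<Psi>: "pdiff m (\<lambda>\<mu>. \<Psi> \<mu> $ i $ j) \<mu> = (if j = m then \<sigma> $ i else 0)"
  by (subst pdiff_eqI[OF d\<Psi>]) (simp add: axis_def)

lemma \<Psi>_differentiable: "(\<lambda>\<mu>. \<Psi> \<mu> $ i $ j) differentiable at \<mu>"
  using d\<Psi> differentiable_def by blast

lemma algebra: "hamiltonian_algebra (\<lambda>i j. hess \<phi> (mu z) $ i $ j) (\<lambda>i j. inv_hess \<phi> (mu z) $ i $ j)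
  (\<lambda>i j. \<Psi> (mu z) $ i $ j) g3 h3 (\<lambda>i. \<sigma> $ i)"
proof
  let ?G = "\<lambda>i j. hess \<phi> (mu z) $ i $ j"
  fix i k m :: 2
  have "((\<lambda>\<mu>. \<Sum>l\<in>UNIV. \<Psi> \<mu> $ i $ l * hess \<phi> \<mu> $ l $ k) has_derivative
      (\<lambda>v. \<Sum>l\<in>UNIV. \<Psi> (mu z) $ i $ l * frechet_derivative (\<lambda>\<mu>. hess \<phi> \<mu> $ l $ k) (at (mu z)) v +
        \<sigma> $ i * v $ l * ?G l k)) (at (mu z))" for i k
    by (intro has_derivative_sum has_derivative_mult frechet_derivative_worksI diff mu_z d\<Psi>)
  note D = this[THEN pdiff_eqI, of m, folded pdiff_def]
  have D': "pdiff m (\<lambda>\<mu>. \<Sum>l\<in>UNIV. \<Psi> \<mu> $ i $ l * hess \<phi> \<mu> $ l $ k) (mu z) =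
      (\<Sum>l\<in>UNIV. \<Psi> (mu z) $ i $ l * g3 m l k) + \<sigma> $ i * ?G m k" for i k
  proof -
    have "(\<Sum>l\<in>UNIV. \<sigma> $ i * axis m 1 $ l * ?G l k) = (\<Sum>l\<in>UNIV. if l = m then \<sigma> $ i * ?G l k else 0)"
      by (intro sum.cong) (auto simp: axis_def)
    then show ?thesis unfolding D sum.distrib by simp
  qed
  have "pdiff m (\<lambda>\<mu>. \<Sum>l\<in>UNIV. \<Psi> \<mu> $ i $ l * hess \<phi> \<mu> $ l $ k) (mu z) =
      pdiff m (\<lambda>\<mu>. \<Sum>l\<in>UNIV. \<Psi> \<mu> $ k $ l * hess \<phi> \<mu> $ l $ i) (mu z)"
    by (rule pdiff_cong[OF open_interior mu_z])
      (use \<Psi>G in \<open>auto intro!: differentiable_sum differentiable_mult \<Psi>_differentiable diff mu_z\<close>)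
  then show "(\<Sum>l\<in>UNIV. \<Psi> (mu z) $ i $ l * g3 m l k) - (\<Sum>l\<in>UNIV. \<Psi> (mu z) $ k $ l * g3 m l i) =
      \<sigma> $ k * ?G m i - \<sigma> $ i * ?G m k"
    unfolding D' by simp
qed (fact GH_sum(1) hess_sym[OF mu_z] inv_hess_sym g3_sym h3_eq \<Psi>G[OF mu_z])+

lemma christoffel_simps:
  "christoffel (toric_metric \<phi>) z (Inl l) (Inl m) (Inl i) = 1/2 * (\<Sum>k\<in>UNIV. inv_hess \<phi> (mu z) $ l $ k * g3 m i k)"
  "christoffel (toric_metric \<phi>) z (Inl l) (Inl m) (Inr a) = 0"
  "christoffel (toric_metric \<phi>) z (Inl l) (Inr a) (Inl m) = 0"
  "christoffel (toric_metric \<phi>) z (Inl l) (Inr a) (Inr b) = - (1/2 * (\<Sum>k\<in>UNIV. inv_hess \<phi> (mu z) $ l $ k * h3 k a b))"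
  "christoffel (toric_metric \<phi>) z (Inr b) (Inl m) (Inl i) = 0"
  "christoffel (toric_metric \<phi>) z (Inr b) (Inl m) (Inr a) = 1/2 * (\<Sum>c\<in>UNIV. hess \<phi> (mu z) $ b $ c * h3 m a c)"
  "christoffel (toric_metric \<phi>) z (Inr b) (Inr a) (Inl m) = 1/2 * (\<Sum>c\<in>UNIV. hess \<phi> (mu z) $ b $ c * h3 m a c)"
  "christoffel (toric_metric \<phi>) z (Inr b) (Inr a) (Inr c) = 0"
proof -
  \<comment> \<open>Third derivatives of \<phi> are totally symmetric, so the three terms of the
    Christoffel symbol are equal up to sign and two of them cancel.\<close>
  have *: "g3 m i k + g3 i m k - g3 k m i = g3 m i k" for m i k
    using g3_sym(2)[of i m k] g3_sym(2)[of k m i] g3_sym(1)[of m k i] by simp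
  show "christoffel (toric_metric \<phi>) z (Inl l) (Inl m) (Inl i) = 1/2 * (\<Sum>k\<in>UNIV. inv_hess \<phi> (mu z) $ l $ k * g3 m i k)"
    unfolding christoffel_def metric_inv by (simp add: sum_UNIV_Plus block_simps(5-8) pdiff_metric *)
qed (simp_all add: christoffel_def metric_inv sum_UNIV_Plus block_simps(5-8) pdiff_metric sum_negf)

lemma pdiff_\<psi>:
  "pdiff p (\<lambda>y. \<psi> y $ Inl i $ Inl j) z = 0" "pdiff p (\<lambda>y. \<psi> y $ Inr i $ Inr j) z = 0"
  "pdiff (Inl m) (\<lambda>y. \<psi> y $ Inl i $ Inr j) z = \<sigma> $ i * (if j = m then 1 else 0)"
  "pdiff (Inr m) (\<lambda>y. \<psi> y $ Inl i $ Inr j) z = 0"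
  "pdiff (Inl m) (\<lambda>y. \<psi> y $ Inr j $ Inl i) z = - (\<sigma> $ i * (if j = m then 1 else 0))"
  "pdiff (Inr m) (\<lambda>y. \<psi> y $ Inr j $ Inl i) z = 0"
  unfolding block_simps pdiff_const pdiff_mu[OF \<Psi>_differentiable] pdiff_\<Psi>
    pdiff_mu[OF differentiable_minus[OF \<Psi>_differentiable]] pdiff_eqI[OF has_derivative_minus[OF d\<Psi>]]
  by (simp_all add: axis_def)

definition cov :: "2 + 2 \<Rightarrow> 2 + 2 \<Rightarrow> 2 + 2 \<Rightarrow> real" where
  "cov m i j = pdiff m (\<lambda>y. \<psi> y $ i $ j) z
      - (\<Sum>l\<in>UNIV. christoffel (toric_metric \<phi>) z l m i * \<psi> z $ l $ j)
      - (\<Sum>l\<in>UNIV. christoffel (toric_metric \<phi>) z l m j * \<psi> z $ i $ l)"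

lemmas cov_unfold = sum_UNIV_Plus christoffel_simps block_simps

lemma cov_zero:
  "cov (Inl m) (Inl i) (Inl j) = 0" "cov (Inl m) (Inr i) (Inr j) = 0"
  "cov (Inr m) (Inl i) (Inr j) = 0" "cov (Inr m) (Inr j) (Inl i) = 0"
  unfolding cov_def pdiff_\<psi> unfolding cov_unfold by simp_all

lemma cov_mixed:
  "cov (Inl m) (Inl i) (Inr j) = 1/2 * (\<sigma> $ i * (if j = m then 1 else 0) +
    hess \<phi> (mu z) $ m $ i * (\<Sum>k\<in>UNIV. inv_hess \<phi> (mu z) $ j $ k * \<sigma> $ k))"
  "cov (Inl m) (Inr j) (Inl i) = - (1/2 * (\<sigma> $ i * (if j = m then 1 else 0) +
    hess \<phi> (mu z) $ m $ i * (\<Sum>k\<in>UNIV. inv_hess \<phi> (mu z) $ j $ k * \<sigma> $ k)))"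
  unfolding hamiltonian_algebra.mixed[OF algebra, symmetric] unfolding cov_def pdiff_\<psi>
  unfolding cov_unfold by (simp_all add: sum_negf)

lemma cov_base:
  "cov (Inr m) (Inl i) (Inl j) = 1/2 * (\<sigma> $ j * (if i = m then 1 else 0) - \<sigma> $ i * (if j = m then 1 else 0))"
  unfolding hamiltonian_algebra.base[OF algebra, symmetric] unfolding cov_def pdiff_\<psi>
  unfolding cov_unfold by (simp add: sum_negf)

lemma cov_fibre:
  "cov (Inr m) (Inr a) (Inr b) = - (1/2) *
    ((\<Sum>k\<in>UNIV. inv_hess \<phi> (mu z) $ a $ k * \<sigma> $ k) * inv_hess \<phi> (mu z) $ m $ b -
     (\<Sum>k\<in>UNIV. inv_hess \<phi> (mu z) $ b $ k * \<sigma> $ k) * inv_hess \<phi> (mu z) $ m $ a)"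
  unfolding hamiltonian_algebra.fibre[OF algebra, symmetric] unfolding cov_def pdiff_\<psi>
  unfolding cov_unfold by (simp add: sum_negf)

lemmas cov_simps = cov_zero cov_mixed cov_base cov_fibre

text \<open>The two off-diagonal blocks contribute the trace of \<Psi> each, which the factor 1/2 in
  \<open>form_inner\<close> averages. As \<Psi> is affine with derivative \<sigma> \<otimes> v, the
  differential of this trace is \<sigma>.\<close>

lemma trace_\<psi>: "form_inner (toric_metric \<phi> z) (\<psi> z) (toric_form z) = (\<Sum>i\<in>UNIV. \<Psi> (mu z) $ i $ i)"
proof -
  let ?G = "\<lambda>i j. hess \<phi> (mu z) $ i $ j" and ?H = "\<lambda>i j. inv_hess \<phi> (mu z) $ i $ j"
  have "form_inner (toric_metric \<phi> z) (\<psi> z) (toric_form z) =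
     1/2 * ((\<Sum>i\<in>UNIV. \<Sum>j\<in>UNIV. \<Sum>k\<in>UNIV. ?H i k * ?G j k * \<Psi> (mu z) $ i $ j) +
      (\<Sum>i\<in>UNIV. \<Sum>j\<in>UNIV. \<Sum>k\<in>UNIV. ?G i k * ?H j k * \<Psi> (mu z) $ j $ i))"
    unfolding form_inner_def metric_inv
    by (simp add: sum_UNIV_Plus block_simps if_distrib[of "(*) _"] cong: if_cong)
  also have "\<dots> = 1/2 * ((\<Sum>i\<in>UNIV. \<Sum>j\<in>UNIV. (\<Sum>k\<in>UNIV. ?H i k * ?G k j) * \<Psi> (mu z) $ i $ j) +
      (\<Sum>i\<in>UNIV. \<Sum>j\<in>UNIV. (\<Sum>k\<in>UNIV. ?G i k * ?H k j) * \<Psi> (mu z) $ j $ i))"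
    using hess_sym[OF mu_z] inv_hess_sym by (simp add: sum_2 algebra_simps)
  also have "\<dots> = (\<Sum>i\<in>UNIV. \<Psi> (mu z) $ i $ i)"
    unfolding GH_sum by (simp add: if_distrib[of "\<lambda>t. t * _"] cong: if_cong)
  finally show ?thesis .
qed

end

lemma ext_d_trace:
  assumes "z \<in> toric_domain \<Delta>"
  defines "\<tau> \<equiv> \<lambda>z. form_inner (toric_metric \<phi> z) (\<psi> z) (toric_form z)"
  shows "ext_d \<tau> z $ Inl i = \<sigma> $ i" "ext_d \<tau> z $ Inr i = 0"
proof -
  have d: "((\<lambda>\<mu>. \<Sum>i\<in>UNIV. \<Psi> \<mu> $ i $ i) has_derivative (\<lambda>v. \<Sum>i\<in>UNIV. \<sigma> $ i * v $ i)) (at (mu z))"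
    by (intro has_derivative_sum d\<Psi>)
  then have diff: "(\<lambda>\<mu>. \<Sum>i\<in>UNIV. \<Psi> \<mu> $ i $ i) differentiable at (mu z)"
    using differentiable_def by blast
  have "pdiff p \<tau> z = pdiff p (\<lambda>z. \<Sum>i\<in>UNIV. \<Psi> (mu z) $ i $ i) z" for p
  proof (rule pdiff_cong[OF open_toric_domain assms(1)])
    show "(\<lambda>z. \<Sum>i\<in>UNIV. \<Psi> (mu z) $ i $ i) differentiable at z"
      using has_derivative_compose[OF bounded_linear_imp_has_derivative[OF mu_linear] d] differentiable_def by blast
  qed (simp add: \<tau>_def trace_\<psi>)
  then show "ext_d \<tau> z $ Inl i = \<sigma> $ i" "ext_d \<tau> z $ Inr i = 0"
    unfolding ext_d_def vec_lambda_beta using pdiff_mu[OF diff] pdiff_eqI[OF d, of i]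
    by (simp_all add: axis_def if_distrib[of "(*) _"] cong: if_cong)
qed

theorem hamiltonian:
  assumes nontrivial: "\<And>\<kappa>. \<exists>\<mu>\<in>interior \<Delta>. \<Psi> \<mu> \<noteq> \<kappa> *\<^sub>R mat 1"
  shows "hamiltonian_2form (toric_domain \<Delta>) (toric_metric \<phi>)
    (complex_structure (toric_metric \<phi>) toric_form) toric_form \<psi>"
proof -
  define \<tau> where "\<tau> = (\<lambda>z. form_inner (toric_metric \<phi> z) (\<psi> z) (toric_form z))"
  let ?M = "toric_domain \<Delta>"
  have cov: "cov_deriv (toric_metric \<phi>) \<psi> z Z =
      (1/2) *\<^sub>R (wedge (ext_d \<tau> z) (flat (toric_metric \<phi>) z (J z *v Z)) - wedge (ext_dc J \<tau> z) (flat (toric_metric \<phi>) z Z))"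
    if z: "z \<in> ?M" for z Z
  proof -
    let ?G = "\<lambda>i j. hess \<phi> (mu z) $ i $ j" and ?H = "\<lambda>i j. inv_hess \<phi> (mu z) $ i $ j"
    note block = block_simps J_simps[OF z]
    \<comment> \<open>The 1-form dual to J Z is a contraction of Z with the symplectic form, so the
      metric cancels and only components of Z remain.\<close>
    have JZ: "flat (toric_metric \<phi>) z (J z *v Z) $ Inl j = - Z $ Inr j"
        "flat (toric_metric \<phi>) z (J z *v Z) $ Inr j = Z $ Inl j" for j
    proof -
      have "flat (toric_metric \<phi>) z (J z *v Z) $ Inl j = - (\<Sum>l\<in>UNIV. (\<Sum>k\<in>UNIV. ?G j k * ?H k l) * Z $ Inr l)"
        by (simp add: flat_def matrix_vector_mult_def sum_UNIV_Plus block sum_2 algebra_simps)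
      then show "flat (toric_metric \<phi>) z (J z *v Z) $ Inl j = - Z $ Inr j"
        unfolding GH_sum[OF z] by (simp add: if_distrib[of "\<lambda>t. t * _"] cong: if_cong)
      have "flat (toric_metric \<phi>) z (J z *v Z) $ Inr j = (\<Sum>l\<in>UNIV. (\<Sum>k\<in>UNIV. ?H j k * ?G k l) * Z $ Inl l)"
        by (simp add: flat_def matrix_vector_mult_def sum_UNIV_Plus block sum_2 algebra_simps)
      then show "flat (toric_metric \<phi>) z (J z *v Z) $ Inr j = Z $ Inl j"
        unfolding GH_sum[OF z] by (simp add: if_distrib[of "\<lambda>t. t * _"] cong: if_cong)
    qed
    have gZ: "flat (toric_metric \<phi>) z Z $ Inl j = (\<Sum>l\<in>UNIV. ?G l j * Z $ Inl l)"
        "flat (toric_metric \<phi>) z Z $ Inr j = (\<Sum>l\<in>UNIV. ?H l j * Z $ Inr l)" for j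
      using hess_sym[OF mu_z[OF z]] inv_hess_sym[OF z]
      by (simp_all add: flat_def matrix_vector_mult_def sum_UNIV_Plus block sum_2)
    note d\<tau> = ext_d_trace[OF z, folded \<tau>_def]
    have dc: "ext_dc J \<tau> z $ Inl j = 0" "ext_dc J \<tau> z $ Inr j = (\<Sum>k\<in>UNIV. ?H j k * \<sigma> $ k)" for j
      using inv_hess_sym[OF z]
      by (simp_all add: ext_dc_def matrix_vector_mult_def transpose_def sum_UNIV_Plus block d\<tau> sum_2)
    have eq: "cov_deriv (toric_metric \<phi>) \<psi> z Z $ p $ q =
        (\<Sum>m\<in>UNIV. Z $ Inl m * cov z (Inl m) p q) + (\<Sum>m\<in>UNIV. Z $ Inr m * cov z (Inr m) p q)" for p q
      by (simp add: cov_deriv_def cov_def[OF z] sum_UNIV_Plus[of "\<lambda>m. Z $ m * _ m"])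
    have "\<forall>p q. cov_deriv (toric_metric \<phi>) \<psi> z Z $ p $ q =
       1/2 * (ext_d \<tau> z $ p * flat (toric_metric \<phi>) z (J z *v Z) $ q - ext_d \<tau> z $ q * flat (toric_metric \<phi>) z (J z *v Z) $ p
         - (ext_dc J \<tau> z $ p * flat (toric_metric \<phi>) z Z $ q - ext_dc J \<tau> z $ q * flat (toric_metric \<phi>) z Z $ p))"
      unfolding eq split_sum_all cov_simps[OF z] JZ gZ d\<tau> dc by (simp add: forall_2 sum_2 algebra_simps)
    then show ?thesis
      by (simp add: vec_eq_iff wedge_def)
  qed
  have inv: "transpose (\<psi> z) = - \<psi> z" "transpose (J z) ** \<psi> z ** J z = \<psi> z" if z: "z \<in> ?M" for z
  proof -
    let ?G = "\<lambda>i j. hess \<phi> (mu z) $ i $ j" and ?H = "\<lambda>i j. inv_hess \<phi> (mu z) $ i $ j"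
    show "transpose (\<psi> z) = - \<psi> z"
      by (simp add: vec_eq_iff transpose_def split_sum_all block_simps)
    have *: "(\<Sum>a\<in>UNIV. \<Sum>b\<in>UNIV. ?G a i * \<Psi> (mu z) $ b $ a * ?H b j) = \<Psi> (mu z) $ i $ j" for i j
    proof -
      have "(\<Sum>a\<in>UNIV. \<Sum>b\<in>UNIV. ?G a i * \<Psi> (mu z) $ b $ a * ?H b j) =
          (\<Sum>b\<in>UNIV. (\<Sum>a\<in>UNIV. \<Psi> (mu z) $ b $ a * ?G a i) * ?H b j)"
        by (simp add: sum_2 algebra_simps)
      also have "\<dots> = (\<Sum>a\<in>UNIV. \<Psi> (mu z) $ i $ a * (\<Sum>b\<in>UNIV. ?G a b * ?H b j))"
        unfolding \<Psi>G[OF mu_z[OF z], of _ i] by (simp add: sum_2 algebra_simps)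
      finally show ?thesis
        unfolding GH_sum[OF z] by (simp add: if_distrib[of "(*) _"] cong: if_cong)
    qed
    have "(transpose (J z) ** \<psi> z ** J z) $ p $ q = \<psi> z $ p $ q" for p q
      using *[of _ "_"] inv_hess_sym[OF z] hess_sym[OF mu_z[OF z]]
      by (cases p; cases q)
        (simp_all add: matrix_matrix_mult_def transpose_def sum_UNIV_Plus block_simps J_simps[OF z] sum_2 algebra_simps)
    then show "transpose (J z) ** \<psi> z ** J z = \<psi> z"
      by (simp add: vec_eq_iff)
  qed
  have "smooth_on ?M \<psi>"
    unfolding smooth_on_def
  proof (intro conjI allI open_toric_domain)
    fix k
    have comp: "Ck_on k UNIV (\<lambda>z. \<Psi> (mu z) $ i $ j)" for i j
    proof -
      have "Ck_on k UNIV (\<lambda>\<mu>. \<Psi> \<mu> $ i $ j)"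
        by (rule Ck_on_lower, rule Ck_on_SucI[OF open_UNIV d\<Psi>]) (rule Ck_on_const)
      from Ck_on_linear_compose[OF mu_linear open_UNIV this] show ?thesis by simp
    qed
    have "Ck_on k UNIV (\<lambda>z. \<psi> z $ p $ q)" for p q
      by (cases p; cases q) (simp_all add: block_simps comp Ck_on_const Ck_on_minus)
    then have "Ck_on k UNIV \<psi>"
      by (intro Ck_on_vec_nth) auto
    then show "Ck_on k ?M \<psi>"
      by (rule Ck_on_subset) simp
  qed
  moreover have "\<not> (\<exists>\<kappa>. \<forall>z\<in>?M. \<psi> z = \<kappa> *\<^sub>R toric_form z)"
  proof
    assume "\<exists>\<kappa>. \<forall>z\<in>?M. \<psi> z = \<kappa> *\<^sub>R toric_form z"
    then obtain \<kappa> where \<kappa>: "\<And>z. z \<in> ?M \<Longrightarrow> \<psi> z = \<kappa> *\<^sub>R toric_form z" by blast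
    obtain \<mu> where \<mu>: "\<mu> \<in> interior \<Delta>" "\<Psi> \<mu> \<noteq> \<kappa> *\<^sub>R mat 1"
      using nontrivial by blast
    define z :: "real^(2 + 2)" where "z = (\<chi> p. case p of Inl i \<Rightarrow> \<mu> $ i | Inr i \<Rightarrow> 0)"
    have m: "mu z = \<mu>"
      by (simp add: z_def mu_def vec_eq_iff)
    then have "z \<in> ?M"
      using \<mu> by (simp add: toric_domain_def)
    then have "\<psi> z $ Inl i $ Inr j = \<kappa> * toric_form z $ Inl i $ Inr j" for i j
      using \<kappa> by simp
    then have "\<Psi> \<mu> = \<kappa> *\<^sub>R mat 1"
      by (simp add: block_simps m vec_eq_iff mat_def)
    with \<mu> show False by blast
  qed
  ultimately show ?thesis
    unfolding hamiltonian_2form_def Let_def using cov inv by (auto simp: \<tau>_def)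
qed

end

section \<open>The Hamiltonian 2-form of the profile metric\<close>

lemma differentiable_cong_open:
  assumes "f differentiable at x" "open U" "x \<in> U" "\<And>y. y \<in> U \<Longrightarrow> f y = g y"
  shows "g differentiable at x"
  unfolding differentiable_def
  by (rule exI, rule has_derivative_transform_within_open[OF frechet_derivative_worksI[OF assms(1)] assms(2,3)])
    (rule assms(4))

context toric_profiles
begin

lemma interior_quad: "interior quad = reg"
proof
  have "\<mu> \<in> quad" if "\<mu> \<in> reg" for \<mu>
  proof -
    have "\<mu> = pt (xc \<mu>) (yc \<mu>)"
      using dom_coords(6,7)[OF reg_dom[OF that]] by (intro pt_eqI) (simp_all add: algebra_simps)
    moreover have "pt (xc \<mu>) (yc \<mu>) \<in> quad"
      using that by (intro pt_in_quad) (auto simp: reg_def)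
    ultimately show ?thesis by simp
  qed
  then show "reg \<subseteq> interior quad"
    by (intro interior_maximal open_reg) auto
qed (rule interior_quad_reg)

lemma center_in_reg: "pt (1/2) (1/2) \<in> reg"
  using coords_pt_unit[of "1/2" "1/2"] by (simp add: reg_def)

lemma \<sigma>_frame:
  assumes "\<mu> \<in> dom"
  shows "\<sigma> $ i = inverse (rt \<mu>) * (d * Xv (xc \<mu>) $ i - c * Yv (yc \<mu>) $ i)"
proof -
  have "d * Xv (xc \<mu>) $ i - c * Yv (yc \<mu>) $ i = rt \<mu> * \<sigma> $ i"
    unfolding dom_coords(2)[OF assms] Xv_def Yv_def by (simp add: \<sigma>_def algebra_simps)
  then show ?thesis
    using dom_coords(1)[OF assms] by simp
qed

text \<open>Supplies the symmetry of the third derivatives of the potential. Once \<sigma> is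
  expressed in the frame by \<open>\<sigma>_frame\<close>, exchanging \<open>k\<close> and
  \<open>i\<close> in the explicit derivative is a polynomial identity.\<close>

lemma G_has_derivative:
  assumes "\<mu> \<in> reg"
  shows "(\<lambda>\<mu>. G \<mu> $ i $ j) differentiable at \<mu>"
    "pdiff k (\<lambda>\<mu>. G \<mu> $ i $ j) \<mu> = pdiff i (\<lambda>\<mu>. G \<mu> $ k $ j) \<mu>"
proof -
  define E Ea Eb X Y where "E = inverse (rt \<mu>)" and "Ea = inverse (A (xc \<mu>))" and "Eb = inverse (B (yc \<mu>))"
    and "X = Xv (xc \<mu>)" and "Y = Yv (yc \<mu>)"
  note dom = reg_dom[OF assms] and pos = profile_pos[OF assms]
  note C = coords_has_derivative[OF dom] and E' = frame_component_derivatives(3)[OF dom]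
  have X': "((\<lambda>\<mu>. Xv (xc \<mu>) $ i) has_derivative (\<lambda>v. X \<bullet> v / rt \<mu> * \<sigma> $ i)) (at \<mu>)" for i
    unfolding Xv_def vector_add_component vector_scaleR_component X_def
    by (rule derivative_eq_intros C refl)+ (simp add: Xv_def)
  have Y': "((\<lambda>\<mu>. Yv (yc \<mu>) $ i) has_derivative (\<lambda>v. - (Y \<bullet> v / rt \<mu> * \<sigma> $ i))) (at \<mu>)" for i
    unfolding Yv_def vector_minus_component vector_scaleR_component Y_def
    by (rule derivative_eq_intros C refl)+ (simp add: Yv_def)
  have Ea': "((\<lambda>\<mu>. inverse (A (xc \<mu>))) has_derivative (\<lambda>v. - (Ea * (X \<bullet> v / rt \<mu> * A1 (xc \<mu>)) * Ea))) (at \<mu>)"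
    unfolding Ea_def X_def
    by (rule Deriv.has_derivative_inverse[OF _ DERIV_compose_FDERIV[OF A(1) C(1)]]) (use pos in simp)
  have Eb': "((\<lambda>\<mu>. inverse (B (yc \<mu>))) has_derivative (\<lambda>v. - (Eb * (Y \<bullet> v / rt \<mu> * B1 (yc \<mu>)) * Eb))) (at \<mu>)"
    unfolding Eb_def Y_def
    by (rule Deriv.has_derivative_inverse[OF _ DERIV_compose_FDERIV[OF B(1) C(2)]]) (use pos in simp)
  have D: "((\<lambda>\<mu>. G \<mu> $ i $ j) has_derivative (\<lambda>v.
      (X $ i * X $ j * (Ea * - (E * ((d * (X \<bullet> v) + c * (Y \<bullet> v)) / rt \<mu>) * E) + - (Ea * (X \<bullet> v / rt \<mu> * A1 (xc \<mu>)) * Ea) * E) +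
       (X $ i * (X \<bullet> v / rt \<mu> * \<sigma> $ j) + X \<bullet> v / rt \<mu> * \<sigma> $ i * X $ j) * (Ea * E)) +
      (Y $ i * Y $ j * (Eb * - (E * ((d * (X \<bullet> v) + c * (Y \<bullet> v)) / rt \<mu>) * E) + - (Eb * (Y \<bullet> v / rt \<mu> * B1 (yc \<mu>)) * Eb) * E) +
       (Y $ i * - (Y \<bullet> v / rt \<mu> * \<sigma> $ j) + - (Y \<bullet> v / rt \<mu> * \<sigma> $ i) * Y $ j) * (Eb * E)))) (at \<mu>)" for i j
    unfolding G_def vec_lambda_beta divide_inverse[of _ "_ * rt _"] inverse_mult_distrib
    unfolding E_def X_def Y_def Ea_def Eb_def
    by (rule has_derivative_mult has_derivative_add E' X'[unfolded X_def] Y'[unfolded Y_def]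
        Ea'[unfolded Ea_def X_def] Eb'[unfolded Eb_def Y_def])+
  show "(\<lambda>\<mu>. G \<mu> $ i $ j) differentiable at \<mu>"
    unfolding differentiable_def by (rule exI) (rule D)
  show "pdiff k (\<lambda>\<mu>. G \<mu> $ i $ j) \<mu> = pdiff i (\<lambda>\<mu>. G \<mu> $ k $ j) \<mu>"
    unfolding pdiff_eqI[OF D] dot_axis \<sigma>_frame[OF dom] X_def[symmetric] Y_def[symmetric]
      divide_inverse[of _ "rt _"] E_def[symmetric]
    by (simp add: algebra_simps)
qed

text \<open>At P this is the projection e \<otimes> Q with eigenvalues 1 and 0; \<sigma> is the
  gradient of the trace 1 + d x - c y.\<close>

definition \<Psi> :: "real^2 \<Rightarrow> real^2^2" where
  "\<Psi> \<mu> = (\<chi> i j. e $ i * Q $ j + \<sigma> $ i * (\<mu> - P) $ j)"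

text \<open>In the frame \<open>(X \<otimes> p, Y \<otimes> q)\<close> the endomorphism \<open>\<Psi>\<close> is diagonal with eigenvalues \<open>1 + d x\<close>
  and \<open>- c y\<close>, each depending on one of the coordinates only.\<close>

lemma \<Psi>_frame:
  assumes "\<mu> \<in> dom"
  shows "\<Psi> \<mu> $ i $ j = Xv (xc \<mu>) $ i * pv (yc \<mu>) $ j - c * yc \<mu> * (if i = j then 1 else 0)"
proof -
  have "\<mu> = pt (xc \<mu>) (yc \<mu>)"
    using dom_coords(6,7)[OF assms] by (intro pt_eqI) (simp_all add: algebra_simps)
  then have "\<mu> - P = pt (xc \<mu>) (yc \<mu>) - P"
    by (rule arg_cong)
  also have "\<dots> = xc \<mu> *\<^sub>R Q + yc \<mu> *\<^sub>R R + (xc \<mu> * yc \<mu>) *\<^sub>R S"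
    by (simp add: pt_def)
  finally show ?thesis
    unfolding \<Psi>_def vec_lambda_beta basis[symmetric]
    by (simp only:) (simp add: Xv_def pv_def S_def \<sigma>_def algebra_simps)
qed

text \<open>By \<open>\<Psi>_frame\<close>, \<Psi> is Xv \<otimes> pv minus a multiple of the
  identity, and \<open>G\<close> sends \<open>pv\<close> to Xv / A. So \<Psi> G is Xv \<otimes> Xv /
  A minus a multiple of \<open>G\<close>.\<close>

lemma \<Psi>_G_sym:
  assumes "\<mu> \<in> reg"
  shows "(\<Sum>l\<in>UNIV. \<Psi> \<mu> $ i $ l * G \<mu> $ l $ k) = (\<Sum>l\<in>UNIV. \<Psi> \<mu> $ k $ l * G \<mu> $ l $ i)"
proof -
  note dom = reg_dom[OF assms] and pos = profile_pos[OF assms]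
  let ?X = "Xv (xc \<mu>)" and ?Y = "Yv (yc \<mu>)" and ?p = "pv (yc \<mu>)"
  have pG: "(\<Sum>l\<in>UNIV. ?p $ l * G \<mu> $ l $ k) = ?X $ k / A (xc \<mu>)" for k
  proof -
    have "(\<Sum>l\<in>UNIV. ?p $ l * G \<mu> $ l $ k) =
       (?X $ 1 * ?p $ 1 + ?X $ 2 * ?p $ 2) * ?X $ k / (A (xc \<mu>) * rt \<mu>) + (?Y $ 1 * ?p $ 1 + ?Y $ 2 * ?p $ 2) * ?Y $ k / (B (yc \<mu>) * rt \<mu>)"
      by (simp add: G_def sum_2 add_divide_distrib algebra_simps)
    then show ?thesis
      unfolding frame_dot_sum[OF dom] using pos by simp
  qed
  have "(\<Sum>l\<in>UNIV. \<Psi> \<mu> $ i $ l * G \<mu> $ l $ k) = ?X $ i * ?X $ k / A (xc \<mu>) - c * yc \<mu> * G \<mu> $ i $ k" for i k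
  proof -
    have "(\<Sum>l\<in>UNIV. \<Psi> \<mu> $ i $ l * G \<mu> $ l $ k) =
        ?X $ i * (\<Sum>l\<in>UNIV. ?p $ l * G \<mu> $ l $ k) - c * yc \<mu> * (\<Sum>l\<in>UNIV. (if i = l then 1 else 0) * G \<mu> $ l $ k)"
      unfolding \<Psi>_frame[OF dom] by (simp add: sum_2 algebra_simps)
    then show ?thesis
      unfolding pG by (simp add: if_distrib[of "\<lambda>t. t * _"] cong: if_cong)
  qed
  moreover have "G \<mu> $ i $ k = G \<mu> $ k $ i"
    by (simp add: G_def mult.commute)
  ultimately show ?thesis
    by (simp add: mult.commute)
qed

lemma hamiltonian_2form_exists:
  assumes h: "\<And>\<mu>. \<mu> \<in> reg \<Longrightarrow> hess \<phi> \<mu> = G \<mu>" "\<And>\<mu>. \<mu> \<in> reg \<Longrightarrow> inv_hess \<phi> \<mu> = H \<mu>"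
  shows "\<exists>\<psi>. hamiltonian_2form (toric_domain quad) (toric_metric \<phi>)
    (complex_structure (toric_metric \<phi>) toric_form) toric_form \<psi>"
proof -
  have p: "pdiff k (\<lambda>\<mu>. hess \<phi> \<mu> $ i $ j) \<mu> = pdiff k (\<lambda>\<mu>. G \<mu> $ i $ j) \<mu>" if "\<mu> \<in> reg" for \<mu> i j k
    by (rule pdiff_cong[OF open_reg that _ G_has_derivative(1)[OF that]]) (simp add: h)
  interpret toric_hamiltonian quad \<phi> \<Psi> \<sigma>
  proof (unfold_locales, unfold interior_quad)
    fix \<mu> i j k
    assume \<mu>: "\<mu> \<in> reg"
    note h = h[OF \<mu>] and h' = h
    show "hess \<phi> \<mu> ** inv_hess \<phi> \<mu> = mat 1" "inv_hess \<phi> \<mu> ** hess \<phi> \<mu> = mat 1"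
      unfolding h by (rule G_H_inverse[OF \<mu>])+
    show "hess \<phi> \<mu> $ i $ j = hess \<phi> \<mu> $ j $ i"
      unfolding h by (simp add: G_def mult.commute)
    show "(\<lambda>\<mu>. hess \<phi> \<mu> $ i $ j) differentiable at \<mu>"
      by (rule differentiable_cong_open[OF G_has_derivative(1)[OF \<mu>] open_reg \<mu>]) (simp add: h')
    show "(\<lambda>\<mu>. inv_hess \<phi> \<mu> $ i $ j) differentiable at \<mu>"
      by (rule differentiable_cong_open[OF H_component_differentiable(1)[OF reg_dom[OF \<mu>]] open_reg \<mu>]) (simp add: h')
    show "pdiff k (\<lambda>\<mu>. hess \<phi> \<mu> $ i $ j) \<mu> = pdiff i (\<lambda>\<mu>. hess \<phi> \<mu> $ k $ j) \<mu>"
      unfolding p[OF \<mu>] by (rule G_has_derivative(2)[OF \<mu>])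
    show "(\<Sum>l\<in>UNIV. \<Psi> \<mu> $ i $ l * hess \<phi> \<mu> $ l $ k) = (\<Sum>l\<in>UNIV. \<Psi> \<mu> $ k $ l * hess \<phi> \<mu> $ l $ i)"
      unfolding h by (rule \<Psi>_G_sym[OF \<mu>])
  next
    fix \<mu> and i j :: 2
    have "((\<lambda>\<mu>. (\<mu> - P) $ j) has_derivative (\<lambda>v. v $ j)) (at \<mu>)"
      unfolding vector_minus_component
      by (rule has_derivative_eq_rhs[OF has_derivative_diff[OF
            bounded_linear_imp_has_derivative[OF bounded_linear_vec_nth] has_derivative_const]]) simp
    then show "((\<lambda>\<mu>. \<Psi> \<mu> $ i $ j) has_derivative (\<lambda>v. \<sigma> $ i * v $ j)) (at \<mu>)"
      unfolding \<Psi>_def vec_lambda_beta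
      by (rule has_derivative_eq_rhs[OF has_derivative_add[OF has_derivative_const
            has_derivative_mult[OF has_derivative_const]]]) simp
  qed
  have "\<exists>\<mu>\<in>interior quad. \<Psi> \<mu> \<noteq> \<kappa> *\<^sub>R mat 1" for \<kappa>
  proof (rule bexI)
    let ?\<mu> = "pt (1/2) (1/2)"
    note dom = reg_dom[OF center_in_reg]
    let ?X = "Xv (xc ?\<mu>)" and ?Y = "Yv (yc ?\<mu>)" and ?p = "pv (yc ?\<mu>)" and ?q = "qv (xc ?\<mu>)" and ?t = "\<kappa> + c * yc ?\<mu>"
    show "?\<mu> \<in> interior quad"
      unfolding interior_quad by (rule center_in_reg)
    show "\<Psi> ?\<mu> \<noteq> \<kappa> *\<^sub>R mat 1"
    proof
      \<comment> \<open>Then Xv \<otimes> pv would be \<open>?t\<close> times the identity. Its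
        determinant vanishes, so \<open>?t\<close> = 0, while its trace is rt > 0.\<close>
      assume "\<Psi> ?\<mu> = \<kappa> *\<^sub>R mat 1"
      then have XP: "?X $ i * ?p $ j = (if i = j then ?t else 0)" for i j
        using \<Psi>_frame[OF dom, of i j] by (auto simp: mat_def)
      have "rt ?\<mu> * ?t = (?X $ 1 * ?p $ 1 + ?X $ 2 * ?p $ 2) * ?t"
        unfolding frame_dot_sum[OF dom] ..
      also have "\<dots> = 2 * ?t\<^sup>2"
        unfolding XP by (simp add: power2_eq_square)
      finally have 1: "rt ?\<mu> * ?t = 2 * ?t\<^sup>2" .
      have "?t * ?t = (?X $ 1 * ?p $ 1) * (?X $ 2 * ?p $ 2)"
        unfolding XP by simp
      also have "\<dots> = (?X $ 1 * ?p $ 2) * (?X $ 2 * ?p $ 1)"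
        by (simp add: mult_ac)
      also have "\<dots> = 0"
        unfolding XP by simp
      finally have "?t = 0" by simp
      then have "rt ?\<mu> = 0"
        using frame_dot_sum(1)[OF dom] unfolding XP by simp
      with dom_coords(1)[OF dom] show False by simp
    qed
  qed
  then show ?thesis
    using hamiltonian by blast
qed

section \<open>Boundary conditions and positivity on faces\<close>

definition labels :: "(4 \<Rightarrow> real^2) \<Rightarrow> bool" where
  "labels u \<longleftrightarrow> u 1 = (2 / B1 0) *\<^sub>R Yv 0 \<and> u 2 = (2 / A1 1) *\<^sub>R Xv 1 \<and>
    u 3 = (2 / B1 1) *\<^sub>R Yv 1 \<and> u 4 = (2 / A1 0) *\<^sub>R Xv 0"

lemma frame_inner_derivatives:
  assumes "\<mu> \<in> dom"
  shows "((\<lambda>\<mu>. pv (yc \<mu>) \<bullet> u) has_derivative (\<lambda>v. Yv (yc \<mu>) \<bullet> v / rt \<mu> * (S \<bullet> u))) (at \<mu>)"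
    "((\<lambda>\<mu>. qv (xc \<mu>) \<bullet> u) has_derivative (\<lambda>v. Xv (xc \<mu>) \<bullet> v / rt \<mu> * (S \<bullet> u))) (at \<mu>)"
  unfolding pv_def qv_def inner_add_left inner_scaleR_left
  by (rule derivative_eq_intros coords_has_derivative[OF assms] refl | simp)+

text \<open>On the edge \<open>A\<close> vanishes, so only its differential contributes: for u = t
  Xv the differential of H(u, u) is t^2 A1 Xv, which equals 2 u for t = 2 / A1. This is the origin
  of the factors in \<open>labels\<close>; at x = 1 a negative slope turns \<open>Xv 1\<close>
  inward.\<close>

lemma edge_condition_x:
  assumes "\<mu> \<in> dom" "A (xc \<mu>) = 0" "A1 (xc \<mu>) \<noteq> 0" "u = (2 / A1 (xc \<mu>)) *\<^sub>R Xv (xc \<mu>)"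
  shows "bilin (H \<mu>) u v = 0"
    "((\<lambda>\<mu>. bilin (H \<mu>) u u) has_derivative (\<lambda>v. 2 * (u \<bullet> v))) (at \<mu>)"
proof -
  note fd = frame_dot[OF assms(1)] and C = coords_has_derivative[OF assms(1)]
  have D: "rt \<mu> > 0" using dom_coords(1)[OF assms(1)] .
  have q: "qv (xc \<mu>) \<bullet> u = 0" and p: "pv (yc \<mu>) \<bullet> u = 2 / A1 (xc \<mu>) * rt \<mu>"
    unfolding assms(4) using fd by (simp_all add: inner_commute)
  show "bilin (H \<mu>) u v = 0"
    unfolding bilin_H q assms(2) by simp
  note p' = frame_inner_derivatives[OF assms(1)]
  show "((\<lambda>\<mu>. bilin (H \<mu>) u u) has_derivative (\<lambda>v. 2 * (u \<bullet> v))) (at \<mu>)"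
    unfolding bilin_H divide_inverse[of _ "rt _"]
    by (rule has_derivative_eq_rhs, (rule has_derivative_mult has_derivative_add p'
        frame_component_derivatives(3)[OF assms(1)]
        DERIV_compose_FDERIV[OF A(1) C(1)] DERIV_compose_FDERIV[OF B(1) C(2)])+,
      unfold assms(2) p q, unfold assms(4))
      (use D assms(3) in \<open>simp add: fun_eq_iff field_simps\<close>)
qed

lemma edge_condition_y:
  assumes "\<mu> \<in> dom" "B (yc \<mu>) = 0" "B1 (yc \<mu>) \<noteq> 0" "u = (2 / B1 (yc \<mu>)) *\<^sub>R Yv (yc \<mu>)"
  shows "bilin (H \<mu>) u v = 0"
    "((\<lambda>\<mu>. bilin (H \<mu>) u u) has_derivative (\<lambda>v. 2 * (u \<bullet> v))) (at \<mu>)"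
proof -
  note fd = frame_dot[OF assms(1)] and C = coords_has_derivative[OF assms(1)]
  have D: "rt \<mu> > 0" using dom_coords(1)[OF assms(1)] .
  have p: "pv (yc \<mu>) \<bullet> u = 0" and q: "qv (xc \<mu>) \<bullet> u = 2 / B1 (yc \<mu>) * rt \<mu>"
    unfolding assms(4) using fd by (simp_all add: inner_commute)
  show "bilin (H \<mu>) u v = 0"
    unfolding bilin_H p assms(2) by simp
  note p' = frame_inner_derivatives[OF assms(1)]
  show "((\<lambda>\<mu>. bilin (H \<mu>) u u) has_derivative (\<lambda>v. 2 * (u \<bullet> v))) (at \<mu>)"
    unfolding bilin_H divide_inverse[of _ "rt _"]
    by (rule has_derivative_eq_rhs, (rule has_derivative_mult has_derivative_add p'
        frame_component_derivatives(3)[OF assms(1)]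
        DERIV_compose_FDERIV[OF A(1) C(1)] DERIV_compose_FDERIV[OF B(1) C(2)])+,
      unfold assms(2) p q, unfold assms(4))
      (use D assms(3) in \<open>simp add: fun_eq_iff field_simps\<close>)
qed

lemma symplectic_potential:
  assumes s: "s 1 = P" "s 2 = P + Q" "s 3 = P + Q + R + S" "s (4::4) = P + R"
    and faces: "\<And>k. edge s k face_of quad"
    and u: "labels u" and nz: "A1 0 \<noteq> 0" "A1 1 \<noteq> 0" "B1 0 \<noteq> 0" "B1 1 \<noteq> 0"
    and Ck: "\<And>k. Ck_on k reg \<phi>"
    and \<phi>: "\<And>\<mu>. \<mu> \<in> reg \<Longrightarrow> (\<phi> has_derivative (\<lambda>v. g \<mu> \<bullet> v)) (at \<mu>)"
    and g: "\<And>\<mu>. \<mu> \<in> reg \<Longrightarrow> (g has_derivative (\<lambda>v. G \<mu> *v v)) (at \<mu>)"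
  shows "\<phi> \<in> symplectic_potentials quad s u"
proof -
  note hess = potential_hess[OF \<phi> g]
  note edges = edge_coords[OF s]
  have conv: "convex (interior quad)"
    unfolding quad_def by (intro convex_interior convex_convex_hull)
  have 1: "smooth_on (interior quad) \<phi>"
    using Ck open_reg by (simp add: smooth_on_def interior_quad)
  have 2: "strictly_convex_on (interior quad) \<phi>"
    by (rule strictly_convex_onI[OF conv, of \<phi> g "\<lambda>\<mu> v. G \<mu> *v v"]) (simp_all add: interior_quad \<phi> g G_pos)
  have 3: "invertible (hess \<phi> \<mu>)" if "\<mu> \<in> interior quad" for \<mu>
    using that G_H_inverse unfolding interior_quad invertible_def by (auto simp: hess)
  have 4: "smooth_on dom H"
    using Ck_on_H open_dom by (simp add: smooth_on_def)
  have cond: "bilin (H y) (u k) v = 0 \<and>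
      ((\<lambda>x. bilin (H x) (u k) (u k)) has_derivative (\<lambda>v. 2 * (u k \<bullet> v))) (at y)"
    if y: "y \<in> edge s k" for k y v
  proof -
    have q: "y \<in> quad" using faces[of k] y face_of_imp_subset by blast
    note dom = quad_coords(1)[OF q]
    consider "k = 1" | "k = 2" | "k = 3" | "k = 4"
      using exhaust_4 by metis
    then show ?thesis
    proof cases
      case 1
      then have "yc y = 0" using y edges by auto
      then show ?thesis
        using edge_condition_y(1)[OF dom, of "u k" v] edge_condition_y(2)[OF dom, of "u k"] u nz B(4) by (simp add: 1 labels_def)
    next
      case 2
      then have "xc y = 1" using y edges by auto
      then show ?thesis
        using edge_condition_x(1)[OF dom, of "u k" v] edge_condition_x(2)[OF dom, of "u k"] u nz A(5) by (simp add: 2 labels_def)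
    next
      case 3
      then have "yc y = 1" using y edges by auto
      then show ?thesis
        using edge_condition_y(1)[OF dom, of "u k" v] edge_condition_y(2)[OF dom, of "u k"] u nz B(5) by (simp add: 3 labels_def)
    next
      case 4
      then have "xc y = 0" using y edges by auto
      then show ?thesis
        using edge_condition_x(1)[OF dom, of "u k" v] edge_condition_x(2)[OF dom, of "u k"] u nz A(4) by (simp add: 4 labels_def)
    qed
  qed
  \<comment> \<open>If H(v, v) is not positive, then A (pv \<bullet> v)^2 = B (qv \<bullet> v)^2 =
    0. In the expansion of v along Xv and Yv a coefficient can survive only where its profile
    vanishes, that is, on an edge with that conormal.\<close>
  have pos: "0 < bilin (H y) v v"
    if F: "F face_of quad" and y: "y \<in> rel_interior F" and v: "v \<notin> normal_span s u F" for F y v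
  proof (rule ccontr)
    have q: "y \<in> quad"
      using F y face_of_imp_subset rel_interior_subset by blast
    note qc = quad_coords[OF q] and dom = quad_coords(1)[OF q]
    have D: "rt y > 0" by (rule dom_coords(1)[OF dom])
    have nonneg: "A (xc y) \<ge> 0" "B (yc y) \<ge> 0"
      using qc A(4-6) B(4-6) by (metis order_le_less)+
    have zero: "A (xc y) = 0 \<longleftrightarrow> xc y = 0 \<or> xc y = 1" "B (yc y) = 0 \<longleftrightarrow> yc y = 0 \<or> yc y = 1"
      using qc A(4-6) B(4-6) by (metis order_le_less less_irrefl)+
    \<comment> \<open>As \<open>y\<close> is in the relative interior of \<open>F\<close>, every
      edge through \<open>y\<close> contains all of \<open>F\<close>, so its normal counts in
      \<open>normal_span\<close>.\<close>
    have sub: "F \<subseteq> edge s k" if "y \<in> edge s k" for k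
      using subset_of_face_of[OF faces[of k] face_of_imp_subset[OF F]] that y by blast
    have span: "w \<in> normal_span s u F" if "y \<in> edge s k" "u k = t *\<^sub>R w" "t \<noteq> 0" for k t w
    proof -
      have "u k \<in> normal_span s u F"
        unfolding normal_span_def by (rule span_base) (use sub[OF that(1)] in auto)
      then have "(1 / t) *\<^sub>R u k \<in> normal_span s u F"
        unfolding normal_span_def by (rule span_scale)
      then show ?thesis using that by simp
    qed
    assume "\<not> 0 < bilin (H y) v v"
    then have "A (xc y) * (pv (yc y) \<bullet> v)\<^sup>2 + B (yc y) * (qv (xc y) \<bullet> v)\<^sup>2 \<le> 0"
      using D by (simp add: bilin_H zero_less_divide_iff power2_eq_square mult.assoc)
    moreover have "A (xc y) * (pv (yc y) \<bullet> v)\<^sup>2 \<ge> 0" "B (yc y) * (qv (xc y) \<bullet> v)\<^sup>2 \<ge> 0"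
      using nonneg by simp_all
    ultimately have "A (xc y) * (pv (yc y) \<bullet> v)\<^sup>2 = 0 \<and> B (yc y) * (qv (xc y) \<bullet> v)\<^sup>2 = 0"
      by linarith
    then have c: "A (xc y) = 0 \<or> pv (yc y) \<bullet> v = 0" "B (yc y) = 0 \<or> qv (xc y) \<bullet> v = 0"
      by auto
    have X: "A (xc y) = 0 \<Longrightarrow> Xv (xc y) \<in> normal_span s u F"
      using span[of 4 "2 / A1 0" "Xv 0"] span[of 2 "2 / A1 1" "Xv 1"] zero(1) q edges u nz
      by (auto simp: labels_def)
    have Y: "B (yc y) = 0 \<Longrightarrow> Yv (yc y) \<in> normal_span s u F"
      using span[of 1 "2 / B1 0" "Yv 0"] span[of 3 "2 / B1 1" "Yv 1"] zero(2) q edges u nz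
      by (auto simp: labels_def)
    have sc: "t *\<^sub>R w \<in> normal_span s u F" if "w \<in> normal_span s u F" for t w
      using that unfolding normal_span_def by (rule span_scale)
    have ad: "w + w' \<in> normal_span s u F" if "w \<in> normal_span s u F" "w' \<in> normal_span s u F" for w w'
      using that unfolding normal_span_def by (rule span_add)
    have z: "0 \<in> normal_span s u F"
      unfolding normal_span_def by (rule span_zero)
    have "(pv (yc y) \<bullet> v) *\<^sub>R Xv (xc y) \<in> normal_span s u F" "(qv (xc y) \<bullet> v) *\<^sub>R Yv (yc y) \<in> normal_span s u F"
      using c X Y sc z by auto
    from sc[OF ad[OF this], of "1 / rt y"] have "(1 / rt y) *\<^sub>R (rt y *\<^sub>R v) \<in> normal_span s u F"
      unfolding frame_expand(1)[OF dom] .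
    with D v show False by simp
  qed
  have "\<exists>U K. quad \<subseteq> U \<and> smooth_on U K \<and> (\<forall>x\<in>interior quad. K x = inv_hess \<phi> x) \<and>
        (\<forall>k. \<forall>y\<in>rel_interior (edge s k).
           (\<forall>v. bilin (K y) (u k) v = 0) \<and>
           ((\<lambda>x. bilin (K x) (u k) (u k)) has_derivative (\<lambda>v. 2 * (u k \<bullet> v))) (at y)) \<and>
        (\<forall>F. F face_of quad \<longrightarrow>
           (\<forall>y\<in>rel_interior F. \<forall>v. v \<notin> normal_span s u F \<longrightarrow> 0 < bilin (K y) v v))"
  proof (intro exI[of _ dom] exI[of _ H] conjI ballI allI impI)
    show "quad \<subseteq> dom" using quad_coords(1) by blast
    show "smooth_on dom H" by (rule 4)
    show "H x = inv_hess \<phi> x" if "x \<in> interior quad" for x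
      using that by (simp add: interior_quad hess)
    show "bilin (H y) (u k) v = 0" if "y \<in> rel_interior (edge s k)" for k y v
      using cond that rel_interior_subset by blast
    show "((\<lambda>x. bilin (H x) (u k) (u k)) has_derivative (\<lambda>v. 2 * (u k \<bullet> v))) (at y)"
      if "y \<in> rel_interior (edge s k)" for k y
      using cond that rel_interior_subset by blast
  qed (rule pos)
  with 1 2 3 show ?thesis
    unfolding symplectic_potentials_def by blast
qed

theorem soliton_exists:
  assumes s: "s 1 = P" "s 2 = P + Q" "s 3 = P + Q + R + S" "s (4::4) = P + R"
    and faces: "\<And>k. edge s k face_of quad"
    and u: "labels u" and nz: "A1 0 \<noteq> 0" "A1 1 \<noteq> 0" "B1 0 \<noteq> 0" "B1 1 \<noteq> 0"
    and a: "a \<bullet> S = 0"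
    and ode: "\<And>x y. - (A2 x + B2 y) + 2 * ((a \<bullet> Q) * A1 x + (a \<bullet> R) * B1 y) =
      average_scal quad s u * (1 + c * y + d * x)"
  shows "\<exists>g. generalized_KRS quad s u g a \<and>
    (\<exists>\<psi>. hamiltonian_2form (toric_domain quad) g (complex_structure g toric_form) toric_form \<psi>)"
proof -
  obtain \<phi> g where Ck: "\<And>k. Ck_on k reg \<phi>"
    and \<phi>: "\<And>\<mu>. \<mu> \<in> reg \<Longrightarrow> (\<phi> has_derivative (\<lambda>v. g \<mu> \<bullet> v)) (at \<mu>)"
    and g: "\<And>\<mu>. \<mu> \<in> reg \<Longrightarrow> (g has_derivative (\<lambda>v. G \<mu> *v v)) (at \<mu>)"
    by (rule potential_exists) (rule that)
  note h = potential_hess[OF \<phi> g]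
  show ?thesis
  proof (rule exI[of _ "toric_metric \<phi>"], rule conjI)
    have sp: "\<phi> \<in> symplectic_potentials quad s u"
      by (rule symplectic_potential[OF s faces u nz Ck \<phi> g])
    have eq: "- (\<Sum>i\<in>UNIV. \<Sum>j\<in>UNIV. pdiff i (pdiff j (\<lambda>y. inv_hess \<phi> y $ i $ j)) \<mu>)
        + 2 * (\<Sum>i\<in>UNIV. \<Sum>j\<in>UNIV. a $ j * pdiff i (\<lambda>y. inv_hess \<phi> y $ i $ j) \<mu>) = average_scal quad s u"
      if "\<mu> \<in> reg" for \<mu>
      by (rule soliton_equation[OF h(2) that a ode])
    show "generalized_KRS quad s u (toric_metric \<phi>) a"
      unfolding generalized_KRS_def interior_quad
      by (intro bexI[OF _ sp] conjI refl ballI eq)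
  qed (rule hamiltonian_2form_exists[OF h])
qed

end

section \<open>Convex quadrilaterals\<close>

text \<open>\<open>w\<close> is orthogonal to \<open>u\<close>, so the freedom in the choice of the
  covector (multiples of \<open>u\<close>) does not affect the value; \<open>?t\<close> shows that a
  choice exists.\<close>

lemma edge_covector_dot:
  assumes "u \<noteq> 0" "w $ 1 = l * u $ 2" "w $ 2 = - l * u $ 1"
  shows "edge_covector u \<bullet> w = l"
proof -
  define N where "N = u $ 1 * u $ 1 + u $ 2 * u $ 2"
  have N: "N \<noteq> 0"
    using assms(1) by (simp add: N_def vec_eq_iff forall_2 sum_squares_eq_zero_iff)
  let ?t = "vector [u $ 2 / N, - u $ 1 / N] :: real^2"
  have "u $ 1 * ?t $ 2 - u $ 2 * ?t $ 1 = - (N / N)"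
    unfolding N_def by (simp add: add_divide_distrib del: divide_self_if)
  also have "\<dots> = -1" using N by simp
  finally have "u $ 1 * edge_covector u $ 2 - u $ 2 * edge_covector u $ 1 = -1"
    unfolding edge_covector_def by (rule someI)
  moreover have "edge_covector u \<bullet> w = - l * (u $ 1 * edge_covector u $ 2 - u $ 2 * edge_covector u $ 1)"
    by (simp add: inner_vec_def sum_2 assms(2,3) algebra_simps)
  ultimately show ?thesis by simp
qed

section \<open>Area, boundary mass and average scalar curvature\<close>

context bilinear_coordinates
begin

text \<open>The determinant of (Q, R), not the complex structure. Its sign is the orientation of the
  vertex order, which is left open; hence the absolute values below.\<close>

definition J :: real where "J = Q $ 1 * R $ 2 - Q $ 2 * R $ 1"

lemma J_dual:
  shows "J * e $ 1 = R $ 2" (is ?e1) and "J * e $ 2 = - R $ 1" (is ?e2)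
    and "J * f $ 1 = - Q $ 2" (is ?f1) and "J * f $ 2 = Q $ 1" (is ?f2)
proof -
  have d: "e $ 1 * Q $ 1 + e $ 2 * Q $ 2 = 1" "e $ 1 * R $ 1 + e $ 2 * R $ 2 = 0"
    "f $ 1 * Q $ 1 + f $ 2 * Q $ 2 = 0" "f $ 1 * R $ 1 + f $ 2 * R $ 2 = 1"
    using dual by (simp_all add: inner_vec_def sum_2)
  have "J * e $ 1 = R $ 2 * (e $ 1 * Q $ 1 + e $ 2 * Q $ 2) - Q $ 2 * (e $ 1 * R $ 1 + e $ 2 * R $ 2)"
    "J * e $ 2 = Q $ 1 * (e $ 1 * R $ 1 + e $ 2 * R $ 2) - R $ 1 * (e $ 1 * Q $ 1 + e $ 2 * Q $ 2)"
    "J * f $ 1 = R $ 2 * (f $ 1 * Q $ 1 + f $ 2 * Q $ 2) - Q $ 2 * (f $ 1 * R $ 1 + f $ 2 * R $ 2)"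
    "J * f $ 2 = Q $ 1 * (f $ 1 * R $ 1 + f $ 2 * R $ 2) - R $ 1 * (f $ 1 * Q $ 1 + f $ 2 * Q $ 2)"
    by (simp_all add: J_def algebra_simps)
  then show ?e1 ?e2 ?f1 ?f2
    unfolding d by simp_all
qed

lemma J_nonzero: "J \<noteq> 0"
proof
  assume "J = 0"
  then have "R = 0"
    using J_dual(1,2) by (simp add: vec_eq_iff forall_2)
  then show False using dual by simp
qed

text \<open>A conormal of a line x = const is its direction \<open>qv x\<close> turned by a right
  angle, and similarly for y; \<open>J\<close> is the scale. This feeds the labels into
  \<open>edge_covector_dot\<close>.\<close>

lemma J_frame:
  shows "J * Xv x $ 1 = qv x $ 2" (is ?x1) and "J * Xv x $ 2 = - qv x $ 1" (is ?x2)
    and "J * Yv y $ 1 = - pv y $ 2" (is ?y1) and "J * Yv y $ 2 = pv y $ 1" (is ?y2)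
proof -
  have "J * \<sigma> $ 1 = S $ 2" "J * \<sigma> $ 2 = - S $ 1"
    using J_dual by (simp_all add: \<sigma>_def S_def algebra_simps)
  then show ?x1 ?x2 ?y1 ?y2
    using J_dual by (simp_all add: Xv_def Yv_def pv_def qv_def algebra_simps)
qed

lemma measure_quad: "measure lebesgue quad = \<bar>J\<bar> * (2 + c + d) / 2"
proof -
  define T1 where "T1 = convex hull {P, P + Q, P + Q + R + S}"
  define T2 where "T2 = convex hull {P, P + Q + R + S, P + R}"
  \<comment> \<open>A normal to the diagonal from P to P + Q + R + S, which cuts the quadrilateral
    into \<open>T1\<close> and \<open>T2\<close>.\<close>
  define n where "n = (1 + c) *\<^sub>R f - (1 + d) *\<^sub>R e"
  have nd: "n \<bullet> Q = - (1 + d)" "n \<bullet> R = 1 + c" "n \<bullet> (Q + R + S) = 0"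
    by (simp_all add: n_def inner_simps dual dot_simps algebra_simps)
  have half: "T1 \<subseteq> {\<mu>. n \<bullet> \<mu> \<le> n \<bullet> P}" "T2 \<subseteq> {\<mu>. n \<bullet> \<mu> \<ge> n \<bullet> P}"
    unfolding T1_def T2_def
    by (rule hull_minimal; use nd cd in \<open>simp add: convex_halfspace_le convex_halfspace_ge inner_add_right\<close>)+
  have "quad = T1 \<union> T2"
  proof
    show "T1 \<union> T2 \<subseteq> quad"
      unfolding T1_def T2_def quad_def by (intro Un_least hull_mono) auto
    show "quad \<subseteq> T1 \<union> T2"
    proof
      fix \<mu> assume \<mu>: "\<mu> \<in> quad"
      define m k where "m = e \<bullet> (\<mu> - P)" and "k = f \<bullet> (\<mu> - P)"
      have h: "m \<ge> 0" "k \<ge> 0" "(1 + d) * m - c * k \<le> 1 + d" "(1 + c) * k - d * m \<le> 1 + c"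
        using quad_halfspaces[OF \<mu>] by (auto simp: m_def k_def \<sigma>_def inner_simps algebra_simps)
      obtain x y where xy: "\<mu> = pt x y"
        by (rule quad_pt[OF \<mu>])
      have \<mu>_eq: "\<mu> = P + m *\<^sub>R Q + k *\<^sub>R R"
        unfolding m_def k_def unfolding xy pt_dot by (simp add: pt_def S_def algebra_simps)
      show "\<mu> \<in> T1 \<union> T2"
      proof (cases "(1 + c) * k \<le> (1 + d) * m")
        case True
        \<comment> \<open>The barycentric weight of P + Q + R + S, the only vertex of
          \<open>T1\<close> that has an R-component relative to P, namely 1 + d.\<close>
        define w where "w = k / (1 + d)"
        have k: "k = (1 + d) * w" using cd by (simp add: w_def)
        have "w \<ge> 0" using h cd by (simp add: w_def)
        moreover have "m - (1 + c) * w \<ge> 0"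
        proof -
          have "(1 + d) * ((1 + c) * w) \<le> (1 + d) * m"
            using True unfolding k by (simp add: mult_ac)
          then show ?thesis using cd by simp
        qed
        moreover have "1 - (m - (1 + c) * w) - w \<ge> 0"
        proof -
          have "(1 + d) * (m - c * w) \<le> (1 + d) * 1"
            using h(3) unfolding k by (simp add: algebra_simps)
          then have "m - c * w \<le> 1" using cd by simp
          then show ?thesis by (simp add: algebra_simps)
        qed
        moreover have "\<mu> = (1 - (m - (1 + c) * w) - w) *\<^sub>R P + (m - (1 + c) * w) *\<^sub>R (P + Q) + w *\<^sub>R (P + Q + R + S)"
          unfolding \<mu>_eq k S_def by (simp add: algebra_simps)
        ultimately show ?thesis
          unfolding T1_def convex_hull_3 by fastforce
      next
        case False
        define w where "w = m / (1 + c)"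
        have m: "m = (1 + c) * w" using cd by (simp add: w_def)
        have "w \<ge> 0" using h cd by (simp add: w_def)
        moreover have "k - (1 + d) * w \<ge> 0"
        proof -
          have "(1 + c) * ((1 + d) * w) \<le> (1 + c) * k"
            using False unfolding m by (simp add: mult_ac)
          then show ?thesis using cd by simp
        qed
        moreover have "1 - (k - (1 + d) * w) - w \<ge> 0"
        proof -
          have "(1 + c) * (k - d * w) \<le> (1 + c) * 1"
            using h(4) unfolding m by (simp add: algebra_simps)
          then have "k - d * w \<le> 1" using cd by simp
          then show ?thesis by (simp add: algebra_simps)
        qed
        moreover have "\<mu> = (1 - (k - (1 + d) * w) - w) *\<^sub>R P + w *\<^sub>R (P + Q + R + S) + (k - (1 + d) * w) *\<^sub>R (P + R)"
          unfolding \<mu>_eq m S_def by (simp add: algebra_simps)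
        ultimately show ?thesis
          unfolding T2_def convex_hull_3 by fastforce
      qed
    qed
  qed
  moreover have "T1 \<in> lmeasurable" "T2 \<in> lmeasurable"
    unfolding T1_def T2_def by (intro lmeasurable_compact finite_imp_compact_convex_hull; simp)+
  moreover have "negligible (T1 \<inter> T2)"
  proof (rule negligible_subset)
    show "T1 \<inter> T2 \<subseteq> {\<mu>. n \<bullet> \<mu> = n \<bullet> P}"
      using half by force
    show "negligible {\<mu>. n \<bullet> \<mu> = n \<bullet> P}"
      using nd cd by (intro negligible_hyperplane) auto
  qed
  moreover have leb: "measure lebesgue (convex hull {x, y, z}) = measure lborel (convex hull {x, y, z})" for x y z :: "real^2"
    by (intro measure_completion) (simp add: borel_compact finite_imp_compact_convex_hull)
  ultimately have "measure lebesgue quad = measure lebesgue T1 + measure lebesgue T2"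
    by (simp add: measure_Un3 negligible_imp_measure0)
  also have "measure lebesgue T1 = \<bar>J\<bar> * (1 + d) / 2"
  proof -
    have "measure lebesgue T1 = \<bar>(1 + d) * J\<bar> / 2"
      unfolding T1_def leb content_triangle
      by (simp add: S_def J_def algebra_simps abs_minus_commute)
    then show ?thesis using cd by (simp add: abs_mult)
  qed
  also have "measure lebesgue T2 = \<bar>J\<bar> * (1 + c) / 2"
  proof -
    have "measure lebesgue T2 = \<bar>(1 + c) * J\<bar> / 2"
      unfolding T2_def leb content_triangle
      by (simp add: S_def J_def algebra_simps abs_minus_commute)
    then show ?thesis using cd by (simp add: abs_mult)
  qed
  finally show ?thesis by (simp add: algebra_simps add_divide_distrib)
qed

text \<open>A label of slope r gives its edge the mass |J r| / 2. Hence \<open>J\<close> drops out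
  against the area, and the average is linear in the slopes as long as their signs are
  fixed.\<close>

lemma average_scal_quad:
  assumes s: "s 1 = P" "s 2 = P + Q" "s 3 = P + Q + R + S" "s (4::4) = P + R"
    and u: "u 1 = (2 / r1) *\<^sub>R Yv 0" "u 2 = (2 / r2) *\<^sub>R Xv 1" "u 3 = (2 / r3) *\<^sub>R Yv 1" "u 4 = (2 / r4) *\<^sub>R Xv 0"
    and nz: "r1 \<noteq> 0" "r2 \<noteq> 0" "r3 \<noteq> 0" "r4 \<noteq> 0"
  shows "average_scal quad s u = 2 * (\<bar>r1\<bar> + \<bar>r2\<bar> + \<bar>r3\<bar> + \<bar>r4\<bar>) / (2 + c + d)"
proof -
  have X: "edge_covector ((2 / r) *\<^sub>R Xv x) \<bullet> qv x = - (J * r / 2)" if "r \<noteq> 0" "1 + d * x \<noteq> 0" for r x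
  proof (rule edge_covector_dot)
    show "qv x $ 1 = - (J * r / 2) * ((2 / r) *\<^sub>R Xv x) $ 2" "qv x $ 2 = - (- (J * r / 2)) * ((2 / r) *\<^sub>R Xv x) $ 1"
      using J_frame(1,2)[of x] that by simp_all
    have "Xv x \<bullet> pv 0 \<noteq> 0"
      using that unfolding XY_pq(1) by simp
    then show "(2 / r) *\<^sub>R Xv x \<noteq> 0"
      using that by auto
  qed
  have Y: "edge_covector ((2 / r) *\<^sub>R Yv y) \<bullet> pv y = J * r / 2" if "r \<noteq> 0" "1 + c * y \<noteq> 0" for r y
  proof (rule edge_covector_dot)
    show "pv y $ 1 = J * r / 2 * ((2 / r) *\<^sub>R Yv y) $ 2" "pv y $ 2 = - (J * r / 2) * ((2 / r) *\<^sub>R Yv y) $ 1"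
      using J_frame(3,4)[of y] that by simp_all
    have "Yv y \<bullet> qv 0 \<noteq> 0"
      using that unfolding XY_pq(4) by simp
    then show "(2 / r) *\<^sub>R Yv y \<noteq> 0"
      using that by auto
  qed
  have w: "s (1 + 1) - s 1 = pv 0" "s (2 + 1) - s 2 = qv 1" "s (3 + 1) - s 3 = - pv 1" "s (4 + 1) - s 4 = - qv 0"
  proof -
    have four: "(4::4) + 1 = 1" "(3::4) + 1 = 4" "(2::4) + 1 = 3" "(1::4) + 1 = 2"
      by simp_all
    show "s (1 + 1) - s 1 = pv 0" "s (2 + 1) - s 2 = qv 1" "s (3 + 1) - s 3 = - pv 1" "s (4 + 1) - s 4 = - qv 0"
      unfolding four s by (simp_all add: pv_def qv_def)
  qed
  have "boundary_mass s u = \<bar>J * r1 / 2\<bar> + \<bar>J * r2 / 2\<bar> + \<bar>J * r3 / 2\<bar> + \<bar>J * r4 / 2\<bar>"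
    unfolding boundary_mass_def sum_4 w u inner_minus_right abs_minus_cancel
    using cd nz by (simp add: X Y)
  also have "\<dots> = \<bar>J\<bar> * (\<bar>r1\<bar> + \<bar>r2\<bar> + \<bar>r3\<bar> + \<bar>r4\<bar>) / 2"
    by (simp add: abs_mult algebra_simps add_divide_distrib)
  finally have bm: "boundary_mass s u = \<bar>J\<bar> * (\<bar>r1\<bar> + \<bar>r2\<bar> + \<bar>r3\<bar> + \<bar>r4\<bar>) / 2" .
  have cancel: "2 * (j * K / 2) / (j * t / 2) = 2 * K / t" if "j \<noteq> 0" for j K t :: real
    using that by simp
  show ?thesis
    unfolding average_scal_def measure_quad bm by (rule cancel) (use J_nonzero in simp)
qed

end

text \<open>An edge is an exposed face, so it has a normal that is zero at its two end vertices and
  positive at the other two. The normals of the edges at \<open>s 1\<close> give the dual basis and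
  1 + c, 1 + d > 0; that of the edge from \<open>s 2\<close> to \<open>s 3\<close> gives 1 + c + d >
  0.\<close>

lemma quadrilateral_bilinear_coordinates:
  assumes "convex_quadrilateral \<Delta> s"
  obtains e f c d where "bilinear_coordinates (s 2 - s 1) (s 4 - s 1) e f c d"
    "s 3 = s 1 + (s 2 - s 1) + (s 4 - s 1) + (c *\<^sub>R (s 2 - s 1) + d *\<^sub>R (s 4 - s 1))"
    "\<Delta> = convex hull {s 1, s 2, s 3, s 4}" "\<And>k. edge s k face_of \<Delta>"
proof -
  have poly: "polytope \<Delta>" and inj: "inj s" and ext: "{x. x extreme_point_of \<Delta>} = range s"
    and face: "\<And>k. edge s k face_of \<Delta>"
    using assms by (auto simp: convex_quadrilateral_def edge_of_def)
  have s\<Delta>: "s l \<in> \<Delta>" and sx: "s l extreme_point_of \<Delta>" for l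
    using ext by (auto simp: extreme_point_of_def)
  have normal: "\<exists>n. \<forall>l. n \<bullet> (s l - s k) \<ge> 0 \<and> (n \<bullet> (s l - s k) = 0 \<longleftrightarrow> l = k \<or> l = k + 1)" for k
  proof -
    have "edge s k exposed_face_of \<Delta>"
      using exposed_face_of_polyhedron[OF polytope_imp_polyhedron[OF poly]] face by blast
    then obtain a b where ab: "\<Delta> \<subseteq> {x. a \<bullet> x \<le> b}" "edge s k = \<Delta> \<inter> {x. a \<bullet> x = b}"
      by (auto simp: exposed_face_of_def)
    have "s k \<in> edge s k" "s (k + 1) \<in> edge s k"
      by (auto simp: edge_def)
    then have b: "a \<bullet> s k = b" "a \<bullet> s (k + 1) = b"
      using ab(2) by auto
    have eq: "l = k \<or> l = k + 1" if "a \<bullet> s l = b" for l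
    proof -
      have "s l \<in> edge s k"
        using ab(2) s\<Delta> that by auto
      \<comment> \<open>An extreme point of \<Delta> on the edge is extreme in the edge, hence one
        of its end points.\<close>
      then have "s l extreme_point_of edge s k"
        using extreme_point_of_face[OF face] sx by blast
      then show ?thesis
        unfolding edge_def extreme_point_of_segment using inj by (auto dest: injD)
    qed
    have le: "a \<bullet> s l \<le> b" for l
      using ab(1) s\<Delta> by auto
    have "- a \<bullet> (s l - s k) \<ge> 0 \<and> (- a \<bullet> (s l - s k) = 0 \<longleftrightarrow> l = k \<or> l = k + 1)" for l
    proof -
      have "- a \<bullet> (s l - s k) = b - a \<bullet> s l"
        by (simp add: inner_diff_right b)
      moreover have "a \<bullet> s l = b \<longleftrightarrow> l = k \<or> l = k + 1"
        using eq[of l] b by blast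
      ultimately show ?thesis
        using le[of l] by (simp add: eq_commute[of b])
    qed
    then show ?thesis
      by (intro exI[of _ "- a"] allI)
  qed
  have plus: "(1::4) + 1 = 2" "(2::4) + 1 = 3" "(4::4) + 1 = 1"
    by simp_all
  obtain n1 where n1: "\<And>l. n1 \<bullet> (s l - s 1) \<ge> 0" "\<And>l. n1 \<bullet> (s l - s 1) = 0 \<longleftrightarrow> l = 1 \<or> l = 2"
  proof -
    obtain n where "\<forall>l. n \<bullet> (s l - s 1) \<ge> 0 \<and> (n \<bullet> (s l - s 1) = 0 \<longleftrightarrow> l = 1 \<or> l = 2)"
      using normal[of 1, unfolded plus] by (rule exE)
    then show ?thesis
      by (intro that[of n]) simp_all
  qed
  obtain n2 where n2: "\<And>l. n2 \<bullet> (s l - s 2) \<ge> 0" "\<And>l. n2 \<bullet> (s l - s 2) = 0 \<longleftrightarrow> l = 2 \<or> l = 3"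
  proof -
    obtain n where "\<forall>l. n \<bullet> (s l - s 2) \<ge> 0 \<and> (n \<bullet> (s l - s 2) = 0 \<longleftrightarrow> l = 2 \<or> l = 3)"
      using normal[of 2, unfolded plus] by (rule exE)
    then show ?thesis
      by (intro that[of n]) simp_all
  qed
  obtain n4 where n4: "\<And>l. n4 \<bullet> (s l - s 4) \<ge> 0" "\<And>l. n4 \<bullet> (s l - s 4) = 0 \<longleftrightarrow> l = 4 \<or> l = 1"
  proof -
    obtain n where "\<forall>l. n \<bullet> (s l - s 4) \<ge> 0 \<and> (n \<bullet> (s l - s 4) = 0 \<longleftrightarrow> l = 4 \<or> l = 1)"
      using normal[of 4, unfolded plus] by (rule exE)
    then show ?thesis
      by (intro that[of n]) simp_all
  qed
  define Q R where "Q = s 2 - s 1" and "R = s 4 - s 1"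
  have n1': "n1 \<bullet> Q = 0" "n1 \<bullet> R > 0" "n1 \<bullet> (s 3 - s 1) > 0"
    using n1(1)[of 4] n1(1)[of 3] n1(2)[of 2] n1(2)[of 3] n1(2)[of 4]
    by (auto simp: Q_def R_def less_le)
  have n4': "n4 \<bullet> R = 0" "n4 \<bullet> Q > 0" "n4 \<bullet> (s 3 - s 1) > 0"
  proof -
    have 1: "n4 \<bullet> (s 1 - s 4) = 0" using n4(2) by simp
    then show "n4 \<bullet> R = 0" by (simp add: R_def inner_diff_right)
    have "n4 \<bullet> (s 2 - s 4) > 0" "n4 \<bullet> (s 3 - s 4) > 0"
      using n4(1)[of 2] n4(1)[of 3] n4(2)[of 2] n4(2)[of 3] by (auto simp: less_le)
    with 1 show "n4 \<bullet> Q > 0" "n4 \<bullet> (s 3 - s 1) > 0"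
      by (auto simp: Q_def inner_diff_right)
  qed
  have n2': "n2 \<bullet> Q < 0" "n2 \<bullet> (R - Q) > 0" "n2 \<bullet> (s 3 - s 1 - Q) = 0"
  proof -
    have "n2 \<bullet> (s 1 - s 2) > 0" "n2 \<bullet> (s 4 - s 2) > 0" "n2 \<bullet> (s 3 - s 2) = 0"
      using n2(1)[of 1] n2(1)[of 4] n2(2)[of 1] n2(2)[of 4] n2(2)[of 3] by (auto simp: less_le)
    then show "n2 \<bullet> Q < 0" "n2 \<bullet> (R - Q) > 0" "n2 \<bullet> (s 3 - s 1 - Q) = 0"
      by (auto simp: Q_def R_def inner_diff_right)
  qed
  define e f where "e = (1 / (n4 \<bullet> Q)) *\<^sub>R n4" and "f = (1 / (n1 \<bullet> R)) *\<^sub>R n1"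
  have dual: "e \<bullet> Q = 1" "e \<bullet> R = 0" "f \<bullet> Q = 0" "f \<bullet> R = 1"
    using n1' n4' by (simp_all add: e_def f_def)
  define c d where "c = e \<bullet> (s 3 - s 1) - 1" and "d = f \<bullet> (s 3 - s 1) - 1"
  have pos: "1 + c > 0" "1 + d > 0"
    using n1' n4' by (simp_all add: c_def d_def e_def f_def)
  have basis: "e $ i * Q $ j + f $ i * R $ j = (if i = j then 1 else 0)" for i j
  proof -
    define M N :: "real^2^2" where "M = (\<chi> i j. if i = 1 then e $ j else f $ j)"
      and "N = (\<chi> i j. if j = 1 then Q $ i else R $ i)"
    have "M ** N = mat 1"
      using dual by (simp add: M_def N_def vec_eq_iff forall_2 matrix_matrix_mult_def mat_def sum_2 inner_vec_def)
    then have "N ** M = mat 1"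
      by (simp add: matrix_left_right_inverse)
    then have "(N ** M) $ j $ i = mat 1 $ j $ i" by simp
    then show ?thesis
      by (simp add: M_def N_def matrix_matrix_mult_def mat_def sum_2 mult.commute eq_commute)
  qed
  have s3: "s 3 - s 1 = (1 + c) *\<^sub>R Q + (1 + d) *\<^sub>R R"
    using dual_basis_expand[OF basis, of "s 3 - s 1"] by (simp add: c_def d_def)
  have "1 + c + d > 0"
  proof -
    have "c * (n2 \<bullet> Q) + (1 + d) * (n2 \<bullet> R) = 0"
      using n2'(3) unfolding s3 by (simp add: inner_simps algebra_simps)
    moreover have "(1 + d) * (n2 \<bullet> Q) < (1 + d) * (n2 \<bullet> R)"
      using n2'(2) pos by (simp add: inner_diff_right)
    ultimately have "(1 + c + d) * (n2 \<bullet> Q) < 0"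
      by (simp add: algebra_simps)
    then show ?thesis
      using n2'(1) by (simp add: mult_less_0_iff)
  qed
  with pos basis dual have "bilinear_coordinates Q R e f c d"
    by unfold_locales
  moreover have "s 3 = s 1 + Q + R + (c *\<^sub>R Q + d *\<^sub>R R)"
    using s3 by (simp add: algebra_simps)
  moreover have "\<Delta> = convex hull {s 1, s 2, s 3, s 4}"
    using Krein_Milman_Minkowski[OF polytope_imp_compact[OF poly] polytope_imp_convex[OF poly]]
    unfolding ext by (simp add: UNIV_4 insert_commute)
  ultimately show ?thesis
    using that face unfolding Q_def R_def by blast
qed

text \<open>Componentwise, z \<mapsto> w / z is a smooth involution of the positive orthant, so it
  serves as its own slice chart and carries the set back to T \<inter> W. The lengths of labels are
  reciprocals of slopes, and slopes form a linear space.\<close>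

lemma submanifold_reciprocals:
  fixes T W :: "(real^4) set" and w :: "real^4"
  assumes T: "subspace T" "dim T = k" and W: "open W" "\<And>r i. r \<in> W \<Longrightarrow> r $ i > 0" and w: "\<And>i. w $ i > 0"
  shows "submanifold k ((\<lambda>r. \<chi> i. w $ i / r $ i) ` (T \<inter> W))"
proof -
  define F :: "real^4 \<Rightarrow> real^4" where "F = (\<lambda>r. \<chi> i. w $ i / r $ i)"
  define Pos where "Pos = {z :: real^4. \<forall>i. z $ i > 0}"
  have Pos: "open Pos"
  proof -
    have "Pos = (\<Inter>i. {z. z $ i > 0})"
      by (auto simp: Pos_def)
    then show ?thesis
      by (auto intro!: open_INT open_Collect_less continuous_intros)
  qed
  have Ck: "Ck_on n V F" if "open V" "V \<subseteq> Pos" for n V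
  proof (rule Ck_on_vec_nth[OF _ that(1)])
    fix i
    have "Ck_on n V (\<lambda>r. w $ i / r $ i)"
      by (rule Ck_on_divide[OF that(1) Ck_on_const Ck_on_linear[OF bounded_linear_vec_nth]])
        (use that(2) in \<open>auto simp: Pos_def less_imp_neq[symmetric]\<close>)
    then show "Ck_on n V (\<lambda>r. F r $ i)" by (simp add: F_def)
  qed
  have FF: "F (F z) = z" if "z \<in> Pos" for z
    using that w by (auto simp: F_def Pos_def vec_eq_iff less_imp_neq[symmetric])
  have FO: "F z \<in> Pos" if "z \<in> Pos" for z
    using that w by (auto simp: F_def Pos_def)
  have WO: "W \<subseteq> Pos"
    using W(2) by (auto simp: Pos_def)
  define U where "U = Pos \<inter> F -` W"
  have U: "open U"
    unfolding U_def
    by (rule continuous_open_preimage[OF Ck_on_imp_continuous_on[OF Ck[OF Pos order_refl, of 0]] Pos W(1)])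
  have UO: "U \<subseteq> Pos" by (auto simp: U_def)
  have FU: "F ` U = W" and FW: "F ` W = U"
    using FF FO WO by (force simp: U_def)+
  have hom: "homeomorphism U W F F"
    unfolding homeomorphism_def
    using FU FW FF UO WO Ck[OF U UO, of 0] Ck[OF W(1) WO, of 0] by auto
  have "\<exists>U V (F :: real^4 \<Rightarrow> real^4) F' T'. z \<in> U \<and> smooth_on U F \<and> smooth_on V F' \<and>
        homeomorphism U V F F' \<and> subspace T' \<and> dim T' = k \<and> F ` (F0 ` (T \<inter> W) \<inter> U) = T' \<inter> V"
    if z: "z \<in> F0 ` (T \<inter> W)" and F0: "F0 = F" for z F0
  proof (rule exI[of _ U], rule exI[of _ W], rule exI[of _ F], rule exI[of _ F], rule exI[of _ T], intro conjI)
    show "z \<in> U" using z FW unfolding F0 by blast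
    show "smooth_on U F" "smooth_on W F"
      unfolding smooth_on_def using U W(1) Ck[OF U UO] Ck[OF W(1) WO] by auto
    have "F ` (T \<inter> W) \<inter> U = F ` (T \<inter> W)"
      using FW by blast
    moreover have "F ` (F ` (T \<inter> W)) = T \<inter> W"
      using FF WO by (force simp: image_iff)
    ultimately show "F ` (F0 ` (T \<inter> W) \<inter> U) = T \<inter> W"
      unfolding F0 by simp
  qed (use hom T in auto)
  then show ?thesis
    unfolding submanifold_def F_def by blast
qed

section \<open>The cone of labels\<close>

context bilinear_coordinates
begin

definition nrm :: "4 \<Rightarrow> real^2" where
  "nrm k = (if k = 1 then Yv 0 else if k = 2 then - Xv 1 else if k = 3 then - Yv 1 else Xv 0)"

text \<open>The coordinates \<open>r\<close> stand for the absolute values of the end slopes of the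
  profiles; in them the families of labels are cut out by linear subspaces.\<close>

definition label :: "real^4 \<Rightarrow> 4 \<Rightarrow> real^2" where
  "label r k = (2 / r $ k) *\<^sub>R nrm k"

lemma nrm_simps: "nrm 1 = Yv 0" "nrm 2 = - Xv 1" "nrm 3 = - Yv 1" "nrm 4 = Xv 0"
  by (simp_all add: nrm_def)

lemma nrm_nonzero: "nrm k \<noteq> 0"
proof -
  have "Yv 0 \<bullet> qv 0 = 1" "Xv 1 \<bullet> pv 0 = 1 + d" "Yv 1 \<bullet> qv 0 = 1 + c" "Xv 0 \<bullet> pv 0 = 1"
    by (simp_all add: XY_pq)
  then have "nrm 1 \<noteq> 0 \<and> nrm 2 \<noteq> 0 \<and> nrm 3 \<noteq> 0 \<and> nrm 4 \<noteq> 0"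
    unfolding nrm_simps using cd by auto
  then show ?thesis
    using forall_4[of "\<lambda>k. nrm k \<noteq> 0"] by simp
qed

text \<open>These are unscaled edge functions in bilinear coordinates. At (X, Y) the same
  expressions are the end slopes of the monotone profiles, up to sign.\<close>

lemma nrm_pt:
  "nrm 1 \<bullet> (pt x y - P) = y * (1 + d * x)"
  "nrm 2 \<bullet> (pt x y - (P + Q)) = (1 - x) * (1 + c * y + d)"
  "nrm 3 \<bullet> (pt x y - (P + Q + R + S)) = (1 - y) * (1 + d * x + c)"
  "nrm 4 \<bullet> (pt x y - (P + R)) = x * (1 + c * y)"
  by (simp_all add: nrm_simps Xv_def Yv_def pt_def inner_simps dual dot_simps algebra_simps)

lemma label_labelling:
  assumes s: "s 1 = P" "s 2 = P + Q" "s 3 = P + Q + R + S" "s (4::4) = P + R"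
    and r: "\<And>k. r $ k > 0"
  shows "labelling quad s (label r)"
proof -
  have pt: "\<mu> = pt (xc \<mu>) (yc \<mu>)" if "\<mu> \<in> quad" for \<mu>
    by (rule quad_coords(2)[OF that])
  have "nrm k \<bullet> (\<mu> - s k) \<ge> 0 \<and> (\<mu> \<in> edge s k \<longrightarrow> nrm k \<bullet> (\<mu> - s k) = 0)" if \<mu>: "\<mu> \<in> quad" for k \<mu>
  proof -
    note c = quad_coords(3-6)[OF \<mu>]
    note j = jacobian_pos[OF c]
    have "nrm 1 \<bullet> (\<mu> - s 1) = yc \<mu> * (1 + d * xc \<mu>)"
      "nrm 2 \<bullet> (\<mu> - s 2) = (1 - xc \<mu>) * (1 + c * yc \<mu> + d)"
      "nrm 3 \<bullet> (\<mu> - s 3) = (1 - yc \<mu>) * (1 + d * xc \<mu> + c)"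
      "nrm 4 \<bullet> (\<mu> - s 4) = xc \<mu> * (1 + c * yc \<mu>)"
      unfolding s by (subst pt[OF \<mu>], rule nrm_pt)+
    then have "\<forall>k. nrm k \<bullet> (\<mu> - s k) \<ge> 0 \<and> (\<mu> \<in> edge s k \<longrightarrow> nrm k \<bullet> (\<mu> - s k) = 0)"
      unfolding forall_4 edge_coords[OF s] using c j by (auto simp: add.commute add.left_commute)
    then show ?thesis by blast
  qed
  then have n: "nrm k \<bullet> \<mu> \<le> nrm k \<bullet> \<nu>" if "\<mu> \<in> edge s k" "\<mu> \<in> quad" "\<nu> \<in> quad" for k \<mu> \<nu>
    using that by (force simp: inner_diff_right)
  have sub: "edge s k \<subseteq> quad" for k
  proof -
    have "\<forall>k. edge s k \<subseteq> quad"
      unfolding forall_4 edge_coords[OF s] by auto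
    then show ?thesis by blast
  qed
  show ?thesis
    unfolding labelling_def inward_normal_def
  proof (intro allI conjI ballI)
    fix k
    show "label r k \<noteq> 0"
      using nrm_nonzero[of k] r[of k] by (simp add: label_def)
    fix \<mu> \<nu> assume "\<mu> \<in> edge s k" "\<nu> \<in> quad"
    then have "nrm k \<bullet> \<mu> \<le> nrm k \<bullet> \<nu>"
      using n sub by blast
    then have "2 / r $ k * (nrm k \<bullet> \<mu>) \<le> 2 / r $ k * (nrm k \<bullet> \<nu>)"
      by (rule mult_left_mono) (use r[of k] in simp)
    then show "label r k \<bullet> \<mu> \<le> label r k \<bullet> \<nu>"
      by (simp only: label_def inner_scaleR_left)
  qed
qed

lemma label_lengths_label:
  assumes "\<And>k. r $ k > 0"
  shows "label_lengths (label r) = (\<chi> k. (\<chi> k. 2 * norm (nrm k)) $ k / r $ k)"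
  using assms by (simp add: label_lengths_def label_def vec_eq_iff less_imp_le)

lemma cone_of_normals_label:
  assumes s: "s 1 = P" "s 2 = P + Q" "s 3 = P + Q + R + S" "s (4::4) = P + R"
    and T: "subspace T" "dim T = k" "T \<inter> W \<noteq> {}"
    and W: "open W" "\<And>r i. r \<in> W \<Longrightarrow> r $ i > 0" "\<And>r t. r \<in> W \<Longrightarrow> t > 0 \<Longrightarrow> t *\<^sub>R r \<in> W"
  shows "cone_of_normals quad s k (label ` (T \<inter> W))"
  unfolding cone_of_normals_def
proof (intro conjI ballI allI impI)
  show "label ` (T \<inter> W) \<noteq> {}" using T by simp
  show "labelling quad s u" if "u \<in> label ` (T \<inter> W)" for u
    using that label_labelling[OF s] W(2) by blast
  show "(\<lambda>k. t *\<^sub>R u k) \<in> label ` (T \<inter> W)" if u: "u \<in> label ` (T \<inter> W)" and t: "t > 0" for u t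
  proof -
    obtain r where r: "r \<in> T" "r \<in> W" "u = label r"
      using u by blast
    have "(1 / t) *\<^sub>R r \<in> T \<inter> W"
      using r W(3)[of r "1 / t"] t subspace_scale[OF T(1)] by simp
    moreover have "(\<lambda>k. t *\<^sub>R u k) = label ((1 / t) *\<^sub>R r)"
      using t by (simp add: label_def r(3) fun_eq_iff)
    ultimately show ?thesis by blast
  qed
  have "label_lengths ` label ` (T \<inter> W) = (\<lambda>r. \<chi> k. (\<chi> k. 2 * norm (nrm k)) $ k / r $ k) ` (T \<inter> W)"
    unfolding image_image by (rule image_cong[OF refl]) (use W(2) label_lengths_label in blast)
  then show "submanifold k (label_lengths ` label ` (T \<inter> W))"
    using submanifold_reciprocals[OF T(1,2) W(1,2), of "\<chi> k. 2 * norm (nrm k)"] nrm_nonzero by simp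
qed

text \<open>The edge function of a label is 2 / r times the unscaled one, so slopes proportional to
  the unscaled values at a point make all edge functions equal to 2 / t there.\<close>

lemma monotone_label:
  assumes s: "s 1 = P" "s 2 = P + Q" "s 3 = P + Q + R + S" "s (4::4) = P + R"
    and xy: "0 \<le> x" "x \<le> 1" "0 \<le> y" "y \<le> 1"
    and r: "\<And>k. r $ k = t * (nrm k \<bullet> (pt x y - s k))" "\<And>k. r $ k > 0"
  shows "monotone_labelling quad s (label r)"
proof -
  have "edge_function s (label r) k (pt x y) = 2 / t" for k
    using r(2)[of k] unfolding edge_function_def label_def r(1) by auto
  then show ?thesis
    unfolding monotone_labelling_def by (intro bexI[OF _ pt_in_quad[OF xy]]) simp
qed

theorem cone_exists:
  assumes s: "s 1 = P" "s 2 = P + Q" "s 3 = P + Q + R + S" "s (4::4) = P + R"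
    and faces: "\<And>k. edge s k face_of quad" and a: "a \<bullet> S = 0"
  shows "\<exists>C. cone_of_normals quad s 2 C \<and>
    (\<forall>u\<in>C. \<exists>g. generalized_KRS quad s u g a \<and>
       (\<exists>\<psi>. hamiltonian_2form (toric_domain quad) g (complex_structure g toric_form) toric_form \<psi>)) \<and>
    (\<exists>C'\<subseteq>C. cone_of_normals quad s 1 C' \<and> (\<forall>u\<in>C'. monotone_labelling quad s u))"
proof -
  define \<alpha> \<beta> where "\<alpha> = a \<bullet> Q" and "\<beta> = a \<bullet> R"
  obtain X Y A0 B0 where XY: "0 < X" "X < 1" "0 < Y" "Y < 1"
    and A0: "A0 0 = 0" "A0 1 = 0" "\<And>x. 0 < x \<Longrightarrow> x < 1 \<Longrightarrow> A0 x > 0"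
      "\<And>x. (A0 has_real_derivative 2 * \<alpha> * A0 x - (x - X) * (1 + c * Y + d * x)) (at x)"
    and B0: "B0 0 = 0" "B0 1 = 0" "\<And>x. 0 < x \<Longrightarrow> x < 1 \<Longrightarrow> B0 x > 0"
      "\<And>x. (B0 has_real_derivative 2 * \<beta> * B0 x - (x - Y) * (1 + d * X + c * x)) (at x)"
    by (rule monotone_profiles_exist[OF cd, of \<alpha> \<beta>]) (rule that)
  obtain X1 At where X1: "0 < X1" "X1 < 1" and At: "At 0 = 0" "At 1 = 0"
      "\<And>x. (At has_real_derivative 2 * \<alpha> * At x - (x - X1)) (at x)"
    by (rule torsion_profile_exists[of \<alpha>]) (rule that)
  obtain Y1 Bt where Y1: "0 < Y1" "Y1 < 1" and Bt: "Bt 0 = 0" "Bt 1 = 0"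
      "\<And>x. (Bt has_real_derivative 2 * \<beta> * Bt x - (x - Y1)) (at x)"
    by (rule torsion_profile_exists[of \<beta>]) (rule that)
  have j: "1 + c * Y > 0" "1 + c * Y + d > 0" "1 + d * X > 0" "1 + d * X + c > 0"
    using jacobian_pos[of X Y] XY by (auto simp: add.commute add.left_commute)
  \<comment> \<open>The slopes B'(0), - A'(1), - B'(1), A'(0), in the order of the edges, for the
    pair (A0, B0) and for the pair (At, - Bt).\<close>
  define \<rho>0 \<rho>1 :: "real^4" where
    "\<rho>0 = vector [Y * (1 + d * X), (1 - X) * (1 + c * Y + d), (1 - Y) * (1 + d * X + c), X * (1 + c * Y)]"
    and "\<rho>1 = vector [- Y1, 1 - X1, - (1 - Y1), X1]"
  have \<rho>0: "\<rho>0 $ 1 = Y * (1 + d * X)" "\<rho>0 $ 2 = (1 - X) * (1 + c * Y + d)"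
      "\<rho>0 $ 3 = (1 - Y) * (1 + d * X + c)" "\<rho>0 $ 4 = X * (1 + c * Y)"
    and \<rho>1: "\<rho>1 $ 1 = - Y1" "\<rho>1 $ 2 = 1 - X1" "\<rho>1 $ 3 = - (1 - Y1)" "\<rho>1 $ 4 = X1"
    by (simp_all add: \<rho>0_def \<rho>1_def vector_def)
  have \<rho>0_pos: "\<rho>0 $ k > 0" for k
  proof -
    have "\<forall>k. \<rho>0 $ k > 0"
      unfolding forall_4 \<rho>0 using XY j by simp
    then show ?thesis by blast
  qed
  obtain \<epsilon>1 where \<epsilon>1: "\<epsilon>1 > 0" "\<And>t x. \<bar>t\<bar> < \<epsilon>1 \<Longrightarrow> 0 < x \<Longrightarrow> x < 1 \<Longrightarrow> A0 x + t * At x > 0"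
  proof (rule profile_perturbation)
    show "(A0 has_real_derivative X * (1 + c * Y)) (at 0)" "(A0 has_real_derivative - ((1 - X) * (1 + c * Y + d))) (at 1)"
      using A0(4)[of 0] A0(4)[of 1] A0(1,2) by simp_all
    show "(At has_real_derivative X1) (at 0)" "(At has_real_derivative - (1 - X1)) (at 1)"
      using At(3)[of 0] At(3)[of 1] At(1,2) by simp_all
    show "continuous_on {0..1} A0" "continuous_on {0..1} At"
      by (rule continuous_on_if_DERIV, rule A0(4), rule continuous_on_if_DERIV, rule At(3))
  qed (use A0 At XY j that in auto)
  obtain \<epsilon>2 where \<epsilon>2: "\<epsilon>2 > 0" "\<And>t x. \<bar>t\<bar> < \<epsilon>2 \<Longrightarrow> 0 < x \<Longrightarrow> x < 1 \<Longrightarrow> B0 x + t * Bt x > 0"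
  proof (rule profile_perturbation)
    show "(B0 has_real_derivative Y * (1 + d * X)) (at 0)" "(B0 has_real_derivative - ((1 - Y) * (1 + d * X + c))) (at 1)"
      using B0(4)[of 0] B0(4)[of 1] B0(1,2) by simp_all
    show "(Bt has_real_derivative Y1) (at 0)" "(Bt has_real_derivative - (1 - Y1)) (at 1)"
      using Bt(3)[of 0] Bt(3)[of 1] Bt(1,2) by simp_all
    show "continuous_on {0..1} B0" "continuous_on {0..1} Bt"
      by (rule continuous_on_if_DERIV, rule B0(4), rule continuous_on_if_DERIV, rule Bt(3))
  qed (use B0 Bt XY j that in auto)
  define \<epsilon> where "\<epsilon> = min \<epsilon>1 \<epsilon>2"
  have \<epsilon>: "\<epsilon> > 0" using \<epsilon>1 \<epsilon>2 by (simp add: \<epsilon>_def)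
  \<comment> \<open>Linear functionals that recover the coefficients of r = p \<rho>0 + q \<rho>1.
    They are defined on all of \<open>real^4\<close> because \<open>W\<close> must be open there; on
    positive \<open>r\<close>, \<open>sv\<close> is half the average scalar curvature of the
    label.\<close>
  define sv tv :: "real^4 \<Rightarrow> real" where "sv = (\<lambda>r. (r $ 1 + r $ 2 + r $ 3 + r $ 4) / (2 + c + d))"
    and "tv = (\<lambda>r. r $ 2 + r $ 4 - sv r * (\<rho>0 $ 2 + \<rho>0 $ 4))"
  have cd2: "2 + c + d > 0" using cd by simp
  have st0: "sv \<rho>0 = 1" "tv \<rho>0 = 0" and st1: "sv \<rho>1 = 0" "tv \<rho>1 = 1"
  proof -
    have "\<rho>0 $ 1 + \<rho>0 $ 2 + \<rho>0 $ 3 + \<rho>0 $ 4 = 2 + c + d"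
      unfolding \<rho>0 by (simp add: algebra_simps)
    with cd2 show "sv \<rho>0 = 1" "tv \<rho>0 = 0" by (simp_all add: sv_def tv_def)
    show "sv \<rho>1 = 0" "tv \<rho>1 = 1" by (simp_all add: sv_def tv_def \<rho>1)
  qed
  have lin: "sv (x *\<^sub>R v + y *\<^sub>R w) = x * sv v + y * sv w" "tv (x *\<^sub>R v + y *\<^sub>R w) = x * tv v + y * tv w" for x y v w
    by (simp_all add: sv_def tv_def add_divide_distrib algebra_simps)
  have scale: "sv (x *\<^sub>R v) = x * sv v" "tv (x *\<^sub>R v) = x * tv v" for x v
    using lin[of x v 0 v] by simp_all
  \<comment> \<open>On the plane \<open>T\<close> the second condition reads |q| < \<epsilon> p, the
    range in which both perturbed profiles are positive.\<close>
  define W where "W = {r :: real^4. (\<forall>k. r $ k > 0) \<and> \<bar>tv r\<bar> < \<epsilon> * sv r}"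
  have W_open: "open W"
  proof -
    have "W = (\<Inter>k. {r. r $ k > 0}) \<inter> {r. \<bar>tv r\<bar> < \<epsilon> * sv r}"
      by (auto simp: W_def)
    moreover have "continuous_on UNIV sv"
      unfolding sv_def using cd2 by (intro continuous_intros) auto
    then have "open {r. \<bar>tv r\<bar> < \<epsilon> * sv r}"
      unfolding tv_def by (intro open_Collect_less continuous_intros)
    ultimately show ?thesis
      by (auto intro!: open_Int open_INT open_Collect_less continuous_intros)
  qed
  have W_cone: "t *\<^sub>R r \<in> W" if "r \<in> W" "t > 0" for r t
    using that by (auto simp: W_def scale abs_mult mult.left_commute)
  have \<rho>0_W: "\<rho>0 \<in> W"
    using \<rho>0_pos st0 \<epsilon> by (simp add: W_def)
  define T T0 where "T = span {\<rho>0, \<rho>1}" and "T0 = span {\<rho>0}"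
  have T: "\<exists>x y. r = x *\<^sub>R \<rho>0 + y *\<^sub>R \<rho>1" if "r \<in> T" for r
  proof -
    have "r \<in> {r. \<exists>x. r - x *\<^sub>R \<rho>0 \<in> span {\<rho>1}}"
      using that unfolding T_def span_insert .
    then obtain x where "r - x *\<^sub>R \<rho>0 \<in> span {\<rho>1}" by blast
    then obtain y where "r - x *\<^sub>R \<rho>0 = y *\<^sub>R \<rho>1"
      unfolding span_singleton by auto
    then show ?thesis by (intro exI[of _ x] exI[of _ y]) (simp add: algebra_simps)
  qed
  have \<rho>1_nz: "\<rho>1 \<noteq> 0" and \<rho>0_nz: "\<rho>0 \<noteq> 0"
    using \<rho>1(4) X1(1) \<rho>0_pos[of 1] by auto
  have dim: "dim T = 2" "dim T0 = 1"
  proof -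
    have "\<rho>0 \<notin> span {\<rho>1}"
    proof
      assume "\<rho>0 \<in> span {\<rho>1}"
      then obtain y where "\<rho>0 = y *\<^sub>R \<rho>1"
        unfolding span_singleton by auto
      then have "sv \<rho>0 = y * sv \<rho>1" by (simp only: scale)
      with st0 st1 show False by simp
    qed
    then show "dim T = 2" "dim T0 = 1"
      using \<rho>0_nz \<rho>1_nz by (simp_all add: T_def T0_def dim_span dim_insert)
  qed
  have "T0 \<subseteq> T"
    unfolding T_def T0_def by (intro span_mono) auto
  note cone = cone_of_normals_label[OF s _ _ _ W_open _ W_cone]
  have "cone_of_normals quad s 2 (label ` (T \<inter> W))"
    by (rule cone) (use dim \<rho>0_W in \<open>auto simp: T_def W_def intro: span_base\<close>)
  moreover have "cone_of_normals quad s 1 (label ` (T0 \<inter> W))"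
    by (rule cone) (use dim \<rho>0_W in \<open>auto simp: T0_def W_def intro: span_base\<close>)
  moreover have "label ` (T0 \<inter> W) \<subseteq> label ` (T \<inter> W)"
    using \<open>T0 \<subseteq> T\<close> by blast
  moreover have "monotone_labelling quad s u" if u: "u \<in> label ` (T0 \<inter> W)" for u
  proof -
    obtain r where r: "r \<in> T0" "r \<in> W" "u = label r"
      using u by blast
    obtain t where t: "r = t *\<^sub>R \<rho>0"
      using r(1) unfolding T0_def span_singleton by auto
    have "\<forall>k. \<rho>0 $ k = nrm k \<bullet> (pt X Y - s k)"
      unfolding forall_4 s nrm_pt \<rho>0 by simp
    then have "r $ k = t * (nrm k \<bullet> (pt X Y - s k))" for k
      by (simp add: t)
    moreover have "r $ k > 0" for k
      using r(2) by (simp add: W_def)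
    ultimately show ?thesis
      unfolding r(3) using XY by (intro monotone_label[OF s, of X Y _ t]) auto
  qed
  moreover have "\<exists>g. generalized_KRS quad s u g a \<and>
      (\<exists>\<psi>. hamiltonian_2form (toric_domain quad) g (complex_structure g toric_form) toric_form \<psi>)"
    if u: "u \<in> label ` (T \<inter> W)" for u
  proof -
    obtain r where r: "r \<in> T" "r \<in> W" "u = label r"
      using u by blast
    obtain p q where pq: "r = p *\<^sub>R \<rho>0 + q *\<^sub>R \<rho>1"
      using T[OF r(1)] by blast
    have r_pos: "r $ k > 0" for k
      using r(2) by (simp add: W_def)
    have "sv r = p" "tv r = q"
      unfolding pq lin st0 st1 by simp_all
    with r(2) have "\<bar>q\<bar> < \<epsilon> * p" by (simp add: W_def)
    then have p: "p > 0"
      using \<epsilon> by (smt (verit) zero_less_mult_pos)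
    have qp: "\<bar>q / p\<bar> < \<epsilon>"
      using \<open>\<bar>q\<bar> < \<epsilon> * p\<close> p by (simp add: divide_simps abs_mult)
    \<comment> \<open>The torsion profiles enter \<open>A\<close> and \<open>B\<close> with opposite
      signs, so that their contributions - q and q to A'' - 2 \<alpha> A' and B'' - 2 \<beta> B'
      cancel in the sum.\<close>
    define A A1 A2 where "A = (\<lambda>x. p * A0 x + q * At x)"
      and "A1 = (\<lambda>x. p * (2 * \<alpha> * A0 x - (x - X) * (1 + c * Y + d * x)) + q * (2 * \<alpha> * At x - (x - X1)))"
      and "A2 = (\<lambda>x. p * (2 * \<alpha> * (2 * \<alpha> * A0 x - (x - X) * (1 + c * Y + d * x)) - ((1 + c * Y + d * x) + (x - X) * d)) +
         q * (2 * \<alpha> * (2 * \<alpha> * At x - (x - X1)) - 1))"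
    define B B1 B2 where "B = (\<lambda>x. p * B0 x - q * Bt x)"
      and "B1 = (\<lambda>x. p * (2 * \<beta> * B0 x - (x - Y) * (1 + d * X + c * x)) - q * (2 * \<beta> * Bt x - (x - Y1)))"
      and "B2 = (\<lambda>x. p * (2 * \<beta> * (2 * \<beta> * B0 x - (x - Y) * (1 + d * X + c * x)) - ((1 + d * X + c * x) + (x - Y) * c)) -
         q * (2 * \<beta> * (2 * \<beta> * Bt x - (x - Y1)) - 1))"
    have id: "Ck_on k U (\<lambda>x::real. x)" for k U
      by (rule Ck_on_linear) simp
    have Ck: "Ck_on k UNIV A0" "Ck_on k UNIV At" "Ck_on k UNIV B0" "Ck_on k UNIV Bt" for k
      by (rule Ck_on_profile[OF A0(4)[unfolded diff_conv_add_uminus]]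
          Ck_on_profile[OF At(3)[unfolded diff_conv_add_uminus]]
          Ck_on_profile[OF B0(4)[unfolded diff_conv_add_uminus]]
          Ck_on_profile[OF Bt(3)[unfolded diff_conv_add_uminus]];
          intro Ck_on_intros id open_UNIV)+
    interpret toric_profiles P Q R e f c d A A1 A2 B B1 B2
    proof unfold_locales
      fix x :: real and k :: nat
      show "(A has_real_derivative A1 x) (at x)"
        unfolding A_def A1_def
        by (rule derivative_eq_intros A0(4) At(3) refl)+ (simp add: algebra_simps)
      show "(A1 has_real_derivative A2 x) (at x)"
        unfolding A1_def A2_def
        by (rule derivative_eq_intros A0(4) At(3) refl)+ (simp add: algebra_simps)
      show "(B has_real_derivative B1 x) (at x)"
        unfolding B_def B1_def
        by (rule derivative_eq_intros B0(4) Bt(3) refl)+ (simp add: algebra_simps)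
      show "(B1 has_real_derivative B2 x) (at x)"
        unfolding B1_def B2_def
        by (rule derivative_eq_intros B0(4) Bt(3) refl)+ (simp add: algebra_simps)
      show "Ck_on k UNIV A" "Ck_on k UNIV B"
        unfolding A_def B_def by (intro Ck_on_intros Ck open_UNIV)+
      show "A 0 = 0" "A 1 = 0" "B 0 = 0" "B 1 = 0"
        using A0 At B0 Bt by (simp_all add: A_def B_def)
      show "A x > 0" "B x > 0" if "0 < x" "x < 1"
      proof -
        have "p * (A0 x + q / p * At x) > 0" "p * (B0 x + - (q / p) * Bt x) > 0"
          using \<epsilon>1(2)[of "q / p" x] \<epsilon>2(2)[of "- (q / p)" x] qp p that by (simp_all add: \<epsilon>_def)
        then show "A x > 0" "B x > 0"
          using p by (simp_all add: A_def B_def distrib_left right_diff_distrib)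
      qed
    qed
    have ends: "B1 0 = r $ 1" "A1 1 = - r $ 2" "B1 1 = - r $ 3" "A1 0 = r $ 4"
      unfolding pq vector_add_component vector_scaleR_component \<rho>0 \<rho>1
      by (simp_all add: A1_def B1_def A0 At B0 Bt algebra_simps)
    have labels: "labels u"
      unfolding labels_def ends r(3) label_def nrm_simps by simp
    have nz: "A1 0 \<noteq> 0" "A1 1 \<noteq> 0" "B1 0 \<noteq> 0" "B1 1 \<noteq> 0"
      unfolding ends using r_pos by (simp_all add: less_imp_neq[symmetric])
    have "average_scal quad s u = 2 * (\<bar>B1 0\<bar> + \<bar>A1 1\<bar> + \<bar>B1 1\<bar> + \<bar>A1 0\<bar>) / (2 + c + d)"
      using labels nz unfolding labels_def by (intro average_scal_quad[OF s]) auto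
    also have "\<dots> = 2 * sv r"
      unfolding ends sv_def using r_pos by (simp add: abs_of_pos)
    finally have av: "average_scal quad s u = 2 * p"
      using \<open>sv r = p\<close> by simp
    \<comment> \<open>The sum of (1 + c Y + d x) + (x - X) d and (1 + d X + c y) + (y - Y) c is 2 (1
      + c y + d x): the terms with X and Y cancel.\<close>
    have "- (A2 x + B2 y) + 2 * ((a \<bullet> Q) * A1 x + (a \<bullet> R) * B1 y) = average_scal quad s u * (1 + c * y + d * x)" for x y
      unfolding av A2_def B2_def A1_def B1_def \<alpha>_def[symmetric] \<beta>_def[symmetric]
      by (simp add: algebra_simps)
    then show ?thesis
      by (rule soliton_exists[OF s faces labels nz a])
  qed
  ultimately show ?thesis by blast
qed

end

theorem proposition1p7:
  fixes \<Delta> :: "(real^2) set" and s :: "4 \<Rightarrow> real^2" and a :: "real^2"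
  assumes "convex_quadrilateral \<Delta> s"
    and "equipoised s (\<lambda>x. a \<bullet> x)"
  shows "\<exists>C. cone_of_normals \<Delta> s 2 C \<and>
    (\<forall>u\<in>C. \<exists>g. generalized_KRS \<Delta> s u g a \<and>
       (\<exists>\<psi>. hamiltonian_2form (toric_domain \<Delta>) g (complex_structure g toric_form) toric_form \<psi>)) \<and>
    (\<exists>C'\<subseteq>C. cone_of_normals \<Delta> s 1 C' \<and> (\<forall>u\<in>C'. monotone_labelling \<Delta> s u))"
proof -
  obtain e f c d where coords: "bilinear_coordinates (s 2 - s 1) (s 4 - s 1) e f c d"
    and s3: "s 3 = s 1 + (s 2 - s 1) + (s 4 - s 1) + (c *\<^sub>R (s 2 - s 1) + d *\<^sub>R (s 4 - s 1))"
    and \<Delta>: "\<Delta> = convex hull {s 1, s 2, s 3, s 4}" and faces: "\<And>k. edge s k face_of \<Delta>"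
    by (rule quadrilateral_bilinear_coordinates[OF assms(1)]) (rule that)
  interpret bilinear_coordinates "s 1" "s 2 - s 1" "s 4 - s 1" e f c d
    by (rule coords)
  have S: "s 3 = s 1 + (s 2 - s 1) + (s 4 - s 1) + S"
    using s3 by (simp add: S_def)
  have q: "\<Delta> = quad"
    unfolding \<Delta> quad_def S[symmetric] by simp
  \<comment> \<open>The alternating sum of the vertices is - S, so this is what equipoised
    means.\<close>
  have "a \<bullet> S = 0"
    using assms(2) S by (simp add: equipoised_def inner_simps)
  then show ?thesis
    using faces S unfolding q by (intro cone_exists) auto
qed

end
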